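(* Let $\mathcal{L}$ be an operator on $\mathbb{R}^n$ satisfying the standing assumptions listed in the context, left translation invariant on the Lie group $\mathbb{G}=(\mathbb{R}^n,\circ)$. Assume that $\mathbb{G}$ is a homogeneous Lie group with dilations $(\delta_\lambda)_{\lambda>0}$ and homogeneous dimension $Q\ge 3$, and that $\mathcal{L}$ is homogeneous of degree two with respect to the dilations of $\mathbb{G}$. (a) Let $u\in L^1_{\mathrm{loc}}(\mathbb{R}^n,\mathbb{R})$ be a solution to $\mathcal{L}u\ge 0$ in $\mathbb{R}^n$ in the weak sense of distributions. If $u\in L^p(\mathbb{R}^n,\mathbb{R})$ for some $p\in\left[1,1+\frac{2}{Q-2}\right]$, then $u=0$ almost everywhere in $\mathbb{R}^n$. (b) For every real $p>1+\frac{2}{Q-2}$ there exists $u\in L^p(\mathbb{R}^n,\mathbb{R})$, $u\le 0$, $u\not\equiv 0$, such that $\mathcal{L}u\ge 0$ in $\mathbb{R}^n$ in the weak sense of distributions.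
   Context: Standing assumptions. $\mathcal{L}:=\mathrm{div}(A\nabla)+\langle b,\nabla\rangle$ is a linear second order partial differential operator on $\mathbb{R}^n$, where $A=(a_{ij})_{i,j=1,\dots,n}$ is a symmetric $n\times n$ matrix with entries $a_{ij}\in C^\infty(\mathbb{R}^n,\mathbb{R})$, $b=(b_1,\dots,b_n)$ has components $b_j\in C^\infty(\mathbb{R}^n,\mathbb{R})$, and $\mathrm{div}$, $\nabla$, $\langle\cdot,\cdot\rangle$ are the Euclidean divergence, gradient and inner product. It is assumed that $\langle A(x)\xi,\xi\rangle\ge 0$ for all $x,\xi\in\mathbb{R}^n$ and $\mathrm{trace}\,A(0)>0$. Moreover: (1) $\mathcal{L}$ is hypoelliptic: if $w$ is a distribution on an open set $\Omega\subseteq\mathbb{R}^n$ and $\mathcal{L}w$ is smooth in $\Omega$, then $w$ is smooth in $\Omega$. (2) There is a Lie group $\mathbb{G}=(\mathbb{R}^n,\circ)$ such that $\mathcal{L}$ is left translation invariant on $\mathbb{G}$, i.e. $\mathcal{L}(w(\alpha\circ\cdot))(x)=(\mathcal{L}w)(\alpha\circ x)$ for all $\alpha,x\in\mathbb{R}^n$ and all $w\in C^\infty(\mathbb{R}^n,\mathbb{R})$. (3) The Lebesgue measure on $\mathbb{R}^n$ is both left and right invariant on $\mathbb{G}$ (this is automatic when $\mathbb{G}$ is homogeneous). Homogeneous Lie group: there are real numbers $1\le\sigma_1\le\dots\le\sigma_n$ such that $\delta_\lambda(x_1,\dots,x_n)=(\lambda^{\sigma_1}x_1,\dots,\lambda^{\sigma_n}x_n)$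 is an automorphism of $\mathbb{G}$ for every $\lambda>0$. The homogeneous dimension of $\mathbb{G}$ is $Q=\sigma_1+\dots+\sigma_n$. $\mathcal{L}$ is homogeneous of degree two with respect to the dilations if $\mathcal{L}(w\circ\delta_\lambda)(x)=\lambda^2(\mathcal{L}w)(\delta_\lambda(x))$ (here $w\circ\delta_\lambda$ is composition of maps) for all $w\in C^\infty(\mathbb{R}^n,\mathbb{R})$, $x\in\mathbb{R}^n$, $\lambda>0$. For $u\in L^1_{\mathrm{loc}}$, "$\mathcal{L}u\ge 0$ in the weak sense of distributions" means $\int_{\mathbb{R}^n}u\,\mathcal{L}^*\varphi\,dx\ge 0$ for every $\varphi\in C_0^\infty(\mathbb{R}^n,\mathbb{R})$ with $\varphi\ge 0$, where $\mathcal{L}^*\varphi=\mathrm{div}(A\nabla\varphi)-\mathrm{div}(b\varphi)$ is the formal adjoint of $\mathcal{L}$. $L^p$ is taken with respect to Lebesgue measure. *)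

theory Defs
  imports "HOL-Analysis.Analysis" "HOL-Algebra.Group"
begin

section \<open>Smooth functions\<close>

text \<open>
  Smoothness is only meant for open \<open>S\<close>; then \<open>frechet_derivative f (at x) v\<close> is the derivative
  of \<open>f\<close> at \<open>x\<close> in direction \<open>v\<close>, and \<open>Ck_on k f S\<close> says that \<open>f\<close> is of class
  \<open>C\<close>-\<open>k\<close> on \<open>S\<close>.
\<close>

fun Ck_on :: "nat \<Rightarrow> ('a::euclidean_space \<Rightarrow> 'b::euclidean_space) \<Rightarrow> 'a set \<Rightarrow> bool" where
  "Ck_on 0 f S \<longleftrightarrow> continuous_on S f"
| "Ck_on (Suc k) f S \<longleftrightarrow>
     f differentiable_on S \<and> (\<forall>v. Ck_on k (\<lambda>x. frechet_derivative f (at x) v) S)"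

definition smooth_on :: "'a::euclidean_space set \<Rightarrow> ('a \<Rightarrow> 'b::euclidean_space) \<Rightarrow> bool" where
  "smooth_on S f \<longleftrightarrow> (\<forall>k. Ck_on k f S)"

definition test_functions :: "(real ^ 'n) set \<Rightarrow> (real ^ 'n \<Rightarrow> real) set" where
  "test_functions \<Omega> = {\<phi>. smooth_on UNIV \<phi> \<and> compact (closure {x. \<phi> x \<noteq> 0}) \<and> closure {x. \<phi> x \<noteq> 0} \<subseteq> \<Omega>}"


section \<open>The operator and its formal adjoint\<close>

definition pderiv_at :: "'n \<Rightarrow> (real ^ 'n \<Rightarrow> real) \<Rightarrow> real ^ 'n \<Rightarrow> real" where
  "pderiv_at i f x = frechet_derivative f (at x) (axis i 1)"

definition grad :: "(real ^ 'n \<Rightarrow> real) \<Rightarrow> real ^ 'n \<Rightarrow> real ^ 'n" where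
  "grad f x = (\<chi> i. pderiv_at i f x)"

definition divergence :: "(real ^ 'n \<Rightarrow> real ^ 'n) \<Rightarrow> real ^ 'n \<Rightarrow> real" where
  "divergence F x = (\<Sum>i\<in>UNIV. pderiv_at i (\<lambda>y. F y $ i) x)"

definition op_L ::
  "(real ^ 'n \<Rightarrow> real ^ 'n ^ 'n) \<Rightarrow> (real ^ 'n \<Rightarrow> real ^ 'n) \<Rightarrow> (real ^ 'n \<Rightarrow> real) \<Rightarrow> real ^ 'n \<Rightarrow> real" where
  "op_L A b w x = divergence (\<lambda>y. A y *v grad w y) x + b x \<bullet> grad w x"

definition op_L_adj ::
  "(real ^ 'n \<Rightarrow> real ^ 'n ^ 'n) \<Rightarrow> (real ^ 'n \<Rightarrow> real ^ 'n) \<Rightarrow> (real ^ 'n \<Rightarrow> real) \<Rightarrow> real ^ 'n \<Rightarrow> real" where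
  "op_L_adj A b \<phi> x = divergence (\<lambda>y. A y *v grad \<phi> y) x - divergence (\<lambda>y. \<phi> y *\<^sub>R b y) x"


section \<open>Distributions and hypoellipticity\<close>

text \<open>
  A distribution is a functional on \<open>test_functions \<Omega>\<close>; its values elsewhere are irrelevant.
  Iterated partial derivatives are indexed by lists of coordinates instead of multi-indices, so
  each derivative may be counted several times, which only affects the constant \<open>C\<close>.
\<close>

definition distribution_on :: "(real ^ 'n) set \<Rightarrow> ((real ^ 'n \<Rightarrow> real) \<Rightarrow> real) \<Rightarrow> bool" where
  "distribution_on \<Omega> T \<longleftrightarrow>
     (\<forall>\<phi>\<in>test_functions \<Omega>. \<forall>\<psi>\<in>test_functions \<Omega>. T (\<lambda>x. \<phi> x + \<psi> x) = T \<phi> + T \<psi>) \<and>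
     (\<forall>\<phi>\<in>test_functions \<Omega>. \<forall>c. T (\<lambda>x. c * \<phi> x) = c * T \<phi>) \<and>
     (\<forall>K. compact K \<and> K \<subseteq> \<Omega> \<longrightarrow>
        (\<exists>C N. \<forall>\<phi>\<in>test_functions K.
           \<bar>T \<phi>\<bar> \<le> C * (\<Sum>is\<in>{is. length is \<le> N}. SUP x. \<bar>foldr pderiv_at is \<phi> x\<bar>)))"

definition distribution_smooth_rep ::
  "(real ^ 'n) set \<Rightarrow> ((real ^ 'n \<Rightarrow> real) \<Rightarrow> real) \<Rightarrow> bool" where
  "distribution_smooth_rep \<Omega> T \<longleftrightarrow>
     (\<exists>f. smooth_on \<Omega> f \<and> (\<forall>\<phi>\<in>test_functions \<Omega>. T \<phi> = (LINT x:\<Omega>|lebesgue. f x * \<phi> x)))"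

definition hypoelliptic ::
  "(real ^ 'n \<Rightarrow> real ^ 'n ^ 'n) \<Rightarrow> (real ^ 'n \<Rightarrow> real ^ 'n) \<Rightarrow> bool" where
  "hypoelliptic A b \<longleftrightarrow>
     (\<forall>\<Omega> T. open \<Omega> \<and> distribution_on \<Omega> T \<and> distribution_smooth_rep \<Omega> (\<lambda>\<phi>. T (op_L_adj A b \<phi>))
        \<longrightarrow> distribution_smooth_rep \<Omega> T)"


section \<open>Lie groups on Euclidean space\<close>

definition lie_group_Rn :: "(real ^ 'n) monoid \<Rightarrow> bool" where
  "lie_group_Rn G \<longleftrightarrow> group G \<and> carrier G = UNIV \<and>
     smooth_on UNIV (\<lambda>(x, y). x \<otimes>\<^bsub>G\<^esub> y) \<and> smooth_on UNIV (m_inv G)"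

definition left_translation_invariant ::
  "(real ^ 'n) monoid \<Rightarrow> (real ^ 'n \<Rightarrow> real ^ 'n ^ 'n) \<Rightarrow> (real ^ 'n \<Rightarrow> real ^ 'n) \<Rightarrow> bool" where
  "left_translation_invariant G A b \<longleftrightarrow>
     (\<forall>\<alpha> x w. smooth_on UNIV w \<longrightarrow> op_L A b (\<lambda>y. w (\<alpha> \<otimes>\<^bsub>G\<^esub> y)) x = op_L A b w (\<alpha> \<otimes>\<^bsub>G\<^esub> x))"

definition lebesgue_bi_invariant :: "(real ^ 'n) monoid \<Rightarrow> bool" where
  "lebesgue_bi_invariant G \<longleftrightarrow>
     (\<forall>\<alpha>. \<forall>E\<in>sets lebesgue.
        emeasure lebesgue ((\<lambda>x. \<alpha> \<otimes>\<^bsub>G\<^esub> x) ` E) = emeasure lebesgue E \<and>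
        emeasure lebesgue ((\<lambda>x. x \<otimes>\<^bsub>G\<^esub> \<alpha>) ` E) = emeasure lebesgue E)"

definition dilation :: "('n \<Rightarrow> real) \<Rightarrow> real \<Rightarrow> real ^ 'n \<Rightarrow> real ^ 'n" where
  "dilation \<sigma> r x = (\<chi> i. r powr \<sigma> i * x $ i)"

text \<open>The linear order on the index type plays the role of the usual order on \<open>{1..n}\<close>.\<close>

definition homogeneous_group :: "(real ^ 'n::{finite,linorder}) monoid \<Rightarrow> ('n \<Rightarrow> real) \<Rightarrow> bool" where
  "homogeneous_group G \<sigma> \<longleftrightarrow> lie_group_Rn G \<and>
     (\<forall>i. 1 \<le> \<sigma> i) \<and> mono \<sigma> \<and> (\<forall>r>0. dilation \<sigma> r \<in> iso G G)"

definition homogeneous_dim :: "('n::finite \<Rightarrow> real) \<Rightarrow> real" where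
  "homogeneous_dim \<sigma> = (\<Sum>i\<in>UNIV. \<sigma> i)"

definition homogeneous_degree_two ::
  "('n \<Rightarrow> real) \<Rightarrow> (real ^ 'n \<Rightarrow> real ^ 'n ^ 'n) \<Rightarrow> (real ^ 'n \<Rightarrow> real ^ 'n) \<Rightarrow> bool" where
  "homogeneous_degree_two \<sigma> A b \<longleftrightarrow>
     (\<forall>w x r. smooth_on UNIV w \<and> r > 0 \<longrightarrow>
        op_L A b (w \<circ> dilation \<sigma> r) x = r\<^sup>2 * op_L A b w (dilation \<sigma> r x))"


section \<open>Standing assumptions\<close>

definition admissible_operator ::
  "(real ^ 'n) monoid \<Rightarrow> (real ^ 'n \<Rightarrow> real ^ 'n ^ 'n) \<Rightarrow> (real ^ 'n \<Rightarrow> real ^ 'n) \<Rightarrow> bool" where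
  "admissible_operator G A b \<longleftrightarrow>
     (\<forall>i j. smooth_on UNIV (\<lambda>x. A x $ i $ j)) \<and>
     (\<forall>j. smooth_on UNIV (\<lambda>x. b x $ j)) \<and>
     (\<forall>x. transpose (A x) = A x) \<and>
     (\<forall>x \<xi>. (A x *v \<xi>) \<bullet> \<xi> \<ge> 0) \<and>
     trace (A 0) > 0 \<and>
     hypoelliptic A b \<and>
     lie_group_Rn G \<and>
     left_translation_invariant G A b \<and>
     lebesgue_bi_invariant G"


section \<open>Integrability and weak subsolutions\<close>

definition L1_loc :: "(real ^ 'n \<Rightarrow> real) \<Rightarrow> bool" where
  "L1_loc u \<longleftrightarrow> u \<in> borel_measurable lebesgue \<and> (\<forall>K. compact K \<longrightarrow> u absolutely_integrable_on K)"

definition in_Lp :: "real \<Rightarrow> (real ^ 'n \<Rightarrow> real) \<Rightarrow> bool" where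
  "in_Lp p u \<longleftrightarrow> u \<in> borel_measurable lebesgue \<and> integrable lebesgue (\<lambda>x. \<bar>u x\<bar> powr p)"

definition weak_L_nonneg ::
  "(real ^ 'n \<Rightarrow> real ^ 'n ^ 'n) \<Rightarrow> (real ^ 'n \<Rightarrow> real ^ 'n) \<Rightarrow> (real ^ 'n \<Rightarrow> real) \<Rightarrow> bool" where
  "weak_L_nonneg A b u \<longleftrightarrow> L1_loc u \<and>
     (\<forall>\<phi>\<in>test_functions UNIV. (\<forall>x. \<phi> x \<ge> 0) \<longrightarrow> (LINT x|lebesgue. u x * op_L_adj A b \<phi> x) \<ge> 0)"

end

theory Submission
  imports Defs
begin

text \<open>
  Homogeneity forces \<open>div b = 0\<close>, so the adjoint of \<open>L\<close> is \<open>L\<close> with \<open>b\<close> replaced by \<open>-b\<close>.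

  (a) Testing \<open>L u \<ge> 0\<close> with cutoffs dilated by \<open>R\<close> costs at most \<open>R\<^bsup>-2\<^esup>\<close> times the integral of
  \<open>\<bar>u\<bar>\<close> over a shell of radius comparable to \<open>R\<close>. For \<open>u\<close> in \<open>L\<^sup>p\<close> with
  \<open>p \<le> Q/(Q-2)\<close> this tends to \<open>0\<close>, hence \<open>L u = 0\<close> and \<open>u\<close> is smooth. A smooth \<open>L\<close>-harmonic function in \<open>L\<^sup>p\<close> vanishes
  at the origin: otherwise the sum of its dilates by \<open>2\<^sup>k\<close>, which converges to an \<open>L\<close>-harmonic
  distribution, would not be a continuous function near \<open>0\<close>. Left translation moves any point to \<open>0\<close>.

  (b) No fundamental solution is needed. Fix a small \<open>g > 0\<close>. A separation argument on functions that are
  homogeneous under \<open>\<delta>\<^sub>2\<close>, which are determined on a compact shell, yields a nonzero nonnegative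
  functional \<open>T\<close> on test functions off the origin, homogeneous of degree \<open>-(Q-2-g)\<close>, with
  \<open>L T = -c f\<close> for some constant \<open>c \<ge> 0\<close> and some smooth \<open>f \<ge> 0\<close>; the hypothesis of the separation is a
  maximum principle for \<open>L\<^sup>*\<close> on homogeneous functions of degree \<open>-g\<close>. By hypoellipticity \<open>T\<close> is a smooth
  supersolution \<open>v\<close> off the origin, of size \<open>O(N\<^bsup>-(Q-2-g)\<^esup>)\<close> in the homogeneous norm \<open>N\<close>, and \<open>u = -v/(1+v)\<close>
  is the required subsolution: concavity of \<open>t/(1+t)\<close> preserves the inequality, and boundedness makes the
  singularity at \<open>0\<close> removable.
\<close>

section \<open>Calculus of functions of class \<open>C\<close>-\<open>k\<close>\<close>

text \<open>The threshold \<open>1 + 2 / (Q - 2)\<close> is Q/(Q-2). In (a) Hoelder on a shell of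
  radius R costs R^(Q - Q/p), and R^(-2) absorbs this exactly up to the threshold; at the threshold
  itself only the vanishing tail of the L^p integral makes the pairing small. In (b) decay of order
  \<gamma> is p-integrable at infinity when \<gamma> p > Q, so a \<open>p\<close> above the
  threshold leaves room for a loss \<open>g\<close> in \<gamma> = Q-2-g. This loss is what the
  construction lives on. Homogeneous functions of degree -g tend to 0 at infinity, so their excess
  below a negative level has bounded support and can enter an energy argument. The cube is the first
  integer power of a positive part that is C^2; the resulting integrand has size N^(-3g-2) near the
  origin, which is integrable when 3g+2 < Q. The degrees are dual to each other: \<open>v\<close> of
  degree -(Q-2-g) times \<open>L_adj \<phi>\<close> of degree -(g+2), or \<open>f\<close> of degree
  -(Q-g) times \<phi> of degree -g, has degree -Q, so each pairing can be read on a single shell.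
  Dilating only by powers of 2 keeps these periodizations locally finite sums, hence smooth.\<close>

lemma Ck_on_differentiable:
  "Ck_on (Suc k) f S \<Longrightarrow> open S \<Longrightarrow> x \<in> S \<Longrightarrow> f differentiable (at x)"
  by (simp add: differentiable_on_eq_differentiable_at)

lemma Ck_on_has_derivative:
  "Ck_on (Suc k) f S \<Longrightarrow> open S \<Longrightarrow> x \<in> S \<Longrightarrow> (f has_derivative frechet_derivative f (at x)) (at x)"
  using Ck_on_differentiable frechet_derivative_works by blast

lemma Ck_on_cong:
  assumes "open S" "\<And>x. x \<in> S \<Longrightarrow> f x = g x" "Ck_on k f S"
  shows "Ck_on k g S"
  using assms(2,3)
proof (induction k arbitrary: f g)
  case 0
  then show ?case by (simp cong: continuous_on_cong)
next
  case (Suc k)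
  have g: "(g has_derivative frechet_derivative f (at x)) (at x)" if "x \<in> S" for x
    using has_derivative_transform_within_open[OF Ck_on_has_derivative[OF Suc.prems(2) assms(1) that] assms(1) that]
      Suc.prems(1) by auto
  have eq: "frechet_derivative f (at x) v = frechet_derivative g (at x) v" if "x \<in> S" for x v
    by (simp only: frechet_derivative_at[OF g[OF that]])
  have "Ck_on k (\<lambda>x. frechet_derivative g (at x) v) S" for v
    by (rule Suc.IH[OF eq]) (use Suc.prems(2) in simp_all)
  moreover have "g differentiable_on S"
    using g assms(1) by (auto simp: differentiable_on_eq_differentiable_at differentiable_def)
  ultimately show ?case by simp
qed

text \<open>\<open>Ck_on\<close> is phrased with the chosen derivative
  \<open>frechet_derivative\<close>; with this rule later proofs can supply an explicit derivative
  formula instead.\<close>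

lemma Ck_on_SucI:
  assumes "open S" "\<And>x. x \<in> S \<Longrightarrow> (f has_derivative f' x) (at x)"
    and "\<And>v. Ck_on k (\<lambda>x. f' x v) S"
  shows "Ck_on (Suc k) f S"
proof -
  have "f' x = frechet_derivative f (at x)" if "x \<in> S" for x
    using frechet_derivative_at[OF assms(2)[OF that]] .
  then have "Ck_on k (\<lambda>x. frechet_derivative f (at x) v) S" for v
    using Ck_on_cong[OF assms(1) _ assms(3)[of v], of "\<lambda>x. frechet_derivative f (at x) v"] by simp
  moreover have "f differentiable_on S"
    using assms(1,2) by (auto simp: differentiable_on_eq_differentiable_at differentiable_def)
  ultimately show ?thesis by simp
qed

lemma Ck_on_Suc_imp: "Ck_on (Suc k) f S \<Longrightarrow> Ck_on k f S"
proof (induction k arbitrary: f)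
  case 0
  then show ?case by (simp add: differentiable_imp_continuous_on)
next
  case (Suc k)
  have "Ck_on k (\<lambda>x. frechet_derivative f (at x) v) S" for v
    using Suc.prems Suc.IH[of "\<lambda>x. frechet_derivative f (at x) v"] by simp
  then show ?case using Suc.prems by simp
qed

lemma Ck_on_le:
  assumes "Ck_on k f S" "j \<le> k"
  shows "Ck_on j f S"
  using assms(2,1) by (induction rule: dec_induct) (blast dest: Ck_on_Suc_imp)+

lemma Ck_on_subset: "Ck_on k f S \<Longrightarrow> T \<subseteq> S \<Longrightarrow> Ck_on k f T"
  by (induction k arbitrary: f) (auto intro: continuous_on_subset differentiable_on_subset)

lemma Ck_on_continuous: "Ck_on k f S \<Longrightarrow> continuous_on S f"
  using Ck_on_le[of k f S 0] by simp

text \<open>Used to glue a function supported in a closed set to zero, and to treat sums that are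
  finite only near each point.\<close>

lemma Ck_on_local:
  assumes "open S" "\<And>x. x \<in> S \<Longrightarrow> \<exists>U. open U \<and> x \<in> U \<and> Ck_on k f U"
  shows "Ck_on k f S"
  using assms(2)
proof (induction k arbitrary: f)
  case 0
  then show ?case
    using assms(1) by (auto simp: continuous_on_eq_continuous_at) (metis continuous_on_eq_continuous_at)
next
  case (Suc k)
  have "f differentiable (at x)" if x: "x \<in> S" for x
    using Suc.prems[OF x] Ck_on_differentiable by blast
  moreover have "Ck_on k (\<lambda>x. frechet_derivative f (at x) v) S" for v
    using Suc.prems by (intro Suc.IH) (metis Ck_on.simps(2))
  ultimately show ?case using assms(1) by (simp add: differentiable_on_eq_differentiable_at)
qed

section \<open>Algebra, composition and inversion of functions of class C^k\<close>

lemma Ck_on_const: "open S \<Longrightarrow> Ck_on k (\<lambda>x. c) S"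
proof (induction k arbitrary: c)
  case (Suc k)
  then show ?case by (intro Ck_on_SucI[where f' = "\<lambda>x v. 0"]) auto
qed simp

lemma Ck_on_bounded_linear_comp:
  assumes "bounded_linear h" "open S" "Ck_on k f S"
  shows "Ck_on k (\<lambda>x. h (f x)) S"
  using assms(3)
proof (induction k arbitrary: f)
  case 0
  then show ?case using bounded_linear.continuous_on[OF assms(1)] by simp
next
  case (Suc k)
  show ?case
    by (rule Ck_on_SucI[OF assms(2), where f' = "\<lambda>x v. h (frechet_derivative f (at x) v)"])
      (use Suc in \<open>auto intro!: bounded_linear.has_derivative[OF assms(1)] Ck_on_has_derivative[OF _ assms(2)]\<close>)
qed

lemma Ck_on_id: "open S \<Longrightarrow> Ck_on k (\<lambda>x. x) S"
proof (induction k)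
  case (Suc k)
  then show ?case by (intro Ck_on_SucI[where f' = "\<lambda>x v. v"]) (auto intro: Ck_on_const)
qed simp

lemma Ck_on_bounded_linear: "bounded_linear h \<Longrightarrow> open S \<Longrightarrow> Ck_on k h S"
  using Ck_on_bounded_linear_comp[OF _ _ Ck_on_id] .

lemma Ck_on_add:
  assumes "open S" "Ck_on k f S" "Ck_on k g S"
  shows "Ck_on k (\<lambda>x. f x + g x) S"
  using assms(2,3)
proof (induction k arbitrary: f g)
  case 0
  then show ?case by (simp add: continuous_on_add)
next
  case (Suc k)
  show ?case
    by (rule Ck_on_SucI[OF assms(1), where f' = "\<lambda>x v. frechet_derivative f (at x) v + frechet_derivative g (at x) v"])
      (use Suc in \<open>auto intro!: has_derivative_add Ck_on_has_derivative[OF _ assms(1)]\<close>)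
qed

lemma Ck_on_mult:
  fixes f g :: "'a::euclidean_space \<Rightarrow> real"
  assumes "open S" "Ck_on k f S" "Ck_on k g S"
  shows "Ck_on k (\<lambda>x. f x * g x) S"
  using assms(2,3)
proof (induction k arbitrary: f g)
  case 0
  then show ?case by (simp add: continuous_on_mult)
next
  case (Suc k)
  have "Ck_on k f S" "Ck_on k g S" using Suc.prems Ck_on_Suc_imp by blast+
  then show ?case
    by (intro Ck_on_SucI[OF assms(1), where f' = "\<lambda>x v. f x * frechet_derivative g (at x) v + frechet_derivative f (at x) v * g x"])
      (use Suc in \<open>auto intro!: has_derivative_mult Ck_on_add Ck_on_has_derivative[OF _ assms(1)] assms(1)\<close>)
qed

lemma Ck_on_cmult:
  fixes f :: "'a::euclidean_space \<Rightarrow> real"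
  shows "open S \<Longrightarrow> Ck_on k f S \<Longrightarrow> Ck_on k (\<lambda>x. c * f x) S"
  by (intro Ck_on_mult Ck_on_const)

lemma Ck_on_minus:
  fixes f :: "'a::euclidean_space \<Rightarrow> real"
  shows "open S \<Longrightarrow> Ck_on k f S \<Longrightarrow> Ck_on k (\<lambda>x. - f x) S"
  using Ck_on_cmult[of S k f "-1"] by simp

lemma Ck_on_diff:
  fixes f :: "'a::euclidean_space \<Rightarrow> real"
  shows "open S \<Longrightarrow> Ck_on k f S \<Longrightarrow> Ck_on k g S \<Longrightarrow> Ck_on k (\<lambda>x. f x - g x) S"
  using Ck_on_add[of S k f "\<lambda>x. - g x"] Ck_on_minus by auto

lemma Ck_on_sum:
  fixes f :: "'i \<Rightarrow> 'a::euclidean_space \<Rightarrow> real"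
  assumes "open S" "\<And>i. i \<in> I \<Longrightarrow> Ck_on k (f i) S"
  shows "Ck_on k (\<lambda>x. \<Sum>i\<in>I. f i x) S"
  using assms(2)
  by (induction I rule: infinite_finite_induct) (auto intro: Ck_on_const Ck_on_add assms(1))

lemma Ck_on_prod:
  fixes f :: "'i \<Rightarrow> 'a::euclidean_space \<Rightarrow> real"
  assumes "open S" "\<And>i. i \<in> I \<Longrightarrow> Ck_on k (f i) S"
  shows "Ck_on k (\<lambda>x. \<Prod>i\<in>I. f i x) S"
  using assms(2)
  by (induction I rule: infinite_finite_induct) (auto intro: Ck_on_const Ck_on_mult assms(1))

lemma Ck_on_compose:
  fixes f :: "'b::euclidean_space \<Rightarrow> real" and g :: "'a::euclidean_space \<Rightarrow> 'b"
  assumes "open S" "open T" "g ` S \<subseteq> T" "Ck_on k f T" "Ck_on k g S"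
  shows "Ck_on k (\<lambda>x. f (g x)) S"
  using assms(4,5)
proof (induction k arbitrary: f)
  case 0
  then show ?case using continuous_on_compose2[OF _ _ assms(3)] by auto
next
  case (Suc k)
  \<comment> \<open>In the chain rule the direction \<open>frechet_derivative g (at x) v\<close>
    moves with \<open>x\<close>, while the induction hypothesis covers fixed directions only;
    expanding it in \<open>Basis\<close> separates the two.\<close>
  let ?f' = "\<lambda>x v. \<Sum>b\<in>Basis. (frechet_derivative g (at x) v \<bullet> b) * frechet_derivative f (at (g x)) b"
  show ?case
  proof (rule Ck_on_SucI[OF assms(1), where f' = ?f'])
    fix x assume x: "x \<in> S"
    have g: "(g has_derivative frechet_derivative g (at x)) (at x)"
      using Ck_on_has_derivative[OF Suc.prems(2) assms(1) x] .
    have f: "(f has_derivative frechet_derivative f (at (g x))) (at (g x))"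
      using Ck_on_has_derivative[OF Suc.prems(1) assms(2)] x assms(3) by auto
    then interpret F: bounded_linear "frechet_derivative f (at (g x))"
      by (rule has_derivative_bounded_linear)
    have eq: "frechet_derivative f (at (g x)) w = (\<Sum>b\<in>Basis. (w \<bullet> b) * frechet_derivative f (at (g x)) b)" for w
    proof -
      have "frechet_derivative f (at (g x)) w = frechet_derivative f (at (g x)) (\<Sum>b\<in>Basis. (w \<bullet> b) *\<^sub>R b)"
        by (simp add: euclidean_representation)
      then show ?thesis by (simp add: F.sum F.scaleR)
    qed
    have "(\<lambda>v. frechet_derivative f (at (g x)) (frechet_derivative g (at x) v)) = ?f' x"
      by (rule ext) (rule eq)
    then show "((\<lambda>x. f (g x)) has_derivative ?f' x) (at x)"
      using has_derivative_compose[OF g f] by (simp only:)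
  next
    fix v
    have g: "Ck_on k g S" using Suc.prems Ck_on_Suc_imp by blast
    have "Ck_on k (\<lambda>x. frechet_derivative f (at (g x)) b) S" for b
      using Suc.IH[of "\<lambda>y. frechet_derivative f (at y) b"] Suc.prems g by simp
    moreover have "Ck_on k (\<lambda>x. frechet_derivative g (at x) v \<bullet> b) S" for b
      by (rule Ck_on_bounded_linear_comp[OF bounded_linear_inner_left assms(1)]) (use Suc.prems in simp)
    ultimately show "Ck_on k (\<lambda>x. ?f' x v) S"
      by (intro Ck_on_sum Ck_on_mult assms(1))
  qed
qed

lemma Ck_on_real_derivative:
  fixes f :: "real \<Rightarrow> real"
  assumes "open S" "\<And>x. x \<in> S \<Longrightarrow> (f has_real_derivative f' x) (at x)" "Ck_on k f' S"
  shows "Ck_on (Suc k) f S"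
  by (rule Ck_on_SucI[OF assms(1), where f' = "\<lambda>x v. f' x * v"])
    (use assms(2) in \<open>auto simp: has_field_derivative_def intro!: Ck_on_mult Ck_on_const assms(1,3)\<close>)

lemma Ck_on_inverse:
  fixes f :: "'a::euclidean_space \<Rightarrow> real"
  assumes "open S" "Ck_on k f S" "\<And>x. x \<in> S \<Longrightarrow> f x \<noteq> 0"
  shows "Ck_on k (\<lambda>x. inverse (f x)) S"
proof -
  have o: "open (- {0::real})" by auto
  have "Ck_on k inverse (- {0::real})"
  proof (induction k)
    case 0
    then show ?case by (auto intro: continuous_intros)
  next
    case (Suc k)
    show ?case
      by (rule Ck_on_real_derivative[OF o, where f' = "\<lambda>x. - (inverse x * inverse x)"])
        (auto intro!: derivative_eq_intros Ck_on_minus[OF o] Ck_on_mult[OF o] Suc simp: power2_eq_square)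
  qed
  then show ?thesis by (intro Ck_on_compose[OF assms(1) o _ _ assms(2)]) (use assms(3) in auto)
qed

lemma smooth_onD: "smooth_on S f \<Longrightarrow> Ck_on k f S"
  by (simp add: smooth_on_def)

lemma smooth_onI: "(\<And>k. Ck_on k f S) \<Longrightarrow> smooth_on S f"
  by (simp add: smooth_on_def)

lemma Ck_on_pderiv: "Ck_on (Suc k) f S \<Longrightarrow> Ck_on k (pderiv_at i f) S"
  by (simp add: pderiv_at_def[abs_def])

declare Ck_on.simps(2) [simp del]

subsection \<open>Partial derivatives\<close>

lemma pderiv_atI: "(f has_derivative f') (at x) \<Longrightarrow> pderiv_at i f x = f' (axis i 1)"
  using frechet_derivative_at[of f f' x] by (simp add: pderiv_at_def)

lemma pderiv_at_cong:
  assumes "open U" "x \<in> U" "\<And>y. y \<in> U \<Longrightarrow> f y = g y"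
  shows "pderiv_at i f x = pderiv_at i g x"
proof -
  have "(f has_derivative f') (at x) \<longleftrightarrow> (g has_derivative f') (at x)" for f'
    using has_derivative_transform_within_open[OF _ assms(1,2)] assms(3) by metis
  then show ?thesis unfolding pderiv_at_def frechet_derivative_def by simp
qed

lemma differentiable_has_derivative:
  "f differentiable (at x) \<Longrightarrow> (f has_derivative frechet_derivative f (at x)) (at x)"
  using frechet_derivative_works by blast

lemma pderiv_at_add:
  "f differentiable (at x) \<Longrightarrow> g differentiable (at x) \<Longrightarrow>
    pderiv_at i (\<lambda>y. f y + g y) x = pderiv_at i f x + pderiv_at i g x"
  by (subst pderiv_atI[OF has_derivative_add[OF differentiable_has_derivative differentiable_has_derivative]])
    (auto simp: pderiv_at_def)

lemma pderiv_at_mult: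
  "f differentiable (at x) \<Longrightarrow> g differentiable (at x) \<Longrightarrow>
    pderiv_at i (\<lambda>y. f y * g y) x = f x * pderiv_at i g x + pderiv_at i f x * g x"
  by (subst pderiv_atI[OF has_derivative_mult[OF differentiable_has_derivative differentiable_has_derivative]])
    (auto simp: pderiv_at_def)

lemma pderiv_at_const [simp]: "pderiv_at i (\<lambda>y. c) x = 0"
  by (rule pderiv_atI[of _ "\<lambda>h. 0", simplified]) auto

lemma pderiv_at_cmult:
  "f differentiable (at x) \<Longrightarrow> pderiv_at i (\<lambda>y. c * f y) x = c * pderiv_at i f x"
  using pderiv_at_mult[of "\<lambda>y. c" x f] by simp

lemma pderiv_at_minus:
  "f differentiable (at x) \<Longrightarrow> pderiv_at i (\<lambda>y. - f y) x = - pderiv_at i f x"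
  using pderiv_at_cmult[of f x i "-1"] by simp

lemma pderiv_at_diff:
  "f differentiable (at x) \<Longrightarrow> g differentiable (at x) \<Longrightarrow>
    pderiv_at i (\<lambda>y. f y - g y) x = pderiv_at i f x - pderiv_at i g x"
  using pderiv_at_add[of f x "\<lambda>y. - g y"] pderiv_at_minus[of g x] by auto

lemma pderiv_at_sum:
  assumes "\<And>j. j \<in> J \<Longrightarrow> f j differentiable (at x)"
  shows "pderiv_at i (\<lambda>y. \<Sum>j\<in>J. f j y) x = (\<Sum>j\<in>J. pderiv_at i (f j) x)"
  using assms
  by (induction J rule: infinite_finite_induct) (auto simp: pderiv_at_add differentiable_sum)

lemma pderiv_at_chain:
  assumes "w differentiable (at x)" "(F has_real_derivative F') (at (w x))"
  shows "pderiv_at i (\<lambda>y. F (w y)) x = F' * pderiv_at i w x"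
  using pderiv_atI[OF has_derivative_compose[OF differentiable_has_derivative[OF assms(1)]
    assms(2)[unfolded has_field_derivative_def]]]
  by (simp add: pderiv_at_def)

lemma pderiv_at_coord: "pderiv_at i (\<lambda>y. y $ j) x = (if i = j then 1 else 0)"
  by (subst pderiv_atI[OF bounded_linear_imp_has_derivative[OF bounded_linear_vec_nth]]) (auto simp: axis_def)

lemma differentiable_coord: "(\<lambda>y. y $ j) differentiable (at x)"
  using bounded_linear_imp_differentiable bounded_linear_vec_nth by blast

lemma pderiv_at_zero_outside:
  assumes "x \<notin> closure {y. f y \<noteq> 0}"
  shows "pderiv_at i f x = 0"
proof -
  have "pderiv_at i f x = pderiv_at i (\<lambda>y. 0) x"
    using closure_subset[of "{y. f y \<noteq> 0}"]
    by (intro pderiv_at_cong[of "- closure {y. f y \<noteq> 0}"]) (use assms in auto)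
  then show ?thesis by simp
qed

section \<open>Second order operators\<close>

lemma op_L_eq:
  "op_L A b w x = (\<Sum>i\<in>UNIV. pderiv_at i (\<lambda>y. \<Sum>j\<in>UNIV. A y $ i $ j * pderiv_at j w y) x)
     + (\<Sum>j\<in>UNIV. b x $ j * pderiv_at j w x)"
  by (simp add: op_L_def divergence_def grad_def matrix_vector_mult_def inner_vec_def)

lemma op_L_cong:
  assumes "open U" "x \<in> U" "\<And>y. y \<in> U \<Longrightarrow> v y = w y"
  shows "op_L A b v x = op_L A b w x"
proof -
  have D: "pderiv_at j v y = pderiv_at j w y" if "y \<in> U" for j y
    using pderiv_at_cong[OF assms(1) that] assms(3) by blast
  have "pderiv_at i (\<lambda>y. \<Sum>j\<in>UNIV. A y $ i $ j * pderiv_at j v y) x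
      = pderiv_at i (\<lambda>y. \<Sum>j\<in>UNIV. A y $ i $ j * pderiv_at j w y) x" for i
    by (rule pderiv_at_cong[OF assms(1,2)]) (simp add: D)
  then show ?thesis using D[OF assms(2)] by (simp add: op_L_eq)
qed

lemma op_L_const [simp]: "op_L A b (\<lambda>y. c) x = 0"
  by (simp add: op_L_eq)

lemma op_L_zero_outside:
  assumes "x \<notin> closure {y. w y \<noteq> 0}"
  shows "op_L A b w x = 0"
proof -
  have "op_L A b w x = op_L A b (\<lambda>y. 0) x"
    using closure_subset[of "{y. w y \<noteq> 0}"]
    by (intro op_L_cong[of "- closure {y. w y \<noteq> 0}"]) (use assms in auto)
  then show ?thesis by simp
qed

text \<open>The first order expression by which \<open>op_L\<close> fails the Leibniz rule
  (\<open>op_L_mult\<close>); where \<open>A\<close> is nonnegative it is a semidefinite form in the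
  gradients.\<close>

definition carre_du_champ ::
  "(real ^ 'n \<Rightarrow> real ^ 'n ^ 'n) \<Rightarrow> (real ^ 'n \<Rightarrow> real) \<Rightarrow> (real ^ 'n \<Rightarrow> real) \<Rightarrow> real ^ 'n \<Rightarrow> real" where
  "carre_du_champ A v w x = (\<Sum>i\<in>UNIV. \<Sum>j\<in>UNIV. A x $ i $ j * pderiv_at i v x * pderiv_at j w x)"

lemma carre_du_champ_eq: "carre_du_champ A v w x = grad v x \<bullet> (A x *v grad w x)"
  by (simp add: carre_du_champ_def grad_def inner_vec_def matrix_vector_mult_def sum_distrib_left ac_simps)

locale second_order_operator =
  fixes A :: "real ^ 'n \<Rightarrow> real ^ 'n ^ 'n" and b :: "real ^ 'n \<Rightarrow> real ^ 'n"
  assumes smooth_A: "smooth_on UNIV (\<lambda>x. A x $ i $ j)"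
    and smooth_b: "smooth_on UNIV (\<lambda>x. b x $ j)"
    and symm_A: "A x $ i $ j = A x $ j $ i"
begin

lemma adjoint: "second_order_operator A (\<lambda>x. - b x)"
proof
  show "smooth_on UNIV (\<lambda>x. (- b x) $ j)" for j
    using smooth_b[of j] by (auto intro!: smooth_onI Ck_on_minus dest: smooth_onD)
qed (rule smooth_A symm_A)+

lemma Ck_A: "open S \<Longrightarrow> Ck_on k (\<lambda>x. A x $ i $ j) S"
  using smooth_onD[OF smooth_A] Ck_on_subset by blast

lemma Ck_b: "open S \<Longrightarrow> Ck_on k (\<lambda>x. b x $ j) S"
  using smooth_onD[OF smooth_b] Ck_on_subset by blast

lemma differentiable_A: "(\<lambda>y. A y $ i $ j) differentiable (at x)"
  using Ck_on_differentiable[OF Ck_A[OF open_UNIV]] by blast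

lemma differentiable_b: "(\<lambda>y. b y $ j) differentiable (at x)"
  using Ck_on_differentiable[OF Ck_b[OF open_UNIV]] by blast

lemma Ck_op_L:
  assumes "open S" "Ck_on (Suc (Suc k)) w S"
  shows "Ck_on k (op_L A b w) S"
  unfolding op_L_eq
  by (intro Ck_on_add Ck_on_sum Ck_on_pderiv Ck_on_mult Ck_A Ck_b assms Ck_on_le[OF assms(2)]) auto

lemma smooth_op_L: "open S \<Longrightarrow> smooth_on S w \<Longrightarrow> smooth_on S (op_L A b w)"
  unfolding smooth_on_def using Ck_op_L by blast

lemma op_L_expand:
  assumes "open S" "Ck_on 2 w S" "x \<in> S"
  shows "op_L A b w x = (\<Sum>i\<in>UNIV. \<Sum>j\<in>UNIV. pderiv_at i (\<lambda>y. A y $ i $ j) x * pderiv_at j w x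
       + A x $ i $ j * pderiv_at i (pderiv_at j w) x) + (\<Sum>j\<in>UNIV. b x $ j * pderiv_at j w x)"
proof -
  have d: "pderiv_at j w differentiable (at x)" for j
    using Ck_on_differentiable[OF Ck_on_pderiv assms(1,3)] assms(2) by (metis numeral_2_eq_2)
  have "pderiv_at i (\<lambda>y. \<Sum>j\<in>UNIV. A y $ i $ j * pderiv_at j w y) x
    = (\<Sum>j\<in>UNIV. pderiv_at i (\<lambda>y. A y $ i $ j) x * pderiv_at j w x + A x $ i $ j * pderiv_at i (pderiv_at j w) x)" for i
    by (subst pderiv_at_sum)
      (auto simp: pderiv_at_mult differentiable_A d add.commute intro!: differentiable_mult)
  then show ?thesis by (simp add: op_L_eq)
qed

text \<open>The two cross terms of the second derivatives coincide by symmetry of \<open>A\<close>,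
  whence the factor 2.\<close>

lemma op_L_mult:
  assumes "open S" "Ck_on 2 v S" "Ck_on 2 w S" "x \<in> S"
  shows "op_L A b (\<lambda>y. v y * w y) x = v x * op_L A b w x + w x * op_L A b v x + 2 * carre_du_champ A v w x"
proof -
  have vw: "Ck_on 2 (\<lambda>y. v y * w y) S" by (intro Ck_on_mult assms)
  have d1: "v differentiable (at y)" "w differentiable (at y)" if "y \<in> S" for y
    using Ck_on_differentiable[OF _ assms(1) that] assms(2,3) by (metis numeral_2_eq_2)+
  have d2: "pderiv_at j v differentiable (at x)" "pderiv_at j w differentiable (at x)" for j
    using Ck_on_differentiable[OF Ck_on_pderiv assms(1,4)] assms(2,3) by (metis numeral_2_eq_2)+
  have D1: "pderiv_at j (\<lambda>y. v y * w y) y = v y * pderiv_at j w y + pderiv_at j v y * w y" if "y \<in> S" for j y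
    using pderiv_at_mult d1[OF that] by blast
  have D2: "pderiv_at i (pderiv_at j (\<lambda>y. v y * w y)) x
     = v x * pderiv_at i (pderiv_at j w) x + pderiv_at i v x * pderiv_at j w x
     + (pderiv_at j v x * pderiv_at i w x + pderiv_at i (pderiv_at j v) x * w x)" for i j
  proof -
    have "pderiv_at i (pderiv_at j (\<lambda>y. v y * w y)) x
      = pderiv_at i (\<lambda>y. v y * pderiv_at j w y + pderiv_at j v y * w y) x"
      by (rule pderiv_at_cong[OF assms(1,4)]) (rule D1)
    then show ?thesis
      using d1[OF assms(4)] d2 by (simp add: pderiv_at_add pderiv_at_mult differentiable_mult)
  qed
  have sym: "(\<Sum>i\<in>UNIV. \<Sum>j\<in>UNIV. A x $ i $ j * (pderiv_at j v x * pderiv_at i w x)) = carre_du_champ A v w x"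
    unfolding carre_du_champ_def by (subst sum.swap) (simp add: symm_A[of x] mult.assoc)
  have "op_L A b (\<lambda>y. v y * w y) x = v x * op_L A b w x + w x * op_L A b v x
    + (carre_du_champ A v w x + (\<Sum>i\<in>UNIV. \<Sum>j\<in>UNIV. A x $ i $ j * (pderiv_at j v x * pderiv_at i w x)))"
    unfolding op_L_expand[OF assms(1) vw assms(4)] op_L_expand[OF assms(1,2,4)] op_L_expand[OF assms(1,3,4)]
      carre_du_champ_def D2 D1[OF assms(4)]
    by (simp add: algebra_simps sum.distrib sum_distrib_left)
  then show ?thesis by (simp add: sym)
qed

lemma op_L_cmult:
  assumes "open S" "Ck_on 2 w S" "x \<in> S"
  shows "op_L A b (\<lambda>y. c * w y) x = c * op_L A b w x"
  using op_L_mult[OF assms(1) Ck_on_const[OF assms(1)] assms(2,3)]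
  by (simp add: carre_du_champ_def)

lemma op_L_add:
  assumes "open S" "Ck_on 2 v S" "Ck_on 2 w S" "x \<in> S"
  shows "op_L A b (\<lambda>y. v y + w y) x = op_L A b v x + op_L A b w x"
proof -
  have vw: "Ck_on 2 (\<lambda>y. v y + w y) S" by (intro Ck_on_add assms)
  have d1: "v differentiable (at y)" "w differentiable (at y)" if "y \<in> S" for y
    using Ck_on_differentiable[OF _ assms(1) that] assms(2,3) by (metis numeral_2_eq_2)+
  have d2: "pderiv_at j v differentiable (at x)" "pderiv_at j w differentiable (at x)" for j
    using Ck_on_differentiable[OF Ck_on_pderiv assms(1,4)] assms(2,3) by (metis numeral_2_eq_2)+
  have D1: "pderiv_at j (\<lambda>y. v y + w y) y = pderiv_at j v y + pderiv_at j w y" if "y \<in> S" for j y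
    using pderiv_at_add d1[OF that] by blast
  have D2: "pderiv_at i (pderiv_at j (\<lambda>y. v y + w y)) x = pderiv_at i (pderiv_at j v) x + pderiv_at i (pderiv_at j w) x" for i j
    using pderiv_at_cong[OF assms(1,4) D1] d2 by (simp add: pderiv_at_add)
  show ?thesis
    unfolding op_L_expand[OF assms(1) vw assms(4)] op_L_expand[OF assms(1,2,4)] op_L_expand[OF assms(1,3,4)]
      D2 D1[OF assms(4)]
    by (simp add: algebra_simps sum.distrib)
qed

lemma op_L_sum:
  assumes "open S" "\<And>k. k \<in> K \<Longrightarrow> Ck_on 2 (v k) S" "x \<in> S"
  shows "op_L A b (\<lambda>y. \<Sum>k\<in>K. v k y) x = (\<Sum>k\<in>K. op_L A b (v k) x)"
  using assms(2)
proof (induction K rule: infinite_finite_induct)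
  case (insert k K)
  then have "Ck_on 2 (v k) S" "Ck_on 2 (\<lambda>y. \<Sum>k\<in>K. v k y) S"
    by (auto intro: Ck_on_sum assms(1) simp del: Ck_on.simps)
  from op_L_add[OF assms(1) this assms(3)] insert show ?case by simp
qed auto

text \<open>For nonnegative \<open>A\<close> the factor \<open>carre_du_champ A w w x\<close> is
  nonnegative, so the sign of \<open>F''\<close> decides: concave \<open>F\<close> lowers the value,
  convex \<open>F\<close> raises it. Allowing an open set \<open>T\<close> instead of the whole line
  makes room for t/(1+t) on t > -1.\<close>

lemma op_L_chain:
  assumes "open S" "Ck_on 2 w S" "x \<in> S" "open T" "w ` S \<subseteq> T"
    and F: "\<And>t. t \<in> T \<Longrightarrow> (F has_real_derivative F' t) (at t)"
    and F': "\<And>t. t \<in> T \<Longrightarrow> (F' has_real_derivative F'' t) (at t)"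
    and "continuous_on T F''"
  shows "Ck_on 2 (\<lambda>y. F (w y)) S"
    and "op_L A b (\<lambda>y. F (w y)) x = F' (w x) * op_L A b w x + F'' (w x) * carre_du_champ A w w x"
proof -
  have "Ck_on (Suc (Suc 0)) F T"
    by (intro Ck_on_real_derivative[OF assms(4) F Ck_on_real_derivative[OF assms(4) F']]) (use assms(8) in auto)
  then show Fw: "Ck_on 2 (\<lambda>y. F (w y)) S"
    using Ck_on_compose[OF assms(1,4,5)] assms(2) by (simp only: numeral_2_eq_2)
  have d1: "w differentiable (at y)" if "y \<in> S" for y
    using Ck_on_differentiable[OF _ assms(1) that] assms(2) by (metis numeral_2_eq_2)
  have d2: "pderiv_at j w differentiable (at x)" for j
    using Ck_on_differentiable[OF Ck_on_pderiv assms(1,3)] assms(2) by (metis numeral_2_eq_2)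
  have D1: "pderiv_at j (\<lambda>y. F (w y)) y = F' (w y) * pderiv_at j w y" if "y \<in> S" for j y
    using pderiv_at_chain[OF d1[OF that] F] that assms(5) by blast
  have wx: "w x \<in> T" using assms(3,5) by blast
  have dF: "(\<lambda>y. F' (w y)) differentiable (at x)"
    using has_derivative_compose[OF differentiable_has_derivative[OF d1[OF assms(3)]]
      F'[OF wx, unfolded has_field_derivative_def]] by (auto simp: differentiable_def)
  have D2: "pderiv_at i (pderiv_at j (\<lambda>y. F (w y))) x
     = F' (w x) * pderiv_at i (pderiv_at j w) x + F'' (w x) * pderiv_at i w x * pderiv_at j w x" for i j
  proof -
    have "pderiv_at i (pderiv_at j (\<lambda>y. F (w y))) x = pderiv_at i (\<lambda>y. F' (w y) * pderiv_at j w y) x"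
      by (rule pderiv_at_cong[OF assms(1,3)]) (rule D1)
    then show ?thesis
      by (simp add: pderiv_at_mult dF d2 pderiv_at_chain[OF d1[OF assms(3)] F'[OF wx]])
  qed
  show "op_L A b (\<lambda>y. F (w y)) x = F' (w x) * op_L A b w x + F'' (w x) * carre_du_champ A w w x"
    unfolding op_L_expand[OF assms(1) Fw assms(3)] op_L_expand[OF assms(1,2,3)]
      carre_du_champ_def D2 D1[OF assms(3)]
    by (simp add: algebra_simps sum.distrib sum_distrib_left)
qed

lemma op_L_uminus_drift:
  "op_L A (\<lambda>x. - b x) w x = op_L A b w x - 2 * (\<Sum>j\<in>UNIV. b x $ j * pderiv_at j w x)"
  by (simp add: op_L_eq sum_negf)

lemma op_L_adj_eq:
  assumes "divergence b x = 0" "\<phi> differentiable (at x)"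
  shows "op_L_adj A b \<phi> x = op_L A (\<lambda>x. - b x) \<phi> x"
proof -
  have "divergence (\<lambda>y. \<phi> y *\<^sub>R b y) x = \<phi> x * divergence b x + (\<Sum>j\<in>UNIV. pderiv_at j \<phi> x * b x $ j)"
    using assms(2) by (simp add: divergence_def pderiv_at_mult differentiable_b sum.distrib sum_distrib_left)
  then show ?thesis
    using assms(1) by (simp add: op_L_adj_def op_L_def inner_vec_def grad_def mult.commute sum_negf)
qed

text \<open>The vector field whose divergence is Green's expression for \<open>\<phi> L w - w L\<^sup>* \<phi>\<close>.\<close>

definition green_field :: "(real ^ 'n \<Rightarrow> real) \<Rightarrow> (real ^ 'n \<Rightarrow> real) \<Rightarrow> 'n \<Rightarrow> real ^ 'n \<Rightarrow> real" where
  "green_field w \<phi> i x = (\<Sum>j\<in>UNIV. A x $ i $ j * (\<phi> x * pderiv_at j w x - w x * pderiv_at j \<phi> x))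
     + b x $ i * (w x * \<phi> x)"

text \<open>The two terms that pair the gradients of \<open>w\<close> and \<open>\<phi>\<close>
  through \<open>A\<close> cancel by symmetry; the only other remainder is
  \<open>w x * \<phi> x * divergence b x\<close>.\<close>

lemma green_identity:
  assumes "open S" "Ck_on 2 w S" "Ck_on 2 \<phi> S" "x \<in> S" "divergence b x = 0"
  shows "(\<Sum>i\<in>UNIV. pderiv_at i (green_field w \<phi> i) x)
    = \<phi> x * op_L A b w x - w x * op_L A (\<lambda>x. - b x) \<phi> x"
proof -
  have d1: "\<phi> differentiable (at x)" "w differentiable (at x)"
    using Ck_on_differentiable[OF _ assms(1,4)] assms(2,3) by (metis numeral_2_eq_2)+
  have d2: "pderiv_at j \<phi> differentiable (at x)" "pderiv_at j w differentiable (at x)" for j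
    using Ck_on_differentiable[OF Ck_on_pderiv assms(1,4)] assms(2,3) by (metis numeral_2_eq_2)+
  have D: "pderiv_at i (green_field w \<phi> i) x =
    (\<Sum>j\<in>UNIV. A x $ i $ j * (\<phi> x * pderiv_at i (pderiv_at j w) x + pderiv_at i \<phi> x * pderiv_at j w x
        - (w x * pderiv_at i (pderiv_at j \<phi>) x + pderiv_at i w x * pderiv_at j \<phi> x))
      + pderiv_at i (\<lambda>y. A y $ i $ j) x * (\<phi> x * pderiv_at j w x - w x * pderiv_at j \<phi> x))
    + (b x $ i * (w x * pderiv_at i \<phi> x + pderiv_at i w x * \<phi> x) + pderiv_at i (\<lambda>y. b y $ i) x * (w x * \<phi> x))" for i
    unfolding green_field_def[abs_def]
    using d1 d2
    by (subst pderiv_at_add, (auto intro!: differentiable_sum differentiable_mult differentiable_diff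
          differentiable_A differentiable_b)[2])
      (subst pderiv_at_sum, (auto intro!: differentiable_sum differentiable_mult differentiable_diff
          differentiable_A differentiable_b)[1],
        simp add: pderiv_at_mult pderiv_at_diff differentiable_A differentiable_b)
  have "(\<Sum>i\<in>UNIV. pderiv_at i (green_field w \<phi> i) x) = \<phi> x * op_L A b w x - w x * op_L A (\<lambda>x. - b x) \<phi> x
     + (\<Sum>i\<in>UNIV. \<Sum>j\<in>UNIV. A x $ i $ j * (pderiv_at i \<phi> x * pderiv_at j w x))
     - (\<Sum>i\<in>UNIV. \<Sum>j\<in>UNIV. A x $ i $ j * (pderiv_at i w x * pderiv_at j \<phi> x)) + w x * \<phi> x * divergence b x"
    unfolding op_L_expand[OF assms(1,2,4)] second_order_operator.op_L_expand[OF adjoint assms(1,3,4)] divergence_def D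
    by (simp add: algebra_simps sum.distrib sum_subtractf sum_distrib_left sum_negf)
  moreover have "(\<Sum>i\<in>UNIV. \<Sum>j\<in>UNIV. A x $ i $ j * (pderiv_at i \<phi> x * pderiv_at j w x))
      = (\<Sum>i\<in>UNIV. \<Sum>j\<in>UNIV. A x $ i $ j * (pderiv_at i w x * pderiv_at j \<phi> x))"
    by (subst sum.swap) (simp add: symm_A[of x] mult.commute)
  ultimately show ?thesis using assms(5) by simp
qed

lemma Ck_green_field:
  assumes "open S" "Ck_on 2 w S" "Ck_on 2 \<phi> S"
  shows "Ck_on 1 (green_field w \<phi> i) S"
  unfolding green_field_def[abs_def]
  by (intro Ck_on_add Ck_on_sum Ck_on_mult Ck_on_diff Ck_A Ck_b assms Ck_on_pderiv
      Ck_on_le[OF assms(2)] Ck_on_le[OF assms(3)]) auto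

end

section \<open>Smooth bump functions\<close>

text \<open>The functions \<open>p(1/t) e\<^bsup>-1/t\<^esup>\<close> with a polynomial \<open>p\<close> are closed under differentiation.\<close>

definition flat_exp :: "real poly \<Rightarrow> real \<Rightarrow> real" where
  "flat_exp p t = (if t \<le> 0 then 0 else poly p (inverse t) * exp (- inverse t))"

lemma poly_times_exp_minus_tendsto_0:
  "((\<lambda>y. poly p y * exp (- y)) \<longlongrightarrow> (0::real)) at_top"
proof -
  have "((\<lambda>y. \<Sum>i\<le>degree p. coeff p i * (y ^ i / exp y)) \<longlongrightarrow> (\<Sum>i\<le>degree p. coeff p i * 0)) at_top"
    by (intro tendsto_intros tendsto_power_div_exp_0)
  then show ?thesis by (simp add: poly_altdef exp_minus divide_inverse sum_distrib_right mult.assoc)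
qed

text \<open>With y = 1/t one has dy/dt = -y^2, so p(y) exp(-y) has the derivative y^2 (p(y) - p'(y))
  exp(-y), again of the same shape. At 0 the exponential beats every polynomial.\<close>

lemma flat_exp_derivative:
  "(flat_exp p has_real_derivative flat_exp (monom 1 2 * (p - pderiv p)) t) (at t)"
proof -
  consider "t < 0" | "t = 0" | "t > 0" by linarith
  then show ?thesis
  proof cases
    case 1
    have "((\<lambda>t. 0) has_real_derivative flat_exp (monom 1 2 * (p - pderiv p)) t) (at t)"
      using 1 by (simp add: flat_exp_def)
    then show ?thesis
      by (rule has_field_derivative_transform_within_open[of _ _ _ "{..<0}"]) (use 1 in \<open>auto simp: flat_exp_def\<close>)
  next
    case 2
    have "((\<lambda>h. flat_exp p h / h) \<longlongrightarrow> 0) (at_left 0)"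
      by (rule tendsto_eventually) (auto simp: eventually_at_left_field flat_exp_def intro!: exI[of _ "-1"])
    moreover have "((\<lambda>h. flat_exp p h / h) \<longlongrightarrow> 0) (at_right 0)"
    proof (rule Lim_transform_eventually)
      \<comment> \<open>Dividing by \<open>h\<close> multiplies the polynomial in
        \<open>inverse h\<close> by its variable, hence \<open>pCons 0 p\<close>.\<close>
      show "((\<lambda>h. poly (pCons 0 p) (inverse h) * exp (- inverse h)) \<longlongrightarrow> 0) (at_right 0)"
        by (rule filterlim_compose[OF poly_times_exp_minus_tendsto_0 filterlim_inverse_at_top_right])
    qed (auto simp: eventually_at_right_field flat_exp_def divide_inverse intro!: exI[of _ 1])
    ultimately show ?thesis
      using 2 by (simp add: has_field_derivative_iff flat_exp_def filterlim_at_split)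
  next
    case 3
    have "((\<lambda>t. poly p (inverse t) * exp (- inverse t)) has_real_derivative
        flat_exp (monom 1 2 * (p - pderiv p)) t) (at t)"
      using 3 by (auto intro!: derivative_eq_intros simp: flat_exp_def poly_monom field_simps power2_eq_square)
    then show ?thesis
      by (rule has_field_derivative_transform_within_open[of _ _ _ "{0<..}"]) (use 3 in \<open>auto simp: flat_exp_def\<close>)
  qed
qed

lemma Ck_flat_exp: "Ck_on k (flat_exp p) UNIV"
proof (induction k arbitrary: p)
  case 0
  then show ?case
    using DERIV_isCont[OF flat_exp_derivative] by (auto intro!: continuous_at_imp_continuous_on)
next
  case (Suc k)
  show ?case by (rule Ck_on_real_derivative[OF open_UNIV flat_exp_derivative Suc])
qed

text \<open>The standard smooth transition, 0 for t \<le> 0 and 1 for t \<ge> 1; the denominator is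
  positive because t and 1 - t are never both nonpositive.\<close>

definition smooth_step :: "real \<Rightarrow> real" where
  "smooth_step t = flat_exp 1 t * inverse (flat_exp 1 t + flat_exp 1 (1 - t))"

lemma flat_exp_1_pos_iff: "0 < flat_exp 1 t \<longleftrightarrow> 0 < t"
  by (simp add: flat_exp_def)

lemma flat_exp_1_nonneg: "0 \<le> flat_exp 1 t"
  by (simp add: flat_exp_def)

lemma flat_exp_1_sum_pos: "0 < flat_exp 1 t + flat_exp 1 (1 - t)"
  using flat_exp_1_pos_iff[of t] flat_exp_1_pos_iff[of "1 - t"] flat_exp_1_nonneg[of t] flat_exp_1_nonneg[of "1 - t"]
  by linarith

lemma Ck_smooth_step: "Ck_on k smooth_step UNIV"
proof -
  have "Ck_on k (\<lambda>t. flat_exp 1 (1 - t)) UNIV"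
    by (rule Ck_on_compose[OF open_UNIV open_UNIV _ Ck_flat_exp])
      (auto intro!: Ck_on_diff Ck_on_const Ck_on_id)
  then show ?thesis
    unfolding smooth_step_def[abs_def]
    by (intro Ck_on_mult Ck_on_inverse Ck_on_add Ck_flat_exp open_UNIV)
      (use flat_exp_1_sum_pos in \<open>auto simp: less_le\<close>)
qed

lemma smooth_step_bounds: "0 \<le> smooth_step t" "smooth_step t \<le> 1"
  using flat_exp_1_sum_pos[of t] flat_exp_1_nonneg[of t] flat_exp_1_nonneg[of "1 - t"]
  by (auto simp: smooth_step_def field_simps)

lemma smooth_step_pos_iff: "0 < smooth_step t \<longleftrightarrow> 0 < t"
  using flat_exp_1_sum_pos[of t] flat_exp_1_pos_iff[of t]
  by (auto simp: smooth_step_def zero_less_mult_iff dest: order.asym)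

lemma smooth_step_eq_1: "1 \<le> t \<Longrightarrow> smooth_step t = 1"
  using flat_exp_1_pos_iff[of t] by (simp add: smooth_step_def flat_exp_def)

text \<open>\<open>k\<close> is a steepness: the plateau 1 is reached at distance 1/\<open>k\<close>
  from the faces. A fixed \<open>k\<close> gives a test function positive exactly in the open box,
  and \<open>k\<close> to infinity gives the indicator of that box.\<close>

definition box_bump :: "real \<Rightarrow> real ^ 'n \<Rightarrow> real ^ 'n \<Rightarrow> real ^ 'n \<Rightarrow> real" where
  "box_bump k u v x = (\<Prod>i\<in>UNIV. smooth_step (k * (x $ i - u $ i)) * smooth_step (k * (v $ i - x $ i)))"

lemma smooth_box_bump: "smooth_on UNIV (box_bump k u v)"
proof (rule smooth_onI)
  fix m
  have *: "Ck_on m (\<lambda>x. smooth_step (k * (x $ i - u $ i))) UNIV"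
    "Ck_on m (\<lambda>x. smooth_step (k * (v $ i - x $ i))) UNIV" for i
    by (rule Ck_on_compose[OF open_UNIV open_UNIV subset_UNIV Ck_smooth_step],
        intro Ck_on_cmult Ck_on_diff Ck_on_const Ck_on_bounded_linear[OF bounded_linear_vec_nth] open_UNIV)+
  then show "Ck_on m (box_bump k u v) UNIV"
    unfolding box_bump_def[abs_def] by (intro Ck_on_prod Ck_on_mult open_UNIV)
qed

lemma box_bump_bounds: "0 \<le> box_bump k u v x" "box_bump k u v x \<le> 1"
  unfolding box_bump_def
  by (auto intro!: prod_nonneg prod_le_1 mult_nonneg_nonneg mult_le_one smooth_step_bounds)

lemma box_bump_pos_iff:
  assumes "k > 0"
  shows "0 < box_bump k u v x \<longleftrightarrow> x \<in> box u v"
proof -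
  have "0 < smooth_step (k * (x $ i - u $ i)) * smooth_step (k * (v $ i - x $ i)) \<longleftrightarrow> u $ i < x $ i \<and> x $ i < v $ i" for i
    using smooth_step_pos_iff[of "k * (x $ i - u $ i)"] smooth_step_pos_iff[of "k * (v $ i - x $ i)"]
      smooth_step_bounds assms by (auto simp: zero_less_mult_iff not_less[symmetric])
  moreover have "0 < box_bump k u v x \<longleftrightarrow> (\<forall>i. 0 < smooth_step (k * (x $ i - u $ i)) * smooth_step (k * (v $ i - x $ i)))"
    unfolding box_bump_def
    using smooth_step_bounds by (auto intro: prod_pos simp: less_le prod_nonneg prod_zero_iff)
  ultimately show ?thesis by (simp add: mem_box_cart)
qed

lemma box_bump_eq_0: "k > 0 \<Longrightarrow> x \<notin> box u v \<Longrightarrow> box_bump k u v x = 0"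
  using box_bump_pos_iff[of k u v x] box_bump_bounds(1)[of k u v x] by linarith

lemma box_bump_eq_0_cbox: "k > 0 \<Longrightarrow> x \<notin> cbox u v \<Longrightarrow> box_bump k u v x = 0"
  using box_bump_eq_0[of k x u v] box_subset_cbox[of u v] by blast

lemma box_bump_eq_1:
  "(\<And>i. 1 \<le> k * (x $ i - u $ i)) \<Longrightarrow> (\<And>i. 1 \<le> k * (v $ i - x $ i)) \<Longrightarrow> box_bump k u v x = 1"
  by (simp add: box_bump_def smooth_step_eq_1)

lemma box_bump_tendsto_indicator:
  "(\<lambda>m. box_bump (real (Suc m)) u v x) \<longlonglongrightarrow> indicat_real (box u v) x"
proof (cases "x \<in> box u v")
  case True
  have ev: "eventually (\<lambda>m. 1 \<le> real (Suc m) * e) sequentially" if "e > 0" for e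
  proof -
    obtain N where "inverse e \<le> real N" using real_arch_simple by blast
    then have "1 \<le> real (Suc m) * e" if "m \<ge> N" for m
    proof -
      have "inverse e \<le> real (Suc m)" using \<open>inverse e \<le> real N\<close> that by linarith
      then show ?thesis using \<open>e > 0\<close> by (simp add: field_simps)
    qed
    then show ?thesis by (auto simp: eventually_sequentially)
  qed
  have "eventually (\<lambda>m. \<forall>i\<in>UNIV. 1 \<le> real (Suc m) * (x $ i - u $ i) \<and> 1 \<le> real (Suc m) * (v $ i - x $ i)) sequentially"
    using True by (intro eventually_ball_finite ballI eventually_conj ev) (auto simp: mem_box_cart)
  then have "eventually (\<lambda>m. box_bump (real (Suc m)) u v x = indicat_real (box u v) x) sequentially"
    by eventually_elim (use True box_bump_eq_1[of "real (Suc _)" x u v] in \<open>simp del: of_nat_Suc\<close>)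
  then show ?thesis by (rule tendsto_eventually)
next
  case False
  then show ?thesis by (simp add: box_bump_eq_0)
qed

section \<open>Test functions\<close>

lemma smooth_on_const: "open S \<Longrightarrow> smooth_on S (\<lambda>x. c)"
  by (intro smooth_onI Ck_on_const)

lemma smooth_on_add: "open S \<Longrightarrow> smooth_on S f \<Longrightarrow> smooth_on S g \<Longrightarrow> smooth_on S (\<lambda>x. f x + g x)"
  by (intro smooth_onI Ck_on_add) (auto dest: smooth_onD)

lemma smooth_on_mult:
  fixes f g :: "'a::euclidean_space \<Rightarrow> real"
  shows "open S \<Longrightarrow> smooth_on S f \<Longrightarrow> smooth_on S g \<Longrightarrow> smooth_on S (\<lambda>x. f x * g x)"
  by (intro smooth_onI Ck_on_mult) (auto dest: smooth_onD)

lemma smooth_on_compose_UNIV: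
  fixes f :: "'b::euclidean_space \<Rightarrow> real" and g :: "'a::euclidean_space \<Rightarrow> 'b"
  shows "smooth_on UNIV f \<Longrightarrow> smooth_on UNIV g \<Longrightarrow> smooth_on UNIV (\<lambda>x. f (g x))"
  by (rule smooth_onI, rule Ck_on_compose[OF open_UNIV open_UNIV subset_UNIV]) (auto dest: smooth_onD)

lemma test_functionsI:
  assumes "smooth_on UNIV \<phi>" "compact K" "K \<subseteq> \<Omega>" "\<And>x. x \<notin> K \<Longrightarrow> \<phi> x = 0"
  shows "\<phi> \<in> test_functions \<Omega>"
proof -
  have "closure {x. \<phi> x \<noteq> 0} \<subseteq> K"
    using assms(2,4) by (intro closure_minimal) (auto intro: compact_imp_closed)
  then show ?thesis
    using assms compact_Int_closed[OF assms(2) closed_closure[of "{x. \<phi> x \<noteq> 0}"]]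
    by (auto simp: test_functions_def Int_absorb1)
qed

lemma test_functionsE:
  assumes "\<phi> \<in> test_functions \<Omega>"
  obtains K where "smooth_on UNIV \<phi>" "compact K" "K \<subseteq> \<Omega>" "\<And>x. x \<notin> K \<Longrightarrow> \<phi> x = 0"
    "\<And>x. x \<notin> K \<Longrightarrow> x \<notin> closure {x. \<phi> x \<noteq> 0}"
proof
  show "smooth_on UNIV \<phi>" "compact (closure {x. \<phi> x \<noteq> 0})" "closure {x. \<phi> x \<noteq> 0} \<subseteq> \<Omega>"
    using assms by (auto simp: test_functions_def)
  show "\<phi> x = 0" if "x \<notin> closure {x. \<phi> x \<noteq> 0}" for x
    using that closure_subset[of "{x. \<phi> x \<noteq> 0}"] by auto
qed

lemma test_functions_smooth: "\<phi> \<in> test_functions \<Omega> \<Longrightarrow> smooth_on UNIV \<phi>"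
  by (simp add: test_functions_def)

lemma test_functions_Ck: "\<phi> \<in> test_functions \<Omega> \<Longrightarrow> Ck_on k \<phi> UNIV"
  using test_functions_smooth smooth_onD by blast

lemma test_functions_continuous: "\<phi> \<in> test_functions \<Omega> \<Longrightarrow> continuous_on UNIV \<phi>"
  using test_functions_Ck Ck_on_continuous by blast

lemma test_functions_mono: "\<phi> \<in> test_functions \<Omega> \<Longrightarrow> \<Omega> \<subseteq> \<Omega>' \<Longrightarrow> \<phi> \<in> test_functions \<Omega>'"
  by (auto simp: test_functions_def)

lemma test_functions_add:
  assumes "\<phi> \<in> test_functions \<Omega>" "\<psi> \<in> test_functions \<Omega>"
  shows "(\<lambda>x. \<phi> x + \<psi> x) \<in> test_functions \<Omega>"
proof -
  obtain K L where K: "compact K" "K \<subseteq> \<Omega>" "\<And>x. x \<notin> K \<Longrightarrow> \<phi> x = 0"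
    and L: "compact L" "L \<subseteq> \<Omega>" "\<And>x. x \<notin> L \<Longrightarrow> \<psi> x = 0"
    using test_functionsE[OF assms(1)] test_functionsE[OF assms(2)] by metis
  show ?thesis
    by (rule test_functionsI[where K = "K \<union> L"])
      (use K L assms in \<open>auto intro!: smooth_on_add dest: test_functions_smooth\<close>)
qed

lemma test_functions_mult:
  assumes "smooth_on UNIV \<eta>" "\<phi> \<in> test_functions \<Omega>"
  shows "(\<lambda>x. \<eta> x * \<phi> x) \<in> test_functions \<Omega>"
proof -
  obtain K where K: "compact K" "K \<subseteq> \<Omega>" "\<And>x. x \<notin> K \<Longrightarrow> \<phi> x = 0"
    using test_functionsE[OF assms(2)] by metis
  show ?thesis
    by (rule test_functionsI[where K = K])
      (use K assms in \<open>auto intro!: smooth_on_mult dest: test_functions_smooth\<close>)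
qed

lemma test_functions_cmult: "\<phi> \<in> test_functions \<Omega> \<Longrightarrow> (\<lambda>x. c * \<phi> x) \<in> test_functions \<Omega>"
  by (rule test_functions_mult) (auto intro!: smooth_on_const)

lemma test_functions_minus: "\<phi> \<in> test_functions \<Omega> \<Longrightarrow> (\<lambda>x. - \<phi> x) \<in> test_functions \<Omega>"
  using test_functions_cmult[of \<phi> \<Omega> "-1"] by simp

lemma test_functions_zero: "(\<lambda>x. 0) \<in> test_functions \<Omega>"
  by (rule test_functionsI[where K = "{}"]) (auto intro!: smooth_on_const)

lemma test_functions_sum:
  "(\<And>k. k \<in> I \<Longrightarrow> \<phi> k \<in> test_functions \<Omega>) \<Longrightarrow> (\<lambda>x. \<Sum>k\<in>I. \<phi> k x) \<in> test_functions \<Omega>"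
  by (induction I rule: infinite_finite_induct) (auto intro: test_functions_zero test_functions_add)

lemma test_functions_bounded:
  assumes "\<phi> \<in> test_functions \<Omega>"
  obtains B where "B > 0" "\<And>x. \<bar>\<phi> x\<bar> \<le> B"
proof -
  obtain K where K: "compact K" "\<And>x. x \<notin> K \<Longrightarrow> \<phi> x = 0"
    using test_functionsE[OF assms] by metis
  have "bounded (\<phi> ` K)"
    using K(1) test_functions_continuous[OF assms]
    by (intro compact_imp_bounded compact_continuous_image) (auto intro: continuous_on_subset)
  then obtain B where B: "B > 0" "\<And>x. x \<in> K \<Longrightarrow> \<bar>\<phi> x\<bar> \<le> B"
    by (auto simp: bounded_pos)
  have "\<bar>\<phi> x\<bar> \<le> B" for x using B K(2)[of x] by (cases "x \<in> K") auto
  with B(1) that show ?thesis by blast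
qed

lemma test_functions_compose:
  fixes g g' :: "real ^ 'n \<Rightarrow> real ^ 'n"
  assumes "\<phi> \<in> test_functions \<Omega>" "smooth_on UNIV g" "continuous_on UNIV g'"
    and "\<And>x. g' (g x) = x" "g' ` \<Omega> \<subseteq> \<Omega>'"
  shows "(\<lambda>x. \<phi> (g x)) \<in> test_functions \<Omega>'"
proof -
  obtain K where K: "compact K" "K \<subseteq> \<Omega>" "\<And>x. x \<notin> K \<Longrightarrow> \<phi> x = 0"
    using test_functionsE[OF assms(1)] by metis
  show ?thesis
  proof (rule test_functionsI)
    show "smooth_on UNIV (\<lambda>x. \<phi> (g x))"
      using smooth_on_compose_UNIV[OF test_functions_smooth[OF assms(1)] assms(2)] .
    show "compact (g' ` K)"
      using K(1) assms(3) by (intro compact_continuous_image) (auto intro: continuous_on_subset)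
    show "g' ` K \<subseteq> \<Omega>'" using K(2) assms(5) by blast
    show "\<phi> (g x) = 0" if "x \<notin> g' ` K" for x
      using that K(3)[of "g x"] assms(4)[of x] by (metis imageI)
  qed
qed

lemma test_functions_box_bump:
  assumes "k > 0" "cbox u v \<subseteq> \<Omega>"
  shows "box_bump k u v \<in> test_functions \<Omega>"
  by (rule test_functionsI[where K = "cbox u v"])
    (use assms box_subset_cbox[of u v] in \<open>auto intro: smooth_box_bump box_bump_eq_0\<close>)

lemma (in second_order_operator) test_functions_op_L:
  assumes "\<phi> \<in> test_functions \<Omega>"
  shows "op_L A b \<phi> \<in> test_functions \<Omega>"
proof -
  obtain K where K: "compact K" "K \<subseteq> \<Omega>" "\<And>x. x \<notin> K \<Longrightarrow> x \<notin> closure {x. \<phi> x \<noteq> 0}"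
    using test_functionsE[OF assms] by metis
  show ?thesis
    by (rule test_functionsI[where K = K])
      (use K assms in \<open>auto intro: smooth_op_L test_functions_smooth op_L_zero_outside\<close>)
qed

section \<open>Integration by parts and the fundamental lemma\<close>

lemma borel_measurable_lebesgue_continuous:
  fixes f :: "'a::euclidean_space \<Rightarrow> real"
  shows "continuous_on UNIV f \<Longrightarrow> f \<in> borel_measurable lebesgue"
  by (intro measurable_completion) (simp add: borel_measurable_continuous_onI)

lemma integrable_lebesgue_compact:
  fixes f :: "'a::euclidean_space \<Rightarrow> real"
  assumes "f \<in> borel_measurable lebesgue" "compact K" "\<And>x. x \<notin> K \<Longrightarrow> f x = 0" "\<And>x. \<bar>f x\<bar> \<le> B"
  shows "integrable lebesgue f"
proof (rule Bochner_Integration.integrable_bound)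
  have "K \<in> sets lebesgue" "emeasure lebesgue K < \<infinity>"
    using lmeasurable_compact[OF assms(2)] by (auto simp: fmeasurable_def)
  then show "integrable lebesgue (\<lambda>x. B * indicator K x)" by auto
  show "AE x in lebesgue. norm (f x) \<le> norm (B * indicator K x)"
    using assms(3) order_trans[OF assms(4) abs_ge_self] by (intro AE_I2) (auto simp: indicator_def)
qed (rule assms)

lemma continuous_compact_support_bounded:
  fixes f :: "'a::euclidean_space \<Rightarrow> real"
  assumes "continuous_on UNIV f" "compact K" "\<And>x. x \<notin> K \<Longrightarrow> f x = 0"
  obtains B where "B > 0" "\<And>x. \<bar>f x\<bar> \<le> B"
proof -
  have "bounded (f ` K)"
    using assms by (intro compact_imp_bounded compact_continuous_image) (auto intro: continuous_on_subset)
  then obtain B where B: "B > 0" "\<And>x. x \<in> K \<Longrightarrow> \<bar>f x\<bar> \<le> B"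
    by (auto simp: bounded_pos)
  have "\<bar>f x\<bar> \<le> B" for x using B assms(3)[of x] by (cases "x \<in> K") auto
  with B(1) that show ?thesis by blast
qed

lemma integrable_continuous_compact:
  fixes f :: "'a::euclidean_space \<Rightarrow> real"
  assumes "continuous_on UNIV f" "compact K" "\<And>x. x \<notin> K \<Longrightarrow> f x = 0"
  shows "integrable lebesgue f"
proof -
  obtain B where "\<And>x. \<bar>f x\<bar> \<le> B" using continuous_compact_support_bounded[OF assms] by blast
  with assms show ?thesis
    by (intro integrable_lebesgue_compact[of f K B] borel_measurable_lebesgue_continuous)
qed

lemma test_functions_integrable: "\<phi> \<in> test_functions \<Omega> \<Longrightarrow> integrable lebesgue \<phi>"
  using test_functionsE[of \<phi> \<Omega>] integrable_continuous_compact[OF test_functions_continuous] by metis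

lemma lebesgue_integral_translate:
  fixes f :: "'a::euclidean_space \<Rightarrow> real"
  assumes "f \<in> borel_measurable borel"
  shows "(LINT x|lebesgue. f (x + c)) = (LINT x|lebesgue. f x)"
proof -
  have "(LINT x|lebesgue. f (x + c)) = (LINT x|lborel. f (x + c))"
    using assms by (intro integral_completion) auto
  also have "\<dots> = (LINT x|distr lborel borel ((+) c). f x)"
    using assms by (subst integral_distr) (auto simp: add.commute)
  also have "\<dots> = (LINT x|lebesgue. f x)"
    using assms by (simp add: lborel_distr_plus integral_completion)
  finally show ?thesis .
qed

lemma has_real_derivative_along_axis:
  assumes "F differentiable (at (x + t *\<^sub>R axis i 1))"
  shows "((\<lambda>s. F (x + s *\<^sub>R axis i 1)) has_real_derivative pderiv_at i F (x + t *\<^sub>R axis i 1)) (at t)"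
proof -
  let ?F' = "frechet_derivative F (at (x + t *\<^sub>R axis i 1))"
  have F: "(F has_derivative ?F') (at (x + t *\<^sub>R axis i 1))"
    using assms frechet_derivative_works by blast
  interpret bounded_linear ?F' using F by (rule has_derivative_bounded_linear)
  have "((\<lambda>s. x + s *\<^sub>R axis i 1) has_derivative (\<lambda>s. s *\<^sub>R axis i 1)) (at t)"
    by (auto intro!: derivative_eq_intros)
  from has_derivative_compose[OF this F] show ?thesis
    by (simp add: has_field_derivative_def pderiv_at_def scaleR mult_commute_abs)
qed

text \<open>Translation invariance does the work of Fubini: difference quotients have integral 0,
  the mean value theorem bounds them by a bound of the derivative, and dominated convergence passes
  to the limit.\<close>

lemma integral_pderiv_eq_0:
  fixes F :: "real ^ 'n \<Rightarrow> real"
  assumes F: "Ck_on 1 F UNIV" and K: "compact K" "\<And>x. x \<notin> K \<Longrightarrow> F x = 0"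
  shows "integrable lebesgue (pderiv_at i F)" "(LINT x|lebesgue. pderiv_at i F x) = 0"
proof -
  let ?e = "axis i 1 :: real ^ 'n"
  have cont: "continuous_on UNIV F" "continuous_on UNIV (pderiv_at i F)"
    using Ck_on_continuous[OF F] Ck_on_pderiv[of 0 F UNIV i] F by auto
  have diff: "F differentiable (at x)" for x
    using Ck_on_differentiable[of 0 F UNIV x] F by auto
  have "closure {x. F x \<noteq> 0} \<subseteq> K"
    using K by (intro closure_minimal) (auto intro: compact_imp_closed)
  then have D0: "pderiv_at i F x = 0" if "x \<notin> K" for x
    using pderiv_at_zero_outside that by blast
  show "integrable lebesgue (pderiv_at i F)"
    by (rule integrable_continuous_compact[OF cont(2) K(1) D0])
  obtain B where B: "B > 0" "\<And>x. \<bar>pderiv_at i F x\<bar> \<le> B"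
    using continuous_compact_support_bounded[OF cont(2) K(1) D0] by blast
  obtain r where r: "K \<subseteq> cball 0 r"
    using compact_imp_bounded[OF K(1)] by (auto simp: bounded_iff subset_iff)
  define h where "h n = inverse (real (Suc n))" for n
  have h: "0 < h n" "h n \<le> 1" for n by (auto simp: h_def inverse_le_1_iff)
  define q where "q n x = (F (x + h n *\<^sub>R ?e) - F x) / h n" for n x
  have qB: "\<bar>q n x\<bar> \<le> B" for n x
  proof -
    have "\<exists>z. 0 < z \<and> z < h n \<and> F (x + h n *\<^sub>R ?e) - F (x + 0 *\<^sub>R ?e) = (h n - 0) * pderiv_at i F (x + z *\<^sub>R ?e)"
      by (rule MVT2[OF h(1)]) (rule has_real_derivative_along_axis[OF diff])
    then show ?thesis using B(2) h[of n] by (auto simp: q_def abs_mult)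
  qed
  \<comment> \<open>All increments \<open>h n\<close> are at most 1, so every quotient is supported
    in the ball enlarged by 1 and one dominating function serves all n.\<close>
  have q0: "q n x = 0" if "x \<notin> cball 0 (r + 1)" for n x
  proof -
    have "norm x \<le> norm (x + h n *\<^sub>R ?e) + norm (h n *\<^sub>R ?e)"
      by (metis add_diff_cancel norm_triangle_ineq4)
    then have "x + h n *\<^sub>R ?e \<notin> cball 0 r" "x \<notin> cball 0 r" using that h[of n] by auto
    then have "F (x + h n *\<^sub>R ?e) = 0" "F x = 0" using K(2) r by blast+
    then show ?thesis by (simp add: q_def)
  qed
  have "(\<lambda>n. LINT x|lebesgue. q n x) \<longlonglongrightarrow> (LINT x|lebesgue. pderiv_at i F x)"
  proof (rule integral_dominated_convergence[where w = "\<lambda>x. B * indicator (cball 0 (r + 1)) x"])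
    show "pderiv_at i F \<in> borel_measurable lebesgue"
      by (rule borel_measurable_lebesgue_continuous[OF cont(2)])
    show "q n \<in> borel_measurable lebesgue" for n
      unfolding q_def by (intro borel_measurable_lebesgue_continuous)
        (use h[of n] in \<open>auto intro!: continuous_intros continuous_on_compose2[OF cont(1)]\<close>)
    have "cball (0::real ^ 'n) (r + 1) \<in> sets lebesgue" "emeasure lebesgue (cball (0::real ^ 'n) (r + 1)) < \<infinity>"
      using lmeasurable_cball[of "0::real ^ 'n" "r + 1"] by (auto simp: fmeasurable_def)
    then show "integrable lebesgue (\<lambda>x. B * indicator (cball (0::real ^ 'n) (r + 1)) x)" by auto
    show "AE x in lebesgue. norm (q n x) \<le> B * indicator (cball 0 (r + 1)) x" for n
      using qB q0 by (intro AE_I2) (auto simp: indicator_def)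
    show "AE x in lebesgue. (\<lambda>n. q n x) \<longlonglongrightarrow> pderiv_at i F x"
    proof (rule AE_I2)
      fix x
      have "((\<lambda>s. (F (x + s *\<^sub>R ?e) - F x) / s) \<longlongrightarrow> pderiv_at i F x) (at 0)"
        using has_real_derivative_along_axis[of F x 0 i] diff by (simp add: has_field_derivative_iff)
      moreover have "filterlim h (at 0) sequentially"
        unfolding filterlim_at h_def using LIMSEQ_inverse_real_of_nat by auto
      ultimately show "(\<lambda>n. q n x) \<longlonglongrightarrow> pderiv_at i F x"
        unfolding q_def by (rule filterlim_compose)
    qed
  qed
  moreover have "(LINT x|lebesgue. q n x) = 0" for n
  proof -
    have "integrable lebesgue (\<lambda>x. F (x + h n *\<^sub>R ?e))"
    proof (rule integrable_continuous_compact)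
      show "continuous_on UNIV (\<lambda>x. F (x + h n *\<^sub>R ?e))"
        by (auto intro!: continuous_intros continuous_on_compose2[OF cont(1)])
      show "compact ((\<lambda>x. x - h n *\<^sub>R ?e) ` K)"
        using K(1) by (intro compact_continuous_image continuous_intros)
      show "F (x + h n *\<^sub>R ?e) = 0" if "x \<notin> (\<lambda>x. x - h n *\<^sub>R ?e) ` K" for x
      proof (rule K(2), rule notI)
        assume "x + h n *\<^sub>R ?e \<in> K"
        then have "(x + h n *\<^sub>R ?e) - h n *\<^sub>R ?e \<in> (\<lambda>x. x - h n *\<^sub>R ?e) ` K" by blast
        with that show False by simp
      qed
    qed
    moreover have "integrable lebesgue F" by (rule integrable_continuous_compact[OF cont(1) K])
    moreover have "F \<in> borel_measurable borel" by (rule borel_measurable_continuous_onI[OF cont(1)])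
    ultimately show ?thesis by (simp add: q_def lebesgue_integral_translate)
  qed
  ultimately show "(LINT x|lebesgue. pderiv_at i F x) = 0"
    by (simp add: LIMSEQ_const_iff)
qed

text \<open>\<open>S\<close> and \<open>- K\<close> are open sets that cover the space, and
  \<open>f\<close> is regular on each of them.\<close>

lemma Ck_on_extend_zero:
  assumes "Ck_on k f S" "open S" "closed K" "K \<subseteq> S" "\<And>x. x \<notin> K \<Longrightarrow> f x = (0::real)"
  shows "Ck_on k f UNIV"
proof (rule Ck_on_local[OF open_UNIV])
  fix x
  have "Ck_on k f (- K)"
    by (rule Ck_on_cong[OF _ _ Ck_on_const[of "- K" k 0]]) (use assms in auto)
  then show "\<exists>U. open U \<and> x \<in> U \<and> Ck_on k f U"
    using assms(1-4) by (cases "x \<in> S") (auto intro: exI[of _ S] exI[of _ "- K"])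
qed

text \<open>\<open>w\<close> is controlled only on \<open>S\<close>, in part (b) the complement of
  the origin; its arbitrary values elsewhere are multiplied by 0 because \<open>\<phi>\<close> lives
  on \<open>K\<close>. Thus every integrand is continuous with compact support, and the divergence
  of \<open>green_field\<close> integrates to 0.\<close>

lemma (in second_order_operator) integration_by_parts:
  assumes "\<And>x. divergence b x = 0"
    and S: "open S" "Ck_on 2 w S" and \<phi>: "Ck_on 2 \<phi> UNIV"
    and K: "compact K" "K \<subseteq> S" "\<And>x. x \<notin> K \<Longrightarrow> \<phi> x = 0"
  shows "(LINT x|lebesgue. w x * op_L A (\<lambda>x. - b x) \<phi> x) = (LINT x|lebesgue. \<phi> x * op_L A b w x)"
    and "integrable lebesgue (\<lambda>x. w x * op_L A (\<lambda>x. - b x) \<phi> x)"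
    and "integrable lebesgue (\<lambda>x. \<phi> x * op_L A b w x)"
proof -
  interpret adj: second_order_operator A "\<lambda>x. - b x" by (rule adjoint)
  have cK: "closed K" by (rule compact_imp_closed[OF K(1)])
  have clK: "closure {x. \<phi> x \<noteq> 0} \<subseteq> K"
    using K cK by (intro closure_minimal) auto
  have \<phi>S: "Ck_on 2 \<phi> S" using \<phi> Ck_on_subset by blast
  have zero: "\<phi> x = 0" "pderiv_at j \<phi> x = 0" "op_L A (\<lambda>x. - b x) \<phi> x = 0" if "x \<notin> K" for x j
  proof -
    have "x \<notin> closure {x. \<phi> x \<noteq> 0}" using that clK by blast
    then show "\<phi> x = 0" "pderiv_at j \<phi> x = 0" "op_L A (\<lambda>x. - b x) \<phi> x = 0"
      using K(3)[OF that] pderiv_at_zero_outside op_L_zero_outside by blast+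
  qed
  have C: "Ck_on 1 (green_field w \<phi> i) UNIV" and Z: "\<And>x. x \<notin> K \<Longrightarrow> green_field w \<phi> i x = 0" for i
  proof -
    show Z: "green_field w \<phi> i x = 0" if "x \<notin> K" for x
      using zero that by (simp add: green_field_def)
    show "Ck_on 1 (green_field w \<phi> i) UNIV"
      by (rule Ck_on_extend_zero[OF Ck_green_field[OF S \<phi>S] S(1) cK K(2) Z])
  qed
  have c: "continuous_on S w" "continuous_on S \<phi>" "continuous_on S (op_L A b w)"
    "continuous_on S (op_L A (\<lambda>x. - b x) \<phi>)"
    using Ck_on_continuous[OF S(2)] Ck_on_continuous[OF \<phi>S] Ck_on_continuous[OF Ck_op_L[OF S(1), of 0 w]]
      Ck_on_continuous[OF adj.Ck_op_L[OF S(1), of 0 \<phi>]] S(2) \<phi>S by (simp_all add: numeral_2_eq_2)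
  have "Ck_on 0 (\<lambda>x. w x * op_L A (\<lambda>x. - b x) \<phi> x) UNIV"
    by (rule Ck_on_extend_zero[OF _ S(1) cK K(2)]) (use c zero in \<open>auto intro: continuous_intros\<close>)
  then show i1: "integrable lebesgue (\<lambda>x. w x * op_L A (\<lambda>x. - b x) \<phi> x)"
    by (intro integrable_continuous_compact[OF _ K(1)]) (auto simp: zero)
  have "Ck_on 0 (\<lambda>x. \<phi> x * op_L A b w x) UNIV"
    by (rule Ck_on_extend_zero[OF _ S(1) cK K(2)]) (use c zero in \<open>auto intro: continuous_intros\<close>)
  then show i2: "integrable lebesgue (\<lambda>x. \<phi> x * op_L A b w x)"
    by (intro integrable_continuous_compact[OF _ K(1)]) (auto simp: zero)
  have "(\<Sum>i\<in>UNIV. pderiv_at i (green_field w \<phi> i) x) = \<phi> x * op_L A b w x - w x * op_L A (\<lambda>x. - b x) \<phi> x" for x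
  proof (cases "x \<in> S")
    case True
    then show ?thesis by (rule green_identity[OF S \<phi>S]) (rule assms(1))
  next
    case False
    then have "x \<notin> K" using K(2) by blast
    moreover have "closure {x. green_field w \<phi> i x \<noteq> 0} \<subseteq> K" for i
      using Z cK by (intro closure_minimal) auto
    ultimately have "pderiv_at i (green_field w \<phi> i) x = 0" for i
      by (intro pderiv_at_zero_outside) blast
    then show ?thesis using zero[OF \<open>x \<notin> K\<close>] by simp
  qed
  moreover have "(LINT x|lebesgue. (\<Sum>i\<in>UNIV. pderiv_at i (green_field w \<phi> i) x)) = 0"
    using integral_pderiv_eq_0[OF C K(1) Z] by (subst Bochner_Integration.integral_sum) auto
  ultimately show "(LINT x|lebesgue. w x * op_L A (\<lambda>x. - b x) \<phi> x) = (LINT x|lebesgue. \<phi> x * op_L A b w x)"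
    using i1 i2 by simp
qed

text \<open>The positive and the negative part of \<open>g\<close> are densities of two measures
  that agree on all boxes, a generating class stable under intersection, hence everywhere. As
  \<open>ennreal\<close> cuts off negative numbers, equality of the densities says that the two
  parts coincide, so both are 0. A Borel representative is taken first because the measures are
  densities of \<open>lborel\<close>.\<close>

lemma integral_zero_boxes_imp_AE_zero:
  fixes g :: "'a::euclidean_space \<Rightarrow> real"
  assumes meas: "g \<in> borel_measurable lebesgue"
    and int: "\<And>u v. integrable lebesgue (\<lambda>x. indicator (box u v) x * g x)"
    and zero: "\<And>u v. (LINT x|lebesgue. indicator (box u v) x * g x) = 0"
  shows "AE x in lebesgue. g x = 0"
proof -
  obtain g' where [measurable]: "g' \<in> borel_measurable lborel" and eq: "AE x in lborel. g x = g' x"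
    using completion_ex_borel_measurable_real[OF meas] by auto
  define P where "P = density lborel (\<lambda>x. ennreal (g' x))"
  define N where "N = density lborel (\<lambda>x. ennreal (- g' x))"
  have int': "integrable lborel (\<lambda>x. indicator (box u v) x * g' x)"
    and zero': "(LINT x|lborel. indicator (box u v) x * g' x) = 0" for u v
  proof -
    have *: "AE x in lebesgue. indicator (box u v) x * g x = indicator (box u v) x * g' x"
      using eq by (intro AE_completion) auto
    have m1: "(\<lambda>x. indicator (box u v) x * g x) \<in> borel_measurable lebesgue"
      using int by (rule borel_measurable_integrable)
    have m2: "(\<lambda>x. indicator (box u v) x * g' x) \<in> borel_measurable lborel" by measurable
    have "integrable lebesgue (\<lambda>x. indicator (box u v) x * g' x)"
      using int integrable_cong_AE[OF m1 measurable_completion[OF m2] *] by blast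
    then show "integrable lborel (\<lambda>x. indicator (box u v) x * g' x)"
      using integrable_completion[OF m2] by blast
    show "(LINT x|lborel. indicator (box u v) x * g' x) = 0"
      using zero integral_cong_AE[OF m1 measurable_completion[OF m2] *] integral_completion[OF m2] by simp
  qed
  have box: "emeasure P (box u v) = emeasure N (box u v)" "emeasure P (box u v) \<noteq> \<infinity>" for u v
  proof -
    let ?i = "\<lambda>x. indicator (box u v) x * g' x"
    have "emeasure P (box u v) = (\<integral>\<^sup>+x. ennreal (?i x) \<partial>lborel)"
      unfolding P_def by (subst emeasure_density) (auto intro!: nn_integral_cong simp: indicator_def)
    moreover have "emeasure N (box u v) = (\<integral>\<^sup>+x. ennreal (- ?i x) \<partial>lborel)"
      unfolding N_def by (subst emeasure_density) (auto intro!: nn_integral_cong simp: indicator_def)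
    moreover have "(\<integral>\<^sup>+x. ennreal (?i x) \<partial>lborel) \<noteq> \<infinity>" "(\<integral>\<^sup>+x. ennreal (- ?i x) \<partial>lborel) \<noteq> \<infinity>"
      using int'[of u v] unfolding real_integrable_def by auto
    moreover have "enn2real (\<integral>\<^sup>+x. ennreal (?i x) \<partial>lborel) = enn2real (\<integral>\<^sup>+x. ennreal (- ?i x) \<partial>lborel)"
      using zero'[of u v] real_lebesgue_integral_def[OF int'[of u v]] by simp
    ultimately show "emeasure P (box u v) = emeasure N (box u v)" "emeasure P (box u v) \<noteq> \<infinity>"
      by (metis ennreal_enn2real infinity_ennreal_def less_top)+
  qed
  have "P = N"
  proof (rule measure_eqI_generator_eq)
    let ?E = "range (\<lambda>(a, b). box a b::'a set)"
    show "Int_stable ?E" by (auto simp: Int_stable_def box_Int_box)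
    show "?E \<subseteq> Pow UNIV" "sets P = sigma_sets UNIV ?E" "sets N = sigma_sets UNIV ?E"
      by (simp_all add: P_def N_def borel_eq_box)
    let ?A = "\<lambda>n::nat. box (- (real n *\<^sub>R One)) (real n *\<^sub>R One) :: 'a set"
    show "range ?A \<subseteq> ?E" "(\<Union>i. ?A i) = UNIV" unfolding UN_box_eq_UNIV by auto
    show "emeasure P (?A i) \<noteq> \<infinity>" for i by (rule box)
    show "emeasure P X = emeasure N X" if "X \<in> ?E" for X using that box(1) by auto
  qed
  then have "AE x in lborel. ennreal (g' x) = ennreal (- g' x)"
    unfolding P_def N_def by (subst (asm) sigma_finite_measure.density_unique_iff[OF sigma_finite_lborel]) auto
  then have "AE x in lborel. g x = 0"
    using eq
  proof eventually_elim
    case (elim x)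
    then show ?case
      by (cases "0 \<le> g' x") (auto simp: ennreal_neg ennreal_eq_0_iff dest: sym)
  qed
  then show ?thesis by (rule AE_completion)
qed

lemma L1_loc_times_bounded_integrable:
  assumes "\<And>K. compact K \<Longrightarrow> g absolutely_integrable_on K" "f \<in> borel_measurable lebesgue"
    and "compact K" "\<And>x. x \<notin> K \<Longrightarrow> f x = 0" "\<And>x. \<bar>f x\<bar> \<le> (B::real)"
  shows "integrable lebesgue (\<lambda>x. g x * f x)"
proof (rule Bochner_Integration.integrable_bound)
  have i: "integrable lebesgue (\<lambda>x. indicator K x * g x)"
    using assms(1)[OF assms(3)] by (simp add: set_integrable_def)
  then show "integrable lebesgue (\<lambda>x. B * \<bar>indicator K x * g x\<bar>)" by auto
  have "(\<lambda>x. g x * f x) = (\<lambda>x. (indicator K x * g x) * f x)"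
    using assms(4) by (fastforce simp: indicator_def)
  then show "(\<lambda>x. g x * f x) \<in> borel_measurable lebesgue"
    using borel_measurable_integrable[OF i] assms(2) by simp
  show "AE x in lebesgue. norm (g x * f x) \<le> norm (B * \<bar>indicator K x * g x\<bar>)"
  proof (rule AE_I2)
    fix x
    have "\<bar>g x\<bar> * \<bar>f x\<bar> \<le> \<bar>B\<bar> * \<bar>g x\<bar>"
      using assms(5)[of x] by (subst mult.commute) (intro mult_right_mono, auto)
    then show "norm (g x * f x) \<le> norm (B * \<bar>indicator K x * g x\<bar>)"
      using assms(4)[of x] by (auto simp: indicator_def abs_mult)
  qed
qed

lemma L1_loc_times_test_integrable:
  assumes "\<And>K. compact K \<Longrightarrow> g absolutely_integrable_on K" "\<phi> \<in> test_functions \<Omega>"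
  shows "integrable lebesgue (\<lambda>x. g x * \<phi> x)"
proof -
  obtain K where K: "compact K" "\<And>x. x \<notin> K \<Longrightarrow> \<phi> x = 0" using test_functionsE[OF assms(2)] by metis
  obtain B where "\<And>x. \<bar>\<phi> x\<bar> \<le> B" using test_functions_bounded[OF assms(2)] by metis
  with K show ?thesis
    by (intro L1_loc_times_bounded_integrable[OF assms(1)] borel_measurable_lebesgue_continuous
        test_functions_continuous[OF assms(2)]) auto
qed

text \<open>Ever steeper box bumps converge to the indicator of an open box and are dominated on the
  closed one, so the integral of \<open>g\<close> over every box is 0.\<close>

lemma du_Bois_Reymond:
  fixes g :: "real ^ 'n \<Rightarrow> real"
  assumes meas: "g \<in> borel_measurable lebesgue" and loc: "\<And>K. compact K \<Longrightarrow> g absolutely_integrable_on K"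
    and zero: "\<And>\<phi>. \<phi> \<in> test_functions UNIV \<Longrightarrow> (LINT x|lebesgue. g x * \<phi> x) = 0"
  shows "AE x in lebesgue. g x = 0"
proof (rule integral_zero_boxes_imp_AE_zero[OF meas])
  fix u v :: "real ^ 'n"
  have c: "integrable lebesgue (\<lambda>x. indicator (cbox u v) x * g x)"
    using loc[of "cbox u v"] by (simp add: set_integrable_def)
  have "set_integrable lebesgue (box u v) g"
    by (rule set_integrable_subset[OF loc[OF compact_cbox[of u v]]]) (auto simp: box_subset_cbox)
  then show "integrable lebesgue (\<lambda>x. indicator (box u v) x * g x)"
    by (simp add: set_integrable_def)
  have "(\<lambda>m. LINT x|lebesgue. g x * box_bump (real (Suc m)) u v x) \<longlonglongrightarrow> (LINT x|lebesgue. indicator (box u v) x * g x)"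
  proof (rule integral_dominated_convergence[where w = "\<lambda>x. \<bar>indicator (cbox u v) x * g x\<bar>"])
    show "integrable lebesgue (\<lambda>x. \<bar>indicator (cbox u v) x * g x\<bar>)" using c by auto
    show "(\<lambda>x. indicator (box u v) x * g x) \<in> borel_measurable lebesgue"
      using meas by (intro borel_measurable_times borel_measurable_indicator) auto
    show "(\<lambda>x. g x * box_bump (real (Suc m)) u v x) \<in> borel_measurable lebesgue" for m
      by (intro borel_measurable_times meas
          borel_measurable_lebesgue_continuous[OF Ck_on_continuous[OF smooth_onD[OF smooth_box_bump]]])
    show "AE x in lebesgue. (\<lambda>m. g x * box_bump (real (Suc m)) u v x) \<longlonglongrightarrow> indicator (box u v) x * g x"
      by (intro AE_I2) (subst mult.commute, intro tendsto_mult box_bump_tendsto_indicator tendsto_const)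
    show "AE x in lebesgue. norm (g x * box_bump (real (Suc m)) u v x) \<le> \<bar>indicator (cbox u v) x * g x\<bar>" for m
    proof (rule AE_I2)
      fix x
      show "norm (g x * box_bump (real (Suc m)) u v x) \<le> \<bar>indicator (cbox u v) x * g x\<bar>"
        using box_bump_bounds[of "real (Suc m)" u v x] box_bump_eq_0_cbox[of "real (Suc m)" x u v]
        by (cases "x \<in> cbox u v") (simp_all add: abs_mult mult_left_le del: of_nat_Suc)
    qed
  qed
  moreover have "(LINT x|lebesgue. g x * box_bump (real (Suc m)) u v x) = 0" for m
    by (intro zero test_functions_box_bump) auto
  ultimately show "(LINT x|lebesgue. indicator (box u v) x * g x) = 0"
    by (simp only: LIMSEQ_const_iff)
qed

text \<open>A nonempty open set is not negligible.\<close>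

lemma AE_zero_imp_zero:
  fixes f :: "'a::euclidean_space \<Rightarrow> real"
  assumes S: "open S" and f: "continuous_on S f" and "AE x in lebesgue. x \<in> S \<longrightarrow> f x = 0" and x: "x \<in> S"
  shows "f x = 0"
proof (rule ccontr)
  assume "f x \<noteq> 0"
  have o: "open {y \<in> S. f y \<noteq> 0}"
    using continuous_open_preimage[OF f S, of "- {0}"] by (simp add: vimage_def Int_def open_Compl)
  then have "{y \<in> S. f y \<noteq> 0} \<in> null_sets lebesgue"
    using assms(3) by (subst (asm) AE_iff_null) (auto simp: Collect_conj_eq[symmetric] conj_commute)
  then have "negligible {y \<in> S. f y \<noteq> 0}" by (simp add: negligible_iff_null_sets)
  then show False using open_not_negligible[OF o] x \<open>f x \<noteq> 0\<close> by blast
qed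

text \<open>Where \<open>f\<close> is positive it is so on a whole closed box inside
  \<open>S\<close>, and the bump of that box would have a positive pairing with
  \<open>f\<close>.\<close>

lemma fundamental_lemma_nonpos:
  fixes f :: "real ^ 'n \<Rightarrow> real"
  assumes S: "open S" and f: "continuous_on S f"
    and nonpos: "\<And>\<phi>. \<phi> \<in> test_functions S \<Longrightarrow> (\<And>x. \<phi> x \<ge> 0) \<Longrightarrow> (LINT x|lebesgue. f x * \<phi> x) \<le> 0"
    and x: "x \<in> S"
  shows "f x \<le> 0"
proof (rule ccontr)
  assume "\<not> f x \<le> 0"
  have "open {y \<in> S. f y > 0}"
    using continuous_open_preimage[OF f S, of "{0<..}"] by (simp add: vimage_def Int_def)
  then obtain u v where uv: "x \<in> box u v" "cbox u v \<subseteq> {y \<in> S. f y > 0}"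
    using x \<open>\<not> f x \<le> 0\<close> by (elim open_contains_cbox[of _ x]) auto
  let ?\<phi> = "box_bump 1 u v"
  have t: "?\<phi> \<in> test_functions S" using uv by (intro test_functions_box_bump) auto
  have sub: "cbox u v \<subseteq> S" using uv(2) by auto
  have "Ck_on 0 (\<lambda>y. f y * ?\<phi> y) UNIV"
    by (rule Ck_on_extend_zero[OF _ S closed_cbox sub])
      (use f box_subset_cbox[of u v] in \<open>auto intro!: continuous_intros box_bump_eq_0
         continuous_on_subset[OF test_functions_continuous[OF t]]\<close>)
  then have cont: "continuous_on UNIV (\<lambda>y. f y * ?\<phi> y)" by simp
  have int: "integrable lebesgue (\<lambda>y. f y * ?\<phi> y)"
    by (rule integrable_continuous_compact[OF cont compact_cbox[of u v]])
      (simp add: box_bump_eq_0_cbox)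
  have nn: "0 \<le> f y * ?\<phi> y" for y
    using uv(2) box_bump_bounds(1)[of 1 u v y] box_bump_eq_0_cbox[of 1 y u v]
    by (cases "y \<in> cbox u v") (auto simp: subset_iff intro!: mult_nonneg_nonneg intro: less_imp_le)
  have "(LINT y|lebesgue. f y * ?\<phi> y) = 0"
    using nonpos[OF t box_bump_bounds(1)] by (intro antisym Bochner_Integration.integral_nonneg nn)
  then have "AE y in lebesgue. f y * ?\<phi> y = 0"
    using integral_nonneg_eq_0_iff_AE[OF int] nn by auto
  then have "f x * ?\<phi> x = 0"
    by (intro AE_zero_imp_zero[OF open_UNIV cont]) auto
  then show False using uv \<open>\<not> f x \<le> 0\<close> box_bump_pos_iff[of 1 u v x] by auto
qed

lemma fundamental_lemma:
  fixes f :: "real ^ 'n \<Rightarrow> real"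
  assumes S: "open S" and f: "continuous_on S f"
    and zero: "\<And>\<phi>. \<phi> \<in> test_functions S \<Longrightarrow> (LINT x|lebesgue. f x * \<phi> x) = 0"
    and x: "x \<in> S"
  shows "f x = 0"
proof (rule antisym)
  show "f x \<le> 0" by (rule fundamental_lemma_nonpos[OF S f _ x]) (simp add: zero)
  have "- f x \<le> 0"
    by (rule fundamental_lemma_nonpos[OF S _ _ x, of "\<lambda>x. - f x"]) (use f in \<open>auto intro: continuous_intros simp: zero\<close>)
  then show "0 \<le> f x" by simp
qed

section \<open>Dilations and homogeneous operators\<close>

lemma dilation_nth [simp]: "dilation \<sigma> r x $ i = r powr \<sigma> i * x $ i"
  by (simp add: dilation_def)

lemma dilation_dilation: "r > 0 \<Longrightarrow> s > 0 \<Longrightarrow> dilation \<sigma> r (dilation \<sigma> s x) = dilation \<sigma> (r * s) x"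
  by (simp add: vec_eq_iff powr_mult)

lemma dilation_1 [simp]: "dilation \<sigma> 1 x = x"
  by (simp add: vec_eq_iff)

lemma dilation_0 [simp]: "dilation \<sigma> r 0 = 0"
  by (simp add: vec_eq_iff)

lemma dilation_inverse: "r > 0 \<Longrightarrow> dilation \<sigma> (inverse r) (dilation \<sigma> r x) = x"
  "r > 0 \<Longrightarrow> dilation \<sigma> r (dilation \<sigma> (inverse r) x) = x"
  by (simp_all add: dilation_dilation)

lemma dilation_eq_0_iff: "r > 0 \<Longrightarrow> dilation \<sigma> r x = 0 \<longleftrightarrow> x = 0"
  by (auto simp: vec_eq_iff)

lemma linear_dilation: "linear (dilation \<sigma> r)"
  by (rule linearI) (simp_all add: vec_eq_iff algebra_simps)

lemma bounded_linear_dilation: "bounded_linear (dilation \<sigma> r)"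
  using linear_dilation by (simp add: linear_conv_bounded_linear)

lemma smooth_dilation: "smooth_on UNIV (dilation \<sigma> r)"
  by (intro smooth_onI Ck_on_bounded_linear bounded_linear_dilation open_UNIV)

lemma continuous_on_dilation [continuous_intros]:
  "continuous_on S f \<Longrightarrow> continuous_on S (\<lambda>x. dilation \<sigma> r (f x))"
  using bounded_linear.continuous_on[OF bounded_linear_dilation] .

lemma smooth_on_dilation: "smooth_on UNIV w \<Longrightarrow> smooth_on UNIV (\<lambda>x. w (dilation \<sigma> r x) :: real)"
  by (rule smooth_on_compose_UNIV[OF _ smooth_dilation])

lemma test_functions_dilation:
  assumes "\<phi> \<in> test_functions \<Omega>" "r > 0" "\<And>x. x \<in> \<Omega> \<Longrightarrow> dilation \<sigma> (inverse r) x \<in> \<Omega>"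
  shows "(\<lambda>x. \<phi> (dilation \<sigma> r x)) \<in> test_functions \<Omega>"
  by (rule test_functions_compose[OF assms(1) smooth_dilation, where g' = "dilation \<sigma> (inverse r)"])
    (use assms in \<open>auto intro!: continuous_intros simp: dilation_inverse\<close>)

lemma pderiv_at_dilation:
  assumes "w differentiable (at (dilation \<sigma> r x))"
  shows "pderiv_at i (\<lambda>y. w (dilation \<sigma> r y)) x = r powr \<sigma> i * pderiv_at i w (dilation \<sigma> r x)"
proof -
  let ?w' = "frechet_derivative w (at (dilation \<sigma> r x))"
  have w: "(w has_derivative ?w') (at (dilation \<sigma> r x))"
    using assms by (rule differentiable_has_derivative)
  interpret bounded_linear ?w' using w by (rule has_derivative_bounded_linear)
  have "pderiv_at i (\<lambda>y. w (dilation \<sigma> r y)) x = ?w' (dilation \<sigma> r (axis i 1))"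
    by (rule pderiv_atI[OF has_derivative_compose[OF bounded_linear_imp_has_derivative[OF bounded_linear_dilation] w]])
  moreover have "dilation \<sigma> r (axis i 1) = (r powr \<sigma> i) *\<^sub>R axis i 1"
    by (simp add: vec_eq_iff axis_def)
  ultimately show ?thesis by (simp add: scaleR pderiv_at_def)
qed

lemma dilation_tendsto_0:
  assumes "\<And>i. 0 < \<sigma> i"
  shows "((\<lambda>r. dilation \<sigma> r x) \<longlongrightarrow> 0) (at_right 0)"
proof (rule vec_tendstoI)
  fix i
  have "((\<lambda>r. r powr \<sigma> i * x $ i) \<longlongrightarrow> 0 powr \<sigma> i * x $ i) (at_right 0)"
    using assms[of i] by (intro tendsto_intros) (auto simp: eventually_at_right_field intro!: exI[of _ 1])
  then show "((\<lambda>r. dilation \<sigma> r x $ i) \<longlongrightarrow> 0 $ i) (at_right 0)"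
    using assms[of i] by simp
qed

section \<open>Lebesgue measure under dilations, the homogeneous norm and the basic cutoff\<close>

lemma lebesgue_dilation:
  fixes \<sigma> :: "'n::finite \<Rightarrow> real"
  assumes "r > 0"
  shows "lebesgue = density (distr lebesgue lebesgue (dilation \<sigma> r)) (\<lambda>_. ennreal (r powr homogeneous_dim \<sigma>))"
    and "dilation \<sigma> r \<in> lebesgue \<rightarrow>\<^sub>M lebesgue"
proof -
  \<comment> \<open>The affine change of variables on a Euclidean space indexes its factors by basis
    vectors; \<open>axis_index\<close> translates back to coordinates.\<close>
  define c :: "real ^ 'n \<Rightarrow> real" where "c j = r powr \<sigma> (axis_index j)" for j
  have c: "c j \<noteq> 0" for j using assms by (simp add: c_def)
  have Basis: "(Basis :: (real ^ 'n) set) = range (\<lambda>i. axis i 1)"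
    by (auto simp: Basis_vec_def)
  have idx: "axis_index (axis i 1 :: real ^ 'n) = i" for i
    using axis_index[of "axis i 1 :: real ^ 'n"] by (simp add: axis_eq_axis)
  have inj: "inj (\<lambda>i. axis i 1 :: real ^ 'n)" by (auto simp: inj_def axis_eq_axis)
  have *: "(\<lambda>x. 0 + (\<Sum>j\<in>Basis. (c j * (x \<bullet> j)) *\<^sub>R j)) = dilation \<sigma> r"
  proof
    fix x
    have "(\<Sum>j\<in>Basis. (c j * (x \<bullet> j)) *\<^sub>R j) = (\<Sum>j\<in>Basis. (dilation \<sigma> r x \<bullet> j) *\<^sub>R j)"
      by (intro sum.cong refl) (auto simp: Basis idx c_def inner_axis)
    then show "0 + (\<Sum>j\<in>Basis. (c j * (x \<bullet> j)) *\<^sub>R j) = dilation \<sigma> r x"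
      by (simp add: euclidean_representation)
  qed
  have prod: "(\<Prod>j\<in>Basis. \<bar>c j\<bar>) = r powr homogeneous_dim \<sigma>"
    using assms unfolding Basis homogeneous_dim_def
    by (subst prod.reindex[OF inj]) (simp add: powr_sum idx c_def)
  show "lebesgue = density (distr lebesgue lebesgue (dilation \<sigma> r)) (\<lambda>_. ennreal (r powr homogeneous_dim \<sigma>))"
    using lebesgue_affine_euclidean[of c 0] c unfolding * prod by simp
  show "dilation \<sigma> r \<in> lebesgue \<rightarrow>\<^sub>M lebesgue"
    using lebesgue_affine_measurable[of c 0] c unfolding * by simp
qed

lemma lebesgue_integral_dilation:
  fixes f :: "real ^ 'n \<Rightarrow> real"
  assumes "r > 0" and f: "f \<in> borel_measurable lebesgue"
  shows "(LINT x|lebesgue. f (dilation \<sigma> r x)) = r powr (- homogeneous_dim \<sigma>) * (LINT x|lebesgue. f x)"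
    and "integrable lebesgue f \<longleftrightarrow> integrable lebesgue (\<lambda>x. f (dilation \<sigma> r x))"
proof -
  let ?c = "r powr homogeneous_dim \<sigma>"
  note m = lebesgue_dilation(2)[OF assms(1), of \<sigma>]
  have f': "f \<in> borel_measurable (distr lebesgue lebesgue (dilation \<sigma> r))"
    using f by (simp add: measurable_distr_eq1)
  have "(LINT x|lebesgue. f x) = (LINT x|density (distr lebesgue lebesgue (dilation \<sigma> r)) (\<lambda>_. ennreal ?c). f x)"
    by (subst lebesgue_dilation(1)[OF assms(1), of \<sigma>]) simp
  also have "\<dots> = ?c * (LINT x|lebesgue. f (dilation \<sigma> r x))"
    using f' f m by (subst integral_density) (auto simp: integral_distr)
  finally show "(LINT x|lebesgue. f (dilation \<sigma> r x)) = r powr (- homogeneous_dim \<sigma>) * (LINT x|lebesgue. f x)"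
    using assms(1) by (simp add: powr_minus field_simps)
  have "integrable lebesgue f \<longleftrightarrow> integrable (density (distr lebesgue lebesgue (dilation \<sigma> r)) (\<lambda>_. ennreal ?c)) f"
    by (subst lebesgue_dilation(1)[OF assms(1), of \<sigma>]) simp
  also have "\<dots> \<longleftrightarrow> integrable lebesgue (\<lambda>x. ?c * f (dilation \<sigma> r x))"
    using f' f m by (subst integrable_density) (auto simp: integrable_distr_eq)
  also have "\<dots> \<longleftrightarrow> integrable lebesgue (\<lambda>x. f (dilation \<sigma> r x))"
    using assms(1) by simp
  finally show "integrable lebesgue f \<longleftrightarrow> integrable lebesgue (\<lambda>x. f (dilation \<sigma> r x))" .
qed

text \<open>Each summand is homogeneous of degree one under the dilations, so all level sets are
  dilates of a single compact one.\<close>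

definition hnorm :: "('n::finite \<Rightarrow> real) \<Rightarrow> real ^ 'n \<Rightarrow> real" where
  "hnorm \<sigma> x = (\<Sum>i\<in>UNIV. \<bar>x $ i\<bar> powr (1 / \<sigma> i))"

lemma hnorm_nonneg: "0 \<le> hnorm \<sigma> x"
  by (auto simp: hnorm_def intro: sum_nonneg)

lemma hnorm_0 [simp]: "hnorm \<sigma> 0 = 0"
  by (simp add: hnorm_def)

lemma hnorm_eq_0_iff: "hnorm \<sigma> x = 0 \<longleftrightarrow> x = 0"
  by (simp add: hnorm_def sum_nonneg_eq_0_iff vec_eq_iff)

lemma hnorm_pos_iff: "0 < hnorm \<sigma> x \<longleftrightarrow> x \<noteq> 0"
  using hnorm_nonneg[of \<sigma> x] hnorm_eq_0_iff[of \<sigma> x] by linarith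

lemma hnorm_dilation:
  assumes "\<And>i. 0 < \<sigma> i" "r > 0"
  shows "hnorm \<sigma> (dilation \<sigma> r x) = r * hnorm \<sigma> x"
proof -
  have "\<bar>r powr \<sigma> i * x $ i\<bar> powr (1 / \<sigma> i) = r * \<bar>x $ i\<bar> powr (1 / \<sigma> i)" for i
    using assms(1)[of i] assms(2) by (simp add: abs_mult powr_mult powr_powr)
  then show ?thesis by (simp add: hnorm_def sum_distrib_left)
qed

lemma continuous_on_hnorm:
  assumes "\<And>i. 0 < \<sigma> i"
  shows "continuous_on S (hnorm \<sigma>)"
  unfolding hnorm_def[abs_def]
  using assms by (intro continuous_on_sum continuous_on_powr' continuous_intros) (auto simp: less_imp_le)

lemma nth_le_hnorm:
  assumes "\<And>i. 0 < \<sigma> i"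
  shows "\<bar>x $ i\<bar> \<le> hnorm \<sigma> x powr \<sigma> i"
proof -
  have "\<bar>x $ i\<bar> powr (1 / \<sigma> i) \<le> hnorm \<sigma> x"
    unfolding hnorm_def by (rule member_le_sum) auto
  then have "(\<bar>x $ i\<bar> powr (1 / \<sigma> i)) powr \<sigma> i \<le> hnorm \<sigma> x powr \<sigma> i"
    using assms[of i] by (intro powr_mono2) (auto simp: less_imp_le)
  then show ?thesis using assms[of i] by (simp add: powr_powr)
qed

lemma compact_hnorm_le:
  assumes "\<And>i. 0 < \<sigma> i"
  shows "compact {x. hnorm \<sigma> x \<le> R}"
proof -
  have "\<bar>x $ i\<bar> \<le> \<bar>R\<bar> powr \<sigma> i" if "hnorm \<sigma> x \<le> R" for x i
    using nth_le_hnorm[of \<sigma> x i] assms powr_mono2[of "\<sigma> i" "hnorm \<sigma> x" "\<bar>R\<bar>"] hnorm_nonneg[of \<sigma> x] that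
    by (fastforce simp: less_imp_le)
  then have "{x. hnorm \<sigma> x \<le> R} \<subseteq> cbox (\<chi> i. - (\<bar>R\<bar> powr \<sigma> i)) (\<chi> i. \<bar>R\<bar> powr \<sigma> i)"
    by (auto simp: mem_box_cart abs_le_iff) (metis minus_le_iff)+
  moreover have "closed {x. hnorm \<sigma> x \<le> R}"
    using continuous_on_hnorm[of \<sigma> UNIV] assms by (intro closed_Collect_le continuous_intros) auto
  ultimately show ?thesis
    using bounded_subset[OF bounded_cbox] by (auto simp: compact_eq_bounded_closed)
qed

text \<open>\<open>hnorm\<close> is in general not smooth where a coordinate vanishes, so the cutoff
  is a bump of a Euclidean cube and is compared with the homogeneous balls only afterwards: it is 1
  for \<open>hnorm\<close> up to 1 and 0 beyond \<open>cutoff_radius\<close>.\<close>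

definition cutoff :: "real ^ 'n \<Rightarrow> real" where
  "cutoff = box_bump 1 (\<chi> i. -2) (\<chi> i. 2)"

lemma cutoff_test: "cutoff \<in> test_functions UNIV"
  unfolding cutoff_def by (rule test_functions_box_bump) auto

lemma smooth_cutoff: "smooth_on UNIV cutoff"
  using cutoff_test test_functions_smooth by blast

lemma cutoff_bounds: "0 \<le> cutoff x" "cutoff x \<le> 1"
  unfolding cutoff_def by (rule box_bump_bounds)+

lemma cutoff_eq_1:
  assumes "\<And>i. 0 < \<sigma> i" "hnorm \<sigma> x \<le> 1"
  shows "cutoff x = 1"
proof -
  have "\<bar>x $ i\<bar> \<le> 1" for i
    using nth_le_hnorm[of \<sigma> x i] assms powr_le_one_le[of "hnorm \<sigma> x" "\<sigma> i"] powr_mono2[of "\<sigma> i" "hnorm \<sigma> x" 1]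
      hnorm_nonneg[of \<sigma> x] by (fastforce simp: less_imp_le)
  then have "1 \<le> x $ i + 2" "1 \<le> 2 - x $ i" for i by (smt (verit))+
  then show ?thesis
    unfolding cutoff_def by (intro box_bump_eq_1) auto
qed

text \<open>The largest value of \<open>hnorm\<close> on the cube of points whose coordinates have
  modulus at most 2, which contains the support of \<open>cutoff\<close>.\<close>

definition cutoff_radius :: "('n::finite \<Rightarrow> real) \<Rightarrow> real" where
  "cutoff_radius \<sigma> = (\<Sum>i\<in>UNIV. 2 powr (1 / \<sigma> i))"

lemma cutoff_eq_0:
  assumes "\<And>i. 0 < \<sigma> i" "cutoff_radius \<sigma> < hnorm \<sigma> x"
  shows "cutoff x = 0"
proof (rule ccontr)
  assume "cutoff x \<noteq> 0"
  then have "x \<in> box (\<chi> i. -2) (\<chi> i. 2)"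
    using box_bump_eq_0[of 1 x] by (auto simp: cutoff_def)
  then have "- 2 < x $ i \<and> x $ i < 2" for i by (auto simp: mem_box_cart)
  then have "\<bar>x $ i\<bar> \<le> 2" for i by (smt (verit))
  then have "hnorm \<sigma> x \<le> cutoff_radius \<sigma>"
    unfolding hnorm_def cutoff_radius_def using assms(1) by (intro sum_mono powr_mono2) (auto simp: less_imp_le)
  with assms(2) show False by simp
qed

lemma cutoff_radius_pos: "0 < cutoff_radius (\<sigma> :: 'n::finite \<Rightarrow> real)"
  unfolding cutoff_radius_def by (intro sum_pos) auto

section \<open>Homogeneity of the coefficients and the vanishing divergence of the drift\<close>

locale homogeneous_operator = second_order_operator A b
  for A :: "real ^ 'n \<Rightarrow> real ^ 'n ^ 'n" and b :: "real ^ 'n \<Rightarrow> real ^ 'n" +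
  fixes \<sigma> :: "'n \<Rightarrow> real"
  assumes nonneg_A: "0 \<le> (A x *v \<xi>) \<bullet> \<xi>"
    and \<sigma>_ge_1: "1 \<le> \<sigma> i"
    and homogeneous: "homogeneous_degree_two \<sigma> A b"
begin

lemma \<sigma>_pos: "0 < \<sigma> i"
  using \<sigma>_ge_1[of i] by linarith

abbreviation \<delta> :: "real \<Rightarrow> real ^ 'n \<Rightarrow> real ^ 'n" where "\<delta> \<equiv> dilation \<sigma>"
abbreviation N :: "real ^ 'n \<Rightarrow> real" where "N \<equiv> hnorm \<sigma>"
abbreviation Q :: real where "Q \<equiv> homogeneous_dim \<sigma>"

lemmas N_\<delta> = hnorm_dilation[of \<sigma>, OF \<sigma>_pos]

lemma op_L_dilation:
  "smooth_on UNIV w \<Longrightarrow> r > 0 \<Longrightarrow> op_L A b (\<lambda>y. w (\<delta> r y)) x = r\<^sup>2 * op_L A b w (\<delta> r x)"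
  using homogeneous by (simp add: homogeneous_degree_two_def comp_def)

lemma carre_du_champ_nonneg: "0 \<le> carre_du_champ A w w x"
  using nonneg_A[of x "grad w x"] by (simp add: carre_du_champ_eq inner_commute)

text \<open>Degree two of the operator is applied to \<open>v\<close>, \<open>w\<close> and their
  product, and \<open>op_L_mult\<close> isolates the bilinear term.\<close>

lemma carre_du_champ_dilation:
  assumes "smooth_on UNIV v" "smooth_on UNIV w" "r > 0"
  shows "carre_du_champ A (\<lambda>y. v (\<delta> r y)) (\<lambda>y. w (\<delta> r y)) x = r\<^sup>2 * carre_du_champ A v w (\<delta> r x)"
proof -
  have "r\<^sup>2 * op_L A b (\<lambda>y. v y * w y) (\<delta> r x) = op_L A b (\<lambda>y. v (\<delta> r y) * w (\<delta> r y)) x"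
    using op_L_dilation[OF smooth_on_mult[OF open_UNIV assms(1,2)] assms(3)] by simp
  then show ?thesis
    using op_L_mult[of UNIV v w "\<delta> r x"] smooth_onD[OF assms(1)] smooth_onD[OF assms(2)]
      op_L_mult[of UNIV "\<lambda>y. v (\<delta> r y)" "\<lambda>y. w (\<delta> r y)" x]
      smooth_onD[OF smooth_on_dilation[OF assms(1)]] smooth_onD[OF smooth_on_dilation[OF assms(2)]]
      op_L_dilation[OF assms(1,3)] op_L_dilation[OF assms(2,3)]
    by (simp add: algebra_simps)
qed

lemma smooth_coord: "smooth_on UNIV (\<lambda>y :: real ^ 'n. y $ i)"
  by (intro smooth_onI Ck_on_bounded_linear bounded_linear_vec_nth open_UNIV)

text \<open>The entries of \<open>A\<close> are the carre du champ of pairs of coordinate functions,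
  so homogeneity of the operator passes to its coefficients.\<close>

lemma A_dilation:
  assumes "r > 0"
  shows "r\<^sup>2 * A (\<delta> r x) $ i $ j = r powr \<sigma> i * r powr \<sigma> j * A x $ i $ j"
proof -
  have "carre_du_champ A (\<lambda>y. y $ i) (\<lambda>y. y $ j) y = A y $ i $ j" for y
    by (simp add: carre_du_champ_def pderiv_at_coord if_distrib[of "\<lambda>x. _ * x"] if_distrib[of "\<lambda>x. x * _"] cong: if_cong)
  moreover have "carre_du_champ A (\<lambda>y. \<delta> r y $ i) (\<lambda>y. \<delta> r y $ j) x = r powr \<sigma> i * r powr \<sigma> j * A x $ i $ j"
    by (simp add: carre_du_champ_def pderiv_at_cmult differentiable_coord pderiv_at_coord
        if_distrib[of "\<lambda>x. _ * x"] if_distrib[of "\<lambda>x. x * _"] cong: if_cong)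
  ultimately show ?thesis
    using carre_du_champ_dilation[OF smooth_coord smooth_coord assms, of i j x] by simp
qed

text \<open>On the j-th coordinate the operator gives the divergence of the j-th column of
  \<open>A\<close> plus \<open>b x $ j\<close>. The divergence scales as claimed by differentiating
  \<open>A_dilation\<close>, hence so does the rest.\<close>

lemma b_dilation:
  assumes "r > 0"
  shows "r\<^sup>2 * b (\<delta> r x) $ j = r powr \<sigma> j * b x $ j"
proof -
  have L: "op_L A b (\<lambda>y. y $ j) y = (\<Sum>i\<in>UNIV. pderiv_at i (\<lambda>y. A y $ i $ j) y) + b y $ j" for y
    by (simp add: op_L_eq pderiv_at_coord if_distrib[of "\<lambda>x. _ * x"] cong: if_cong)
  have "r powr \<sigma> j * op_L A b (\<lambda>y. y $ j) x = op_L A b (\<lambda>y. \<delta> r y $ j) x"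
    using op_L_cmult[OF open_UNIV smooth_onD[OF smooth_coord]] by simp
  also have "\<dots> = r\<^sup>2 * op_L A b (\<lambda>y. y $ j) (\<delta> r x)"
    by (rule op_L_dilation[OF smooth_coord assms])
  finally have 1: "r powr \<sigma> j * op_L A b (\<lambda>y. y $ j) x = r\<^sup>2 * op_L A b (\<lambda>y. y $ j) (\<delta> r x)" .
  have 2: "r powr \<sigma> j * pderiv_at i (\<lambda>y. A y $ i $ j) x = r\<^sup>2 * pderiv_at i (\<lambda>y. A y $ i $ j) (\<delta> r x)" for i
  proof -
    have "pderiv_at i (\<lambda>y. r powr \<sigma> i * r powr \<sigma> j * A y $ i $ j) x = pderiv_at i (\<lambda>y. r\<^sup>2 * A (\<delta> r y) $ i $ j) x"
      by (simp add: A_dilation[OF assms])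
    then have "r powr \<sigma> i * r powr \<sigma> j * pderiv_at i (\<lambda>y. A y $ i $ j) x
        = r\<^sup>2 * (r powr \<sigma> i * pderiv_at i (\<lambda>y. A y $ i $ j) (\<delta> r x))"
      using Ck_on_differentiable[OF smooth_onD[OF smooth_on_dilation[OF smooth_A]] open_UNIV]
      by (simp only: pderiv_at_cmult[OF differentiable_A] pderiv_at_cmult
          pderiv_at_dilation[OF differentiable_A] UNIV_I)
    then show ?thesis using assms by simp
  qed
  from 1 show ?thesis unfolding L by (simp add: distrib_left sum_distrib_left 2)
qed

text \<open>Each \<open>pderiv_at j (\<lambda>y. b y $ j)\<close> is homogeneous of degree -2 and
  continuous at the origin; letting r tend to 0 in the scaling relation leaves 0.\<close>

lemma divergence_b: "divergence b x = 0"
proof -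
  have "pderiv_at j (\<lambda>y. b y $ j) x = 0" for j
  proof -
    have *: "r\<^sup>2 * pderiv_at j (\<lambda>y. b y $ j) (\<delta> r x) = pderiv_at j (\<lambda>y. b y $ j) x" if "r > 0" for r
    proof -
      have "pderiv_at j (\<lambda>y. r powr \<sigma> j * b y $ j) x = pderiv_at j (\<lambda>y. r\<^sup>2 * b (\<delta> r y) $ j) x"
        by (simp add: b_dilation[OF that])
      then have "r powr \<sigma> j * pderiv_at j (\<lambda>y. b y $ j) x = r\<^sup>2 * (r powr \<sigma> j * pderiv_at j (\<lambda>y. b y $ j) (\<delta> r x))"
        using Ck_on_differentiable[OF smooth_onD[OF smooth_on_dilation[OF smooth_b]] open_UNIV]
        by (simp only: pderiv_at_cmult[OF differentiable_b] pderiv_at_cmult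
            pderiv_at_dilation[OF differentiable_b] UNIV_I)
      then show ?thesis using that by simp
    qed
    have "continuous_on UNIV (pderiv_at j (\<lambda>y. b y $ j))"
      by (intro Ck_on_continuous[of 0] Ck_on_pderiv Ck_b open_UNIV)
    then have "((\<lambda>r. pderiv_at j (\<lambda>y. b y $ j) (\<delta> r x)) \<longlongrightarrow> pderiv_at j (\<lambda>y. b y $ j) 0) (at_right 0)"
      by (intro isCont_tendsto_compose[OF _ dilation_tendsto_0] \<sigma>_pos) (simp add: continuous_on_eq_continuous_at)
    then have "((\<lambda>r. r\<^sup>2 * pderiv_at j (\<lambda>y. b y $ j) (\<delta> r x)) \<longlongrightarrow> 0\<^sup>2 * pderiv_at j (\<lambda>y. b y $ j) 0) (at_right 0)"
      by (intro tendsto_intros)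
    moreover have "eventually (\<lambda>r. r\<^sup>2 * pderiv_at j (\<lambda>y. b y $ j) (\<delta> r x) = pderiv_at j (\<lambda>y. b y $ j) x) (at_right 0)"
      using * by (auto simp: eventually_at_right_field intro!: exI[of _ 1])
    ultimately have "((\<lambda>r. pderiv_at j (\<lambda>y. b y $ j) x) \<longlongrightarrow> (0::real)) (at_right (0::real))"
      by (simp add: tendsto_cong)
    then show ?thesis using tendsto_unique[OF _ tendsto_const] by (metis trivial_limit_at_right_real)
  qed
  then show ?thesis by (simp add: divergence_def)
qed

lemma op_L_adj_test: "\<phi> \<in> test_functions \<Omega> \<Longrightarrow> op_L_adj A b \<phi> = op_L A (\<lambda>x. - b x) \<phi>"
  using op_L_adj_eq[OF divergence_b Ck_on_differentiable[OF test_functions_Ck open_UNIV UNIV_I]] by (intro ext)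

text \<open>By \<open>b_dilation\<close> the drift term is homogeneous of degree two by itself, so
  its sign may be changed.\<close>

lemma homogeneous_adjoint: "homogeneous_operator A (\<lambda>x. - b x) \<sigma>"
proof -
  have "homogeneous_degree_two \<sigma> A (\<lambda>x. - b x)"
    unfolding homogeneous_degree_two_def comp_def
  proof (intro allI impI, elim conjE)
    fix w :: "real ^ 'n \<Rightarrow> real" and x and r :: real
    assume w: "smooth_on UNIV w" and r: "r > 0"
    have d: "w differentiable (at y)" for y by (rule Ck_on_differentiable[OF smooth_onD[OF w] open_UNIV UNIV_I])
    have "b x $ j * pderiv_at j (\<lambda>y. w (\<delta> r y)) x = (r powr \<sigma> j * b x $ j) * pderiv_at j w (\<delta> r x)" for j
      by (simp add: pderiv_at_dilation[OF d])
    then have "b x $ j * pderiv_at j (\<lambda>y. w (\<delta> r y)) x = r\<^sup>2 * (b (\<delta> r x) $ j * pderiv_at j w (\<delta> r x))" for j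
      unfolding b_dilation[OF r, symmetric] by simp
    then show "op_L A (\<lambda>x. - b x) (\<lambda>y. w (\<delta> r y)) x = r\<^sup>2 * op_L A (\<lambda>x. - b x) w (\<delta> r x)"
      unfolding op_L_uminus_drift op_L_dilation[OF w r]
      by (simp add: right_diff_distrib sum_distrib_left mult.left_commute)
  qed
  then show ?thesis
    by (intro homogeneous_operator.intro adjoint homogeneous_operator_axioms.intro nonneg_A \<sigma>_ge_1)
qed

end

section \<open>The Liouville theorem\<close>

text \<open>All distributions built here have order zero: with N = 0 the only index is the empty
  list and the seminorm is the supremum of |\<phi>|.\<close>

lemma distribution_onI:
  assumes "\<And>\<phi> \<psi>. \<phi> \<in> test_functions \<Omega> \<Longrightarrow> \<psi> \<in> test_functions \<Omega> \<Longrightarrow> T (\<lambda>x. \<phi> x + \<psi> x) = T \<phi> + T \<psi>"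
    and "\<And>\<phi> c. \<phi> \<in> test_functions \<Omega> \<Longrightarrow> T (\<lambda>x. c * \<phi> x) = c * T \<phi>"
    and bound: "\<And>K. compact K \<Longrightarrow> K \<subseteq> \<Omega> \<Longrightarrow>
      \<exists>C. \<forall>\<phi>\<in>test_functions K. \<forall>B. (\<forall>x. \<bar>\<phi> x\<bar> \<le> B) \<longrightarrow> \<bar>T \<phi>\<bar> \<le> C * B"
  shows "distribution_on \<Omega> T"
  unfolding distribution_on_def
proof (intro conjI allI impI ballI)
  fix K assume "compact K \<and> K \<subseteq> \<Omega>"
  then obtain C where C: "\<And>\<phi> B. \<phi> \<in> test_functions K \<Longrightarrow> (\<And>x. \<bar>\<phi> x\<bar> \<le> B) \<Longrightarrow> \<bar>T \<phi>\<bar> \<le> C * B"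
    using bound[of K] by blast
  have "\<bar>T \<phi>\<bar> \<le> C * (\<Sum>is\<in>{is. length is \<le> 0}. SUP x. \<bar>foldr pderiv_at is \<phi> x\<bar>)" if \<phi>: "\<phi> \<in> test_functions K" for \<phi>
  proof -
    obtain B where B: "\<And>x. \<bar>\<phi> x\<bar> \<le> B" using test_functions_bounded[OF \<phi>] by metis
    have "\<bar>\<phi> x\<bar> \<le> (SUP x. \<bar>\<phi> x\<bar>)" for x
      by (rule cSUP_upper) (auto intro!: bdd_aboveI[of _ B] B)
    then show ?thesis using C[OF \<phi>] by simp
  qed
  then show "\<exists>C N. \<forall>\<phi>\<in>test_functions K.
      \<bar>T \<phi>\<bar> \<le> C * (\<Sum>is\<in>{is. length is \<le> N}. SUP x. \<bar>foldr pderiv_at is \<phi> x\<bar>)" by blast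
qed (use assms in auto)

text \<open>Stands in for Hoelder's inequality: when t > s one has t/s \<le> (t/s)^p. The parameter
  \<open>s\<close> is tuned at each use to balance a volume against an L^p integral.\<close>

lemma le_plus_powr:
  fixes t s p :: real
  assumes "0 \<le> t" "0 < s" "1 \<le> p"
  shows "t \<le> s + s powr (1 - p) * t powr p"
proof (cases "t \<le> s")
  case True
  moreover have "0 \<le> s powr (1 - p) * t powr p" by (intro mult_nonneg_nonneg) auto
  ultimately show ?thesis by linarith
next
  case False
  have "t / s \<le> (t / s) powr p"
    using powr_mono[of 1 p "t / s"] False assms by (simp add: field_simps)
  then have "t \<le> s * (t / s) powr p" using assms(2) by (simp add: field_simps)
  also have "\<dots> = s powr (1 - p) * t powr p"
    using assms by (simp add: powr_divide powr_diff)
  finally show ?thesis using assms(2) by simp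
qed

lemma integrable_powr_cong_AE:
  assumes "AE x in lebesgue. u x = f x" "f \<in> borel_measurable lebesgue" "in_Lp p u"
  shows "integrable lebesgue (\<lambda>x. \<bar>f x\<bar> powr p)"
proof -
  have i: "integrable lebesgue (\<lambda>x. \<bar>u x\<bar> powr p)" using assms(3) by (simp add: in_Lp_def)
  then show ?thesis
    by (rule integrable_cong_AE_imp) (use assms(1,2) in auto)
qed

lemma L1_locD: "L1_loc u \<Longrightarrow> compact K \<Longrightarrow> u absolutely_integrable_on K"
  by (simp add: L1_loc_def)

lemma distribution_on_L1_loc:
  fixes u :: "real ^ 'n \<Rightarrow> real"
  assumes "L1_loc u"
  shows "distribution_on \<Omega> (\<lambda>\<phi>. LINT x|lebesgue. u x * \<phi> x)"
proof (rule distribution_onI)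
  note loc = L1_locD[OF assms]
  show "(LINT x|lebesgue. u x * (\<phi> x + \<psi> x)) = (LINT x|lebesgue. u x * \<phi> x) + (LINT x|lebesgue. u x * \<psi> x)"
    if "\<phi> \<in> test_functions \<Omega>" "\<psi> \<in> test_functions \<Omega>" for \<phi> \<psi>
    using L1_loc_times_test_integrable[OF loc that(1)] L1_loc_times_test_integrable[OF loc that(2)]
    by (simp add: distrib_left)
  show "(LINT x|lebesgue. u x * (c * \<phi> x)) = c * (LINT x|lebesgue. u x * \<phi> x)" for \<phi> c
    by (simp add: mult.left_commute)
  fix K :: "(real ^ 'n) set" assume K: "compact K"
  have i: "integrable lebesgue (\<lambda>x. indicator K x * u x)"
    using loc[OF K] by (simp add: set_integrable_def)
  have "\<bar>LINT x|lebesgue. u x * \<phi> x\<bar> \<le> (LINT x|lebesgue. \<bar>indicator K x * u x\<bar>) * B"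
    if \<phi>: "\<phi> \<in> test_functions K" and B: "\<forall>x. \<bar>\<phi> x\<bar> \<le> B" for \<phi> B
  proof -
    have "\<bar>u x * \<phi> x\<bar> \<le> \<bar>indicator K x * u x\<bar> * B" for x
    proof (cases "x \<in> K")
      case False
      then have "\<phi> x = 0" using test_functionsE[OF \<phi>] by (metis subsetD)
      then show ?thesis using False by simp
    qed (use B in \<open>auto simp: abs_mult intro: mult_left_mono\<close>)
    then have "(LINT x|lebesgue. \<bar>u x * \<phi> x\<bar>) \<le> (LINT x|lebesgue. \<bar>indicator K x * u x\<bar> * B)"
      using i by (intro integral_mono_AE') (auto intro: order_trans[OF abs_ge_zero])
    then have "(LINT x|lebesgue. \<bar>u x * \<phi> x\<bar>) \<le> (LINT x|lebesgue. \<bar>indicator K x * u x\<bar>) * B"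
      by simp
    then show ?thesis by (rule order_trans[OF integral_abs_bound])
  qed
  then show "\<exists>C. \<forall>\<phi>\<in>test_functions K. \<forall>B. (\<forall>x. \<bar>\<phi> x\<bar> \<le> B) \<longrightarrow> \<bar>LINT x|lebesgue. u x * \<phi> x\<bar> \<le> C * B"
    by blast
qed

lemma continuous_L1_loc:
  assumes "continuous_on UNIV f"
  shows "L1_loc f"
  unfolding L1_loc_def
proof (intro conjI allI impI)
  show m: "f \<in> borel_measurable lebesgue" by (rule borel_measurable_lebesgue_continuous[OF assms])
  fix K :: "(real ^ 'a) set" assume K: "compact K"
  have "bounded (f ` K)"
    using K assms by (intro compact_imp_bounded compact_continuous_image) (auto intro: continuous_on_subset)
  then obtain B where B: "\<And>x. x \<in> K \<Longrightarrow> \<bar>f x\<bar> \<le> B" "B > 0" by (auto simp: bounded_pos)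
  have "K \<in> sets lebesgue" using lmeasurable_compact[OF K] by (rule fmeasurableD)
  then have "integrable lebesgue (\<lambda>x. indicator K x * f x)"
    using m B by (intro integrable_lebesgue_compact[OF _ K, of _ B] borel_measurable_times borel_measurable_indicator)
      (auto simp: indicator_def)
  then show "f absolutely_integrable_on K" by (simp add: set_integrable_def)
qed

section \<open>Subsolutions in L^p are smooth solutions\<close>

context homogeneous_operator
begin

lemma Q_ge: "real CARD('n) \<le> Q"
  unfolding homogeneous_dim_def using sum_mono[of UNIV "\<lambda>_. 1" \<sigma>] \<sigma>_ge_1 by simp

lemma Q_pos: "0 < Q"
  using Q_ge zero_less_card_finite[where 'a = 'n] by linarith

definition unit_volume :: real where "unit_volume = measure lebesgue {x. N x \<le> 1}"

lemma lmeasurable_ball: "{x. N x \<le> R} \<in> lmeasurable"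
  by (rule lmeasurable_compact[OF compact_hnorm_le[OF \<sigma>_pos]])

lemma integrable_indicator_ball: "integrable lebesgue (indicat_real {x. N x \<le> R})"
  using lmeasurable_ball[of R] by (auto simp: fmeasurable_def)

lemma integral_indicator_ball:
  assumes "R > 0"
  shows "(LINT x|lebesgue. indicat_real {x. N x \<le> R} x) = R powr Q * unit_volume"
proof -
  have "indicat_real {x. N x \<le> R} x = indicat_real {x. N x \<le> 1} (\<delta> (inverse R) x)" for x
    using assms by (auto simp: indicator_def N_\<delta> field_simps)
  then have "(LINT x|lebesgue. indicat_real {x. N x \<le> R} x)
      = inverse R powr (- Q) * (LINT x|lebesgue. indicat_real {x. N x \<le> 1} x)"
    using lebesgue_integral_dilation(1)[of "inverse R" "indicat_real {x. N x \<le> 1}" \<sigma>] assms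
      borel_measurable_integrable[OF integrable_indicator_ball[of 1]] by simp
  then show ?thesis using assms by (simp add: unit_volume_def powr_minus inverse_powr)
qed

lemma unit_volume_nonneg: "0 \<le> unit_volume"
  by (simp add: unit_volume_def)

abbreviation L_adj :: "(real ^ 'n \<Rightarrow> real) \<Rightarrow> real ^ 'n \<Rightarrow> real" where
  "L_adj \<equiv> op_L A (\<lambda>x. - b x)"

sublocale adj: second_order_operator A "\<lambda>x. - b x" by (rule adjoint)

lemmas L_adj_dilation = homogeneous_operator.op_L_dilation[OF homogeneous_adjoint]

lemma open_N_less: "open {x. N x < R}" "open {x. R < N x}"
  using continuous_on_hnorm[of \<sigma> UNIV, OF \<sigma>_pos] by (auto intro!: open_Collect_less continuous_intros)

text \<open>\<open>cutoff\<close> is constant near every such point.\<close>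

lemma op_L_cutoff_zero:
  assumes "N x < 1 \<or> cutoff_radius \<sigma> < N x"
  shows "op_L A c cutoff x = 0"
  using assms
proof
  assume "N x < 1"
  then have "op_L A c cutoff x = op_L A c (\<lambda>_. 1) x"
    by (intro op_L_cong[OF open_N_less(1)[of 1]]) (auto intro!: cutoff_eq_1[of \<sigma>] \<sigma>_pos)
  then show ?thesis by simp
next
  assume "cutoff_radius \<sigma> < N x"
  then have "op_L A c cutoff x = op_L A c (\<lambda>_. 0) x"
    by (intro op_L_cong[OF open_N_less(2)[of "cutoff_radius \<sigma>"]]) (auto intro!: cutoff_eq_0[of \<sigma>] \<sigma>_pos)
  then show ?thesis by simp
qed

lemma scaled_cutoff_test: "R > 0 \<Longrightarrow> (\<lambda>x. cutoff (\<delta> R x)) \<in> test_functions UNIV"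
  by (rule test_functions_dilation[OF cutoff_test]) auto

text \<open>After dilation by 1/R the image of the cutoff under \<open>L_adj\<close> is R^(-2) times
  a bounded function living on R \<le> N x \<le> \<open>cutoff_radius \<sigma> * R\<close>.
  Estimating |u| there with \<open>le_plus_powr\<close> leaves a volume term and the tail of the L^p
  integral.\<close>

lemma weak_pairing_cutoff_tendsto_0:
  assumes u: "L1_loc u" "in_Lp p u" and p: "1 \<le> p" "p \<le> 1 + 2 / (Q - 2)" and Q: "2 < Q"
  shows "(\<lambda>m. LINT x|lebesgue. u x * L_adj (\<lambda>x. cutoff (\<delta> (inverse (real (Suc m))) x)) x) \<longlonglongrightarrow> 0"
    (is "?a \<longlonglongrightarrow> 0")
proof -
  obtain B where B: "B > 0" "\<And>x. \<bar>L_adj cutoff x\<bar> \<le> B"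
    using test_functions_bounded[OF adj.test_functions_op_L[OF cutoff_test]] by blast
  let ?C = "cutoff_radius \<sigma> powr Q * unit_volume"
  define \<tau> where "\<tau> m = (LINT x|lebesgue. indicator {x. real (Suc m) \<le> N x} x * \<bar>u x\<bar> powr p)" for m :: nat
  have up: "integrable lebesgue (\<lambda>x. \<bar>u x\<bar> powr p)" using u(2) by (simp add: in_Lp_def)
  have um: "u \<in> borel_measurable lebesgue" using u(2) by (simp add: in_Lp_def)
  have sN: "{x. R \<le> N x} \<in> sets lebesgue" for R
  proof -
    have "closed {x. R \<le> N x}"
      using continuous_on_hnorm[of \<sigma> UNIV, OF \<sigma>_pos] by (intro closed_Collect_le continuous_intros)
    then show ?thesis by auto
  qed
  have tail_int: "integrable lebesgue (\<lambda>x. indicator {x. R \<le> N x} x * \<bar>u x\<bar> powr p)" for R :: real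
    using integrable_mult_indicator[OF sN up] by simp
  \<comment> \<open>At the largest admissible \<open>p\<close> no negative power of R remains in
    front of this tail, and the convergence rests on it alone.\<close>
  have \<tau>: "\<tau> \<longlonglongrightarrow> 0"
  proof -
    have "\<tau> \<longlonglongrightarrow> (LINT (x :: real ^ 'n)|lebesgue. (0::real))"
      unfolding \<tau>_def
    proof (rule integral_dominated_convergence[OF _ _ up])
      show "(\<lambda>x. indicator {x. real (Suc m) \<le> N x} x * \<bar>u x\<bar> powr p) \<in> borel_measurable lebesgue" for m
        using tail_int by (rule borel_measurable_integrable)
      show "AE x in lebesgue. (\<lambda>m. indicator {x. real (Suc m) \<le> N x} x * \<bar>u x\<bar> powr p) \<longlonglongrightarrow> 0"
      proof (intro AE_I2 tendsto_eventually)
        fix x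
        obtain k where "N x < real k" using reals_Archimedean2 by blast
        then show "eventually (\<lambda>m. indicator {x. real (Suc m) \<le> N x} x * \<bar>u x\<bar> powr p = 0) sequentially"
          by (intro eventually_sequentiallyI[of k]) auto
      qed
      show "AE x in lebesgue. norm (indicator {x. real (Suc m) \<le> N x} x * \<bar>u x\<bar> powr p) \<le> \<bar>u x\<bar> powr p" for m
        by (intro AE_I2) (auto simp: indicator_def)
    qed auto
    then show ?thesis by simp
  qed
  have bound: "\<bar>?a m\<bar> \<le> B * (\<epsilon> * ?C + \<epsilon> powr (1 - p) * \<tau> m)" if \<epsilon>: "\<epsilon> > 0" for \<epsilon> m
  proof -
    define R where "R = real (Suc m)"
    have R: "R \<ge> 1" by (simp add: R_def)
    \<comment> \<open>Chosen so that the volume term becomes R^(-2) * s * R^Q = \<epsilon>.\<close>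
    define s where "s = \<epsilon> * R powr (2 - Q)"
    have s: "s > 0" using \<epsilon> R by (simp add: s_def)
    let ?h = "\<lambda>x. inverse R ^ 2 * B * (s * indicat_real {x. N x \<le> cutoff_radius \<sigma> * R} x
        + s powr (1 - p) * (indicator {x. R \<le> N x} x * \<bar>u x\<bar> powr p))"
    have pt: "\<bar>u x * L_adj (\<lambda>x. cutoff (\<delta> (inverse R) x)) x\<bar> \<le> ?h x" for x
    proof -
      have eq: "L_adj (\<lambda>x. cutoff (\<delta> (inverse R) x)) x = (inverse R)\<^sup>2 * L_adj cutoff (\<delta> (inverse R) x)"
        using R by (intro L_adj_dilation smooth_cutoff) auto
      show ?thesis
      proof (cases "R \<le> N x \<and> N x \<le> cutoff_radius \<sigma> * R")
        case True
        have "\<bar>u x * L_adj (\<lambda>x. cutoff (\<delta> (inverse R) x)) x\<bar> \<le> \<bar>u x\<bar> * ((inverse R)\<^sup>2 * B)"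
          unfolding eq abs_mult by (intro mult_left_mono mult_mono B) auto
        also have "\<dots> \<le> (s + s powr (1 - p) * \<bar>u x\<bar> powr p) * ((inverse R)\<^sup>2 * B)"
          using B(1) by (intro mult_right_mono le_plus_powr s p) auto
        finally show ?thesis using True by (simp add: mult_ac)
      next
        case False
        then have "L_adj cutoff (\<delta> (inverse R) x) = 0"
          using R by (intro op_L_cutoff_zero) (auto simp: N_\<delta> field_simps)
        then show ?thesis using B(1) s by (simp add: eq)
      qed
    qed
    have i1: "integrable lebesgue (\<lambda>x. s * indicat_real {x. N x \<le> cutoff_radius \<sigma> * R} x)"
      by (intro integrable_mult_right integrable_indicator_ball)
    have i2: "integrable lebesgue (\<lambda>x. s powr (1 - p) * (indicator {x. R \<le> N x} x * \<bar>u x\<bar> powr p))"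
      by (intro integrable_mult_right tail_int)
    have ih: "integrable lebesgue ?h"
      by (intro integrable_mult_right Bochner_Integration.integrable_add i1 i2)
    have "\<bar>?a m\<bar> \<le> (LINT x|lebesgue. \<bar>u x * L_adj (\<lambda>x. cutoff (\<delta> (inverse R) x)) x\<bar>)"
      unfolding R_def by (rule integral_abs_bound)
    also have "\<dots> \<le> (LINT x|lebesgue. ?h x)"
      by (rule integral_mono_AE'[OF ih]) (intro AE_I2 pt, intro AE_I2 order_trans[OF abs_ge_zero pt])
    also have "\<dots> = (inverse R)\<^sup>2 * B * (s * ((cutoff_radius \<sigma> * R) powr Q * unit_volume) + s powr (1 - p) * \<tau> m)"
      using i1 i2 integral_indicator_ball[of "cutoff_radius \<sigma> * R"] cutoff_radius_pos[of \<sigma>] R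
      by (simp add: \<tau>_def R_def)
    also have "\<dots> = B * (((inverse R)\<^sup>2 * s * R powr Q) * ?C + ((inverse R)\<^sup>2 * s powr (1 - p)) * \<tau> m)"
      using R cutoff_radius_pos[of \<sigma>] by (simp add: powr_mult algebra_simps)
    also have "(inverse R)\<^sup>2 * s * R powr Q = \<epsilon>"
    proof -
      have "(inverse R)\<^sup>2 = R powr (-2)" using R by (simp add: powr_minus powr_numeral power_inverse)
      then have "(inverse R)\<^sup>2 * s * R powr Q = \<epsilon> * (R powr (-2) * R powr (2 - Q) * R powr Q)"
        by (simp add: s_def)
      also have "R powr (-2) * R powr (2 - Q) * R powr Q = 1"
        using R by (simp add: powr_add[symmetric])
      finally show ?thesis by simp
    qed
    also have "(inverse R)\<^sup>2 * s powr (1 - p) \<le> \<epsilon> powr (1 - p)"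
    proof -
      have "(inverse R)\<^sup>2 = R powr (-2)" using R by (simp add: powr_minus powr_numeral power_inverse)
      then have "(inverse R)\<^sup>2 * s powr (1 - p) = \<epsilon> powr (1 - p) * R powr (-2 + (2 - Q) * (1 - p))"
        using R \<epsilon> by (simp add: s_def powr_mult powr_powr powr_add[symmetric])
      \<comment> \<open>This is (Q - 2) (p - 1) \<le> 2, the upper bound on
        \<open>p\<close>.\<close>
      moreover have "-2 + (2 - Q) * (1 - p) \<le> 0"
        using p Q by (simp add: field_simps)
      then have "R powr (-2 + (2 - Q) * (1 - p)) \<le> R powr 0"
        using R by (intro powr_mono)
      ultimately show ?thesis using R by (simp add: mult_left_le)
    qed
    finally show ?thesis
      using B(1) by (simp add: \<tau>_def mult_right_mono)
  qed
  show ?thesis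
  proof (rule LIMSEQ_I)
    fix \<eta> :: real assume "\<eta> > 0"
    \<comment> \<open>Gives the volume term half of \<eta>; the summand 1 keeps the divisor positive
      even when the constant is 0.\<close>
    define \<epsilon> where "\<epsilon> = \<eta> / (2 * B * (?C + 1))"
    have C: "?C \<ge> 0" using unit_volume_nonneg by simp
    have \<epsilon>: "\<epsilon> > 0" using \<open>\<eta> > 0\<close> B(1) C by (simp add: \<epsilon>_def add_nonneg_pos)
    have e: "B * (\<epsilon> * ?C) < \<eta> / 2"
    proof -
      have half: "B * (\<eta> / (2 * B * D) * D) = \<eta> / 2" if "D > 0" for D
        using that B(1) by (simp add: field_simps)
      have "B * (\<epsilon> * (?C + 1)) = \<eta> / 2"
        unfolding \<epsilon>_def by (rule half) (use C in linarith)
      moreover have "B * (\<epsilon> * ?C) < B * (\<epsilon> * (?C + 1))" using \<epsilon> B(1) by simp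
      ultimately show ?thesis by simp
    qed
    have "(\<lambda>m. B * (\<epsilon> powr (1 - p) * \<tau> m)) \<longlonglongrightarrow> B * (\<epsilon> powr (1 - p) * 0)"
      by (intro tendsto_intros \<tau>)
    then have "eventually (\<lambda>m. B * (\<epsilon> powr (1 - p) * \<tau> m) < \<eta> / 2) sequentially"
      using \<open>\<eta> > 0\<close> by (intro order_tendstoD(2)) auto
    then have "eventually (\<lambda>m. norm (?a m - 0) < \<eta>) sequentially"
    proof eventually_elim
      case (elim m)
      then show ?case using bound[OF \<epsilon>, of m] e by (simp add: distrib_left)
    qed
    then show "\<exists>no. \<forall>n\<ge>no. norm (?a n - 0) < \<eta>" by (simp add: eventually_sequentially)
  qed
qed

text \<open>For large m the cutoff \<open>\<rho> m\<close> is 1 on the support of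
  \<open>\<phi>\<close>, so both M \<open>\<rho> m\<close> + \<phi> and M \<open>\<rho> m\<close> -
  \<phi> are nonnegative tests. This bounds the modulus of the pairing with \<open>\<phi>\<close> by
  M times the pairing with \<open>\<rho> m\<close>, which tends to 0.\<close>

lemma weak_subsolution_imp_solution:
  assumes u: "weak_L_nonneg A b u" "in_Lp p u" and p: "1 \<le> p" "p \<le> 1 + 2 / (Q - 2)" and Q: "2 < Q"
    and \<phi>: "\<phi> \<in> test_functions UNIV"
  shows "(LINT x|lebesgue. u x * L_adj \<phi> x) = 0"
proof -
  have loc: "L1_loc u" using u(1) by (simp add: weak_L_nonneg_def)
  define \<rho> where "\<rho> m x = cutoff (\<delta> (inverse (real (Suc m))) x)" for m x
  define a where "a m = (LINT x|lebesgue. u x * L_adj (\<rho> m) x)" for m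
  have a: "a \<longlonglongrightarrow> 0"
    using weak_pairing_cutoff_tendsto_0[OF loc u(2) p Q] by (simp add: a_def[abs_def] \<rho>_def[abs_def])
  have \<rho>: "\<rho> m \<in> test_functions UNIV" for m
    unfolding \<rho>_def by (rule scaled_cutoff_test) simp
  obtain M where M: "M > 0" "\<And>x. \<bar>\<phi> x\<bar> \<le> M" using test_functions_bounded[OF \<phi>] by blast
  obtain K where K: "compact K" "\<And>x. x \<notin> K \<Longrightarrow> \<phi> x = 0" using test_functionsE[OF \<phi>] by metis
  have "bounded (N ` K)"
    using K(1) continuous_on_hnorm[of \<sigma> K, OF \<sigma>_pos] by (intro compact_imp_bounded compact_continuous_image)
  then obtain R where R: "\<And>x. x \<in> K \<Longrightarrow> N x \<le> R" by (auto simp: bounded_iff) (metis abs_ge_self order_trans)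
  obtain m0 where m0: "R \<le> real m0" using real_arch_simple by blast
  let ?I = "LINT x|lebesgue. u x * L_adj \<phi> x"
  have "\<bar>?I\<bar> \<le> M * a m" if m: "m \<ge> m0" for m
  proof -
    have le: "\<bar>\<phi> x\<bar> \<le> M * \<rho> m x" for x
    proof (cases "x \<in> K")
      case True
      have "N x \<le> real (Suc m)" using R[OF True] m0 m by linarith
      then have "N (\<delta> (inverse (real (Suc m))) x) \<le> 1" by (simp add: N_\<delta> field_simps)
      then have "\<rho> m x = 1" unfolding \<rho>_def by (intro cutoff_eq_1[of \<sigma>] \<sigma>_pos)
      then show ?thesis using M(2) by simp
    next
      case False
      then show ?thesis using K(2) M(1) cutoff_bounds(1) by (auto simp: \<rho>_def intro!: mult_nonneg_nonneg)
    qed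
    have int: "integrable lebesgue (\<lambda>x. u x * L_adj \<psi> x)" if "\<psi> \<in> test_functions UNIV" for \<psi>
      by (rule L1_loc_times_test_integrable[OF L1_locD[OF loc] adj.test_functions_op_L[OF that]])
    have "0 \<le> M * a m + c * ?I" if c: "\<bar>c\<bar> = 1" for c
    proof -
      have t: "(\<lambda>x. M * \<rho> m x + c * \<phi> x) \<in> test_functions UNIV"
        by (intro test_functions_add test_functions_cmult \<rho> \<phi>)
      have "0 \<le> M * \<rho> m x + c * \<phi> x" for x
      proof -
        have "\<bar>c * \<phi> x\<bar> \<le> M * \<rho> m x" using le[of x] c by (simp add: abs_mult)
        then show ?thesis by linarith
      qed
      then have "0 \<le> (LINT x|lebesgue. u x * L_adj (\<lambda>x. M * \<rho> m x + c * \<phi> x) x)"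
        using u(1) t op_L_adj_test[OF t] by (auto simp: weak_L_nonneg_def)
      moreover have "L_adj (\<lambda>x. M * \<rho> m x + c * \<phi> x) x = M * L_adj (\<rho> m) x + c * L_adj \<phi> x" for x
        by (subst adj.op_L_add[OF open_UNIV])
          (auto intro!: Ck_on_cmult test_functions_Ck[OF \<rho>] test_functions_Ck[OF \<phi>]
            simp: adj.op_L_cmult[OF open_UNIV test_functions_Ck[OF \<rho>]] adj.op_L_cmult[OF open_UNIV test_functions_Ck[OF \<phi>]])
      ultimately have "0 \<le> (LINT x|lebesgue. M * (u x * L_adj (\<rho> m) x) + c * (u x * L_adj \<phi> x))"
        by (simp add: algebra_simps)
      then show ?thesis using int[OF \<rho>] int[OF \<phi>] by (simp add: a_def)
    qed
    from this[of 1] this[of "-1"] show ?thesis by simp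
  qed
  moreover have "(\<lambda>m. M * a m) \<longlonglongrightarrow> M * 0" by (intro tendsto_intros a)
  ultimately have "\<bar>?I\<bar> \<le> M * 0"
    by (intro tendsto_lowerbound[of _ _ sequentially "\<bar>?I\<bar>"]) (auto simp: eventually_sequentially)
  then show ?thesis by simp
qed

text \<open>Hypoellipticity yields only a smooth \<open>f\<close> with the same pairings as
  \<open>u\<close>. \<open>du_Bois_Reymond\<close> turns this into equality almost everywhere, and
  \<open>fundamental_lemma\<close> makes the weak equation pointwise.\<close>

lemma weak_solution_smooth:
  assumes "hypoelliptic A b" and u: "L1_loc u"
    and zero: "\<And>\<phi>. \<phi> \<in> test_functions UNIV \<Longrightarrow> (LINT x|lebesgue. u x * L_adj \<phi> x) = 0"
  obtains f where "smooth_on UNIV f" "AE x in lebesgue. u x = f x" "\<And>x. op_L A b f x = 0"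
proof -
  let ?T = "\<lambda>\<phi>. LINT x|lebesgue. u x * \<phi> x"
  have "distribution_smooth_rep UNIV (\<lambda>\<phi>. ?T (op_L_adj A b \<phi>))"
    unfolding distribution_smooth_rep_def
    by (intro exI[of _ "\<lambda>_. 0"]) (auto simp: zero op_L_adj_test intro: smooth_on_const)
  then have "distribution_smooth_rep UNIV ?T"
    using assms(1) distribution_on_L1_loc[OF u, of UNIV] by (auto simp: hypoelliptic_def)
  then obtain f where f: "smooth_on UNIV f"
    and rep: "\<And>\<phi>. \<phi> \<in> test_functions UNIV \<Longrightarrow> ?T \<phi> = (LINT x|lebesgue. f x * \<phi> x)"
    unfolding distribution_smooth_rep_def set_lebesgue_integral_def by auto
  have fc: "continuous_on UNIV f" by (rule Ck_on_continuous[OF smooth_onD[OF f]])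
  have fl: "L1_loc f" by (rule continuous_L1_loc[OF fc])
  have "AE x in lebesgue. u x - f x = 0"
  proof (rule du_Bois_Reymond)
    show "(\<lambda>x. u x - f x) \<in> borel_measurable lebesgue"
      using u fl by (intro borel_measurable_diff) (simp_all add: L1_loc_def)
    show "(\<lambda>x. u x - f x) absolutely_integrable_on K" if "compact K" for K
      using L1_locD[OF u that] L1_locD[OF fl that] by (rule set_integral_diff(1))
    show "(LINT x|lebesgue. (u x - f x) * \<phi> x) = 0" if "\<phi> \<in> test_functions UNIV" for \<phi>
      using rep[OF that] L1_loc_times_test_integrable[OF L1_locD[OF u] that]
        L1_loc_times_test_integrable[OF L1_locD[OF fl] that] by (simp add: left_diff_distrib)
  qed
  then have ae: "AE x in lebesgue. u x = f x" by simp
  have "op_L A b f x = 0" for x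
  proof (rule fundamental_lemma[OF open_UNIV _ _ UNIV_I])
    show "continuous_on UNIV (op_L A b f)"
      by (rule Ck_on_continuous[OF smooth_onD[OF smooth_op_L[OF open_UNIV f]]])
    fix \<phi> :: "real ^ 'n \<Rightarrow> real" assume \<phi>: "\<phi> \<in> test_functions UNIV"
    obtain K where K: "compact K" "\<And>x. x \<notin> K \<Longrightarrow> \<phi> x = 0" using test_functionsE[OF \<phi>] by metis
    have "(LINT x|lebesgue. \<phi> x * op_L A b f x) = (LINT x|lebesgue. f x * L_adj \<phi> x)"
      using integration_by_parts(1)[OF divergence_b open_UNIV smooth_onD[OF f] test_functions_Ck[OF \<phi>] K(1) subset_UNIV K(2)]
      by simp
    also have "\<dots> = 0" using rep[OF adj.test_functions_op_L[OF \<phi>]] zero[OF \<phi>] by simp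
    finally show "(LINT x|lebesgue. op_L A b f x * \<phi> x) = 0" by (simp add: mult.commute)
  qed
  with f ae that show thesis by blast
qed

text \<open>The dilations shrink the compact support of \<open>cutoff\<close> to the origin, where
  \<open>h\<close> is continuous.\<close>

lemma cutoff_average_tendsto:
  assumes h: "continuous_on UNIV h"
  shows "(\<lambda>m. LINT x|lebesgue. h (\<delta> (inverse (2 ^ m)) x) * cutoff x) \<longlonglongrightarrow> h 0 * (LINT x|lebesgue. cutoff (x :: real ^ 'n))"
proof -
  let ?K = "{x. N x \<le> cutoff_radius \<sigma>}"
  have "bounded (h ` ?K)"
    using h by (intro compact_imp_bounded compact_continuous_image compact_hnorm_le \<sigma>_pos) (auto intro: continuous_on_subset)
  then obtain B where B: "\<And>x. x \<in> ?K \<Longrightarrow> \<bar>h x\<bar> \<le> B" by (auto simp: bounded_iff)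
  have "(\<lambda>m. LINT x|lebesgue. h (\<delta> (inverse (2 ^ m)) x) * cutoff x) \<longlonglongrightarrow> (LINT x|lebesgue. h 0 * cutoff (x :: real ^ 'n))"
  proof (rule integral_dominated_convergence[where w = "\<lambda>x. B * cutoff x"])
    show "integrable lebesgue (\<lambda>x. B * cutoff x)"
      by (intro integrable_mult_right test_functions_integrable[OF cutoff_test])
    show "(\<lambda>x. h 0 * cutoff x) \<in> borel_measurable lebesgue"
      by (intro borel_measurable_lebesgue_continuous continuous_intros test_functions_continuous[OF cutoff_test])
    show "(\<lambda>x. h (\<delta> (inverse (2 ^ m)) x) * cutoff x) \<in> borel_measurable lebesgue" for m
      by (intro borel_measurable_lebesgue_continuous continuous_intros test_functions_continuous[OF cutoff_test]
          continuous_on_compose2[OF h]) auto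
    show "AE x in lebesgue. (\<lambda>m. h (\<delta> (inverse (2 ^ m)) x) * cutoff x) \<longlonglongrightarrow> h 0 * cutoff x"
    proof (intro AE_I2 tendsto_mult tendsto_const)
      fix x
      have "filterlim (\<lambda>m. inverse (2 ^ m) :: real) (at_right 0) sequentially"
        unfolding filterlim_at using LIMSEQ_inverse_realpow_zero[of 2] by auto
      then have lim: "(\<lambda>m. \<delta> (inverse (2 ^ m)) x) \<longlonglongrightarrow> 0"
        by (rule filterlim_compose[OF dilation_tendsto_0[OF \<sigma>_pos]])
      have cont: "isCont h 0" using h by (simp add: continuous_on_eq_continuous_at)
      show "(\<lambda>m. h (\<delta> (inverse (2 ^ m)) x)) \<longlonglongrightarrow> h 0"
        by (rule isCont_tendsto_compose[OF cont lim])
    qed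
    show "AE x in lebesgue. norm (h (\<delta> (inverse (2 ^ m)) x) * cutoff x) \<le> B * cutoff x" for m
    proof (rule AE_I2)
      fix x
      show "norm (h (\<delta> (inverse (2 ^ m)) x) * cutoff x) \<le> B * cutoff x"
      proof (cases "N x \<le> cutoff_radius \<sigma>")
        case True
        have "N (\<delta> (inverse (2 ^ m)) x) \<le> N x"
          using hnorm_nonneg[of \<sigma> x] by (simp add: N_\<delta> mult_left_le_one_le inverse_le_1_iff)
        then have "\<bar>h (\<delta> (inverse (2 ^ m)) x)\<bar> \<le> B" using True by (intro B) auto
        then show ?thesis using cutoff_bounds(1)[of x] by (simp add: abs_mult mult_right_mono)
      qed (simp add: cutoff_eq_0[of \<sigma>, OF \<sigma>_pos])
    qed
  qed
  then show ?thesis by simp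
qed

lemma integral_cutoff_pos: "0 < (LINT x|lebesgue. cutoff (x :: real ^ 'n))"
proof -
  have "(LINT x|lebesgue. cutoff (x :: real ^ 'n)) \<noteq> 0"
  proof
    assume "(LINT x|lebesgue. cutoff (x :: real ^ 'n)) = 0"
    then have "AE x in lebesgue. cutoff (x :: real ^ 'n) = 0"
      using integral_nonneg_eq_0_iff_AE[OF test_functions_integrable[OF cutoff_test]] cutoff_bounds(1) by auto
    then have "cutoff (0 :: real ^ 'n) = 0"
      by (intro AE_zero_imp_zero[OF open_UNIV test_functions_continuous[OF cutoff_test]]) auto
    then show False using cutoff_eq_1[of \<sigma> 0, OF \<sigma>_pos] by simp
  qed
  moreover have "0 \<le> (LINT x|lebesgue. cutoff (x :: real ^ 'n))"
    by (intro Bochner_Integration.integral_nonneg cutoff_bounds)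
  ultimately show ?thesis by simp
qed

end

section \<open>Left translations and the identity of the group\<close>

lemma Ck_on_componentwise:
  fixes g :: "'a::euclidean_space \<Rightarrow> 'b::euclidean_space"
  assumes "open S" "\<And>c. c \<in> Basis \<Longrightarrow> Ck_on k (\<lambda>x. g x \<bullet> c) S"
  shows "Ck_on k g S"
proof -
  have "Ck_on k (\<lambda>x. \<Sum>c\<in>C. (g x \<bullet> c) *\<^sub>R c) S" if "finite C" "C \<subseteq> Basis" for C :: "'b set"
    using that
  proof (induction C rule: finite_induct)
    case (insert c C)
    have "Ck_on k (\<lambda>x. (g x \<bullet> c) *\<^sub>R c) S"
      by (rule Ck_on_bounded_linear_comp[OF bounded_linear_scaleR_left assms(1)]) (use insert assms in auto)
    then show ?case using insert by (auto intro: Ck_on_add assms(1))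
  qed (simp add: Ck_on_const assms(1))
  from this[of Basis] show ?thesis by (simp add: euclidean_representation)
qed

text \<open>\<open>Ck_on_compose\<close> has a scalar outer function, so the group law is composed
  coordinate by coordinate with x \<mapsto> (\<alpha>, x).\<close>

lemma smooth_left_translation:
  fixes G :: "(real ^ 'n) monoid"
  assumes "lie_group_Rn G"
  shows "smooth_on UNIV (\<lambda>x. \<alpha> \<otimes>\<^bsub>G\<^esub> x)"
proof (rule smooth_onI, rule Ck_on_componentwise[OF open_UNIV])
  fix k and c :: "real ^ 'n"
  have "Ck_on k (\<lambda>z. (case z of (x, y) \<Rightarrow> x \<otimes>\<^bsub>G\<^esub> y) \<bullet> c) UNIV"
    using assms by (intro Ck_on_bounded_linear_comp[OF bounded_linear_inner_left open_UNIV])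
      (auto simp: lie_group_Rn_def dest: smooth_onD)
  moreover have "Ck_on k (\<lambda>x :: real ^ 'n. (\<alpha>, x)) UNIV"
  proof -
    have "bounded_linear (\<lambda>x :: real ^ 'n. (0 :: real ^ 'n, x))"
      by (intro bounded_linear_Pair bounded_linear_zero bounded_linear_ident)
    from Ck_on_add[OF open_UNIV Ck_on_const[OF open_UNIV, of k "(\<alpha>, 0)"] Ck_on_bounded_linear[OF this open_UNIV]]
    show ?thesis by simp
  qed
  ultimately show "Ck_on k (\<lambda>x. (\<alpha> \<otimes>\<^bsub>G\<^esub> x) \<bullet> c) UNIV"
    using Ck_on_compose[OF open_UNIV open_UNIV subset_UNIV, of k _ "\<lambda>x :: real ^ 'n. (\<alpha>, x)"] by fastforce
qed

text \<open>\<open>lebesgue_bi_invariant\<close> speaks of images, \<open>distr\<close> of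
  preimages: the preimage under translation by \<alpha> is the image under translation by the
  inverse of \<alpha>.\<close>

lemma integrable_left_translation:
  fixes G :: "(real ^ 'n) monoid" and h :: "real ^ 'n \<Rightarrow> real"
  assumes G: "lie_group_Rn G" "lebesgue_bi_invariant G" and h: "continuous_on UNIV h" "integrable lebesgue h"
  shows "integrable lebesgue (\<lambda>x. h (\<alpha> \<otimes>\<^bsub>G\<^esub> x))"
proof -
  interpret G: group G using G(1) by (simp add: lie_group_Rn_def)
  have carrier: "x \<in> carrier G" for x using G(1) by (simp add: lie_group_Rn_def)
  let ?\<tau> = "\<lambda>x. \<alpha> \<otimes>\<^bsub>G\<^esub> x" and ?\<tau>' = "\<lambda>x. inv\<^bsub>G\<^esub> \<alpha> \<otimes>\<^bsub>G\<^esub> x"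
  have \<tau>: "continuous_on UNIV ?\<tau>"
    by (rule Ck_on_continuous[OF smooth_onD[OF smooth_left_translation[OF G(1)]]])
  then have \<tau>_borel: "?\<tau> \<in> borel_measurable borel" by (rule borel_measurable_continuous_onI)
  have "distr lborel borel ?\<tau> = lborel"
  proof (rule measure_eqI)
    fix E assume "E \<in> sets (distr lborel borel ?\<tau>)"
    then have E: "E \<in> sets borel" by simp
    have "?\<tau> -` E = ?\<tau>' ` E"
    proof (intro equalityI subsetI)
      fix x assume "x \<in> ?\<tau> -` E"
      moreover have "x = ?\<tau>' (?\<tau> x)" using carrier by (simp add: G.m_assoc[symmetric])
      ultimately show "x \<in> ?\<tau>' ` E" by blast
    next
      fix x assume "x \<in> ?\<tau>' ` E"
      then show "x \<in> ?\<tau> -` E" using carrier by (auto simp: G.m_assoc[symmetric])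
    qed
    moreover have "emeasure lebesgue (?\<tau>' ` E) = emeasure lebesgue E"
      using G(2) E by (auto simp: lebesgue_bi_invariant_def)
    moreover have "?\<tau> -` E \<in> sets borel" using measurable_sets[OF \<tau>_borel E] by simp
    ultimately show "emeasure (distr lborel borel ?\<tau>) E = emeasure lborel E"
      using E \<tau>_borel by (simp add: emeasure_distr)
  qed simp
  moreover have "integrable lborel h"
    using h integrable_completion[of h lborel] borel_measurable_continuous_onI[OF h(1)] by simp
  ultimately have "integrable lborel (\<lambda>x. h (?\<tau> x))"
    using integrable_distr_eq[of ?\<tau> lborel borel h] \<tau>_borel borel_measurable_continuous_onI[OF h(1)] by simp
  moreover have "(\<lambda>x. h (?\<tau> x)) \<in> borel_measurable lborel"
    using borel_measurable_continuous_onI[OF continuous_on_compose2[OF h(1) \<tau>]] by simp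
  ultimately show ?thesis by (simp add: integrable_completion)
qed

text \<open>An automorphism fixes the identity, and \<open>dilation \<sigma> 2\<close> fixes only 0.
  So translations can bring any point to the centre of the dilations.\<close>

lemma homogeneous_group_one:
  assumes "homogeneous_group G \<sigma>"
  shows "\<one>\<^bsub>G\<^esub> = 0"
proof -
  have G: "group G" and "dilation \<sigma> 2 \<in> hom G G"
    using assms by (auto simp: homogeneous_group_def lie_group_Rn_def iso_def)
  then have "dilation \<sigma> 2 \<one>\<^bsub>G\<^esub> = \<one>\<^bsub>G\<^esub>" by (intro hom_one)
  then have "2 powr \<sigma> i * \<one>\<^bsub>G\<^esub> $ i = \<one>\<^bsub>G\<^esub> $ i" for i by (metis dilation_nth)
  moreover have "2 powr \<sigma> i \<noteq> 1" for i
  proof -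
    have "1 \<le> \<sigma> i" using assms by (simp add: homogeneous_group_def)
    then show ?thesis by (simp add: powr_eq_one_iff_gen)
  qed
  ultimately show ?thesis by (simp add: vec_eq_iff)
qed

section \<open>Smooth solutions in L^p vanish\<close>

context homogeneous_operator
begin

text \<open>Dilation by R multiplies the L^p norm by R^(-Q/p). With \<open>s\<close> equal to this
  factor both terms of \<open>le_plus_powr\<close> carry it exactly once.\<close>

lemma Lp_dilate_pairing_bound:
  assumes f: "continuous_on UNIV f" "integrable lebesgue (\<lambda>x. \<bar>f x\<bar> powr p)" and p: "1 \<le> p"
    and K: "compact K" and \<phi>: "\<phi> \<in> test_functions K" "\<And>x. \<bar>\<phi> x\<bar> \<le> B" and R: "0 < R"
  shows "\<bar>LINT x|lebesgue. f (\<delta> R x) * \<phi> x\<bar>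
    \<le> R powr (- Q / p) * (measure lebesgue K + (LINT x|lebesgue. \<bar>f x\<bar> powr p)) * B"
proof -
  define s where "s = R powr (- Q / p)"
  have s: "s > 0" using R by (simp add: s_def)
  have B: "0 \<le> B" using \<phi>(2)[of 0] by linarith
  let ?J = "LINT x|lebesgue. \<bar>f x\<bar> powr p"
  let ?h = "\<lambda>x. B * (s * indicator K x + s powr (1 - p) * \<bar>f (\<delta> R x)\<bar> powr p)"
  have pt: "\<bar>f (\<delta> R x) * \<phi> x\<bar> \<le> ?h x" for x
  proof (cases "x \<in> K")
    case True
    have "\<bar>f (\<delta> R x) * \<phi> x\<bar> \<le> \<bar>f (\<delta> R x)\<bar> * B"
      unfolding abs_mult by (intro mult_left_mono \<phi>(2)) auto
    also have "\<dots> \<le> (s + s powr (1 - p) * \<bar>f (\<delta> R x)\<bar> powr p) * B"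
      by (intro mult_right_mono le_plus_powr s p B) auto
    finally show ?thesis using True by (simp add: mult.commute)
  next
    case False
    then have "\<phi> x = 0" using test_functionsE[OF \<phi>(1)] by (metis subsetD)
    then show ?thesis using B s by simp
  qed
  have m: "(\<lambda>x. \<bar>f x\<bar> powr p) \<in> borel_measurable lebesgue"
    using f(2) by (rule borel_measurable_integrable)
  have iK: "integrable lebesgue (indicat_real K)"
    using lmeasurable_compact[OF K] by (auto simp: fmeasurable_def)
  have iF: "integrable lebesgue (\<lambda>x. \<bar>f (\<delta> R x)\<bar> powr p)"
    using lebesgue_integral_dilation(2)[OF R m, of \<sigma>] f(2) by simp
  have ih: "integrable lebesgue ?h" using iK iF by auto
  have "\<bar>LINT x|lebesgue. f (\<delta> R x) * \<phi> x\<bar> \<le> (LINT x|lebesgue. \<bar>f (\<delta> R x) * \<phi> x\<bar>)"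
    by (rule integral_abs_bound)
  also have "\<dots> \<le> (LINT x|lebesgue. ?h x)"
    by (rule integral_mono_AE'[OF ih]) (intro AE_I2 pt, intro AE_I2 order_trans[OF abs_ge_zero pt])
  also have "\<dots> = B * (s * measure lebesgue K + s powr (1 - p) * (R powr (- Q) * ?J))"
    using iK iF lmeasurable_compact[OF K] lebesgue_integral_dilation(1)[OF R m, of \<sigma>]
    by (simp add: fmeasurableD)
  also have "s powr (1 - p) * (R powr (- Q) * ?J) = s * ?J"
  proof -
    have "s powr (1 - p) * R powr (- Q) = R powr (- Q / p * (1 - p) + - Q)"
      using R by (simp add: s_def powr_powr powr_add[symmetric])
    also have "- Q / p * (1 - p) + - Q = - Q / p" using p by (simp add: field_simps)
    finally show ?thesis by (simp add: s_def mult.assoc[symmetric])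
  qed
  finally show ?thesis by (simp add: s_def algebra_simps)
qed

text \<open>The sum of the dilates \<open>f \<circ> \<delta>\<^bsub>2^k\<^esub>\<close>, \<open>k \<ge> 0\<close>, converges as a distribution \<open>T\<close> annihilated by \<open>L\<close>, so \<open>T\<close>
  is a continuous function \<open>g\<close>. Average over \<open>\<delta>\<^bsub>2^-m\<^esub>\<close>-shrunk cutoffs: the averages converge to a
  multiple of \<open>g 0\<close>, while two consecutive ones differ by an average of the dilate of \<open>f\<close> by \<open>2^-(m+1)\<close>.\<close>

lemma Lp_solution_at_0:
  assumes hypo: "hypoelliptic A b" and f: "smooth_on UNIV f" "\<And>x. op_L A b f x = 0"
    and fp: "integrable lebesgue (\<lambda>x. \<bar>f x\<bar> powr p)" and p: "1 \<le> p"
  shows "f 0 = 0"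
proof -
  define F where "F k \<phi> = (LINT x|lebesgue. f (\<delta> (2 ^ k) x) * \<phi> x)" for k :: nat and \<phi>
  define T where "T \<phi> = (\<Sum>k. F k \<phi>)" for \<phi>
  \<comment> \<open>Ratio of the geometric series that dominates the pairings with the dilates by
    2^k.\<close>
  define \<theta> where "\<theta> = 2 powr (- (Q / p))"
  have \<theta>: "0 < \<theta>" "\<theta> < 1" using Q_pos p by (auto simp: \<theta>_def powr_less_one)
  have fc: "continuous_on UNIV f" by (rule Ck_on_continuous[OF smooth_onD[OF f(1)]])
  have f\<delta>: "continuous_on UNIV (\<lambda>x. f (\<delta> r x))" for r
    by (rule continuous_on_compose2[OF fc]) (auto intro: continuous_intros)
  have \<theta>k: "(2 ^ k) powr (- (Q / p)) = \<theta> ^ k" for k :: nat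
    by (simp add: \<theta>_def powr_realpow[symmetric] powr_powr mult.commute)
  let ?J = "LINT x|lebesgue. \<bar>f x\<bar> powr p"
  have bound: "\<bar>F k \<phi>\<bar> \<le> \<theta> ^ k * ((measure lebesgue K + ?J) * B)"
    if "compact K" "\<phi> \<in> test_functions K" "\<And>x. \<bar>\<phi> x\<bar> \<le> B" for k \<phi> K B
    using Lp_dilate_pairing_bound[OF fc fp p that, of "2 ^ k"] by (simp add: F_def \<theta>k mult.assoc)
  have geo: "summable (\<lambda>k. \<theta> ^ k * c)" "(\<Sum>k. \<theta> ^ k * c) = c / (1 - \<theta>)" for c
    using \<theta> by (auto simp: summable_geometric suminf_mult2[symmetric] suminf_geometric summable_mult2)
  have summable: "summable (\<lambda>k. \<bar>F k \<phi>\<bar>)" if \<phi>: "\<phi> \<in> test_functions UNIV" for \<phi>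
  proof -
    obtain K where K: "compact K" "\<And>x. x \<notin> K \<Longrightarrow> \<phi> x = 0" using test_functionsE[OF \<phi>] by metis
    obtain B where B: "\<And>x. \<bar>\<phi> x\<bar> \<le> B" using test_functions_bounded[OF \<phi>] by metis
    have "\<phi> \<in> test_functions K"
      by (rule test_functionsI[OF test_functions_smooth[OF \<phi>] K(1) order_refl K(2)])
    from bound[OF K(1) this B] show ?thesis
      by (intro summable_comparison_test[OF _ geo(1)]) auto
  qed
  have summable': "summable (\<lambda>k. F k \<phi>)" if "\<phi> \<in> test_functions UNIV" for \<phi>
    by (rule summable_rabs_cancel[OF summable[OF that]])
  have "distribution_on UNIV T"
  proof (rule distribution_onI)
    show "T (\<lambda>x. \<phi> x + \<psi> x) = T \<phi> + T \<psi>" if "\<phi> \<in> test_functions UNIV" "\<psi> \<in> test_functions UNIV" for \<phi> \<psi>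
    proof -
      have "F k (\<lambda>x. \<phi> x + \<psi> x) = F k \<phi> + F k \<psi>" for k
        unfolding F_def distrib_left
        by (intro Bochner_Integration.integral_add
            L1_loc_times_test_integrable[OF L1_locD[OF continuous_L1_loc[OF f\<delta>]]])
          (assumption, rule that, assumption, rule that)
      then show ?thesis using suminf_add[OF summable'[OF that(1)] summable'[OF that(2)]] by (simp add: T_def)
    qed
    show "T (\<lambda>x. c * \<phi> x) = c * T \<phi>" if "\<phi> \<in> test_functions UNIV" for \<phi> c
    proof -
      have "F k (\<lambda>x. c * \<phi> x) = c * F k \<phi>" for k by (simp add: F_def mult.left_commute)
      then show ?thesis using suminf_mult[OF summable'[OF that]] by (simp add: T_def)
    qed
    fix K :: "(real ^ 'n) set" assume K: "compact K"
    have "\<bar>T \<phi>\<bar> \<le> (measure lebesgue K + ?J) / (1 - \<theta>) * B"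
      if \<phi>: "\<phi> \<in> test_functions K" "\<forall>x. \<bar>\<phi> x\<bar> \<le> B" for \<phi> B
    proof -
      have \<phi>': "\<phi> \<in> test_functions UNIV" using \<phi>(1) by (rule test_functions_mono) simp
      have "\<bar>T \<phi>\<bar> \<le> (\<Sum>k. \<bar>F k \<phi>\<bar>)"
        unfolding T_def by (rule summable_rabs[OF summable[OF \<phi>']])
      also have "\<dots> \<le> (\<Sum>k. \<theta> ^ k * ((measure lebesgue K + ?J) * B))"
        using bound[OF K \<phi>(1)] \<phi>(2) by (intro suminf_le summable[OF \<phi>'] geo(1)) auto
      finally show ?thesis by (simp add: geo(2))
    qed
    then show "\<exists>C. \<forall>\<phi>\<in>test_functions K. \<forall>B. (\<forall>x. \<bar>\<phi> x\<bar> \<le> B) \<longrightarrow> \<bar>T \<phi>\<bar> \<le> C * B" by blast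
  qed
  moreover have "T (L_adj \<phi>) = 0" if \<phi>: "\<phi> \<in> test_functions UNIV" for \<phi>
  proof -
    obtain K where K: "compact K" "\<And>x. x \<notin> K \<Longrightarrow> \<phi> x = 0" using test_functionsE[OF \<phi>] by metis
    have "F k (L_adj \<phi>) = (LINT x|lebesgue. \<phi> x * op_L A b (\<lambda>x. f (\<delta> (2 ^ k) x)) x)" for k
      unfolding F_def
      by (rule integration_by_parts(1)[OF divergence_b open_UNIV smooth_onD[OF smooth_on_dilation[OF f(1)]]
          test_functions_Ck[OF \<phi>] K(1) subset_UNIV K(2)])
    then have "F k (L_adj \<phi>) = 0" for k by (simp add: op_L_dilation[OF f(1)] f(2))
    then show ?thesis by (simp add: T_def)
  qed
  then have "distribution_smooth_rep UNIV (\<lambda>\<phi>. T (op_L_adj A b \<phi>))"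
    unfolding distribution_smooth_rep_def
    by (intro exI[of _ "\<lambda>_. 0"]) (auto simp: op_L_adj_test intro: smooth_on_const)
  ultimately have "distribution_smooth_rep UNIV T" using hypo by (auto simp: hypoelliptic_def)
  then obtain g where g: "smooth_on UNIV g"
    and rep: "\<And>\<phi>. \<phi> \<in> test_functions UNIV \<Longrightarrow> T \<phi> = (LINT x|lebesgue. g x * \<phi> x)"
    unfolding distribution_smooth_rep_def set_lebesgue_integral_def by auto
  have gc: "continuous_on UNIV g" by (rule Ck_on_continuous[OF smooth_onD[OF g]])
  \<comment> \<open>Averages over a shrunken cutoff, rescaled to the fixed \<open>cutoff\<close>.
    The Jacobian 2^(-mQ) from \<open>scale\<close> is common to all terms of the series and to its
    sum, and drops out in \<open>S\<close>.\<close>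
  define I where "I h r = (LINT x|lebesgue. h (\<delta> r x) * cutoff x)" for h and r :: real
  have scale: "(LINT x|lebesgue. h (\<delta> r x) * cutoff (\<delta> (2 ^ m) x)) = (2 ^ m) powr (- Q) * I h (r / 2 ^ m)"
    if h: "continuous_on UNIV h" and r: "0 < r" for h r and m :: nat
  proof -
    have c: "continuous_on UNIV (\<lambda>x. h (\<delta> (r / 2 ^ m) x) * cutoff x)"
      by (intro continuous_intros test_functions_continuous[OF cutoff_test] continuous_on_compose2[OF h]) auto
    show ?thesis
      using lebesgue_integral_dilation(1)[OF _ borel_measurable_lebesgue_continuous[OF c], of "2 ^ m" \<sigma>] r
      by (simp add: I_def dilation_dilation)
  qed
  define S where "S m = I g (inverse (2 ^ m))" for m :: nat
  have S: "(\<lambda>k. I f (2 ^ k / 2 ^ m)) sums S m" for m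
  proof -
    have t: "(\<lambda>x :: real ^ 'n. cutoff (\<delta> (2 ^ m) x)) \<in> test_functions UNIV" by (rule scaled_cutoff_test) simp
    have "(\<lambda>k. F k (\<lambda>x. cutoff (\<delta> (2 ^ m) x))) sums T (\<lambda>x. cutoff (\<delta> (2 ^ m) x))"
      unfolding T_def by (rule summable_sums[OF summable'[OF t]])
    moreover have "F k (\<lambda>x. cutoff (\<delta> (2 ^ m) x)) = (2 ^ m) powr (- Q) * I f (2 ^ k / 2 ^ m)" for k
      unfolding F_def by (rule scale[OF fc]) simp
    moreover have "T (\<lambda>x. cutoff (\<delta> (2 ^ m) x)) = (2 ^ m) powr (- Q) * S m"
      using scale[OF gc, of 1 m] by (simp add: rep[OF t] S_def divide_inverse)
    ultimately show ?thesis by (simp add: sums_mult_iff)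
  qed
  \<comment> \<open>The dilations 2^(k-m-1) in the series for \<open>Suc m\<close> are those of the
    series for \<open>m\<close> preceded by one new term, that of k = 0.\<close>
  have step: "S (Suc m) - S m = I f (inverse (2 ^ Suc m))" for m
  proof -
    have "(\<lambda>k. I f (2 ^ Suc k / 2 ^ Suc m)) sums (S (Suc m) - I f (2 ^ 0 / 2 ^ Suc m))"
      using S[of "Suc m"] by (subst sums_Suc_iff) simp
    moreover have "(2 :: real) ^ Suc k / 2 ^ Suc m = 2 ^ k / 2 ^ m" for k by simp
    moreover have "(2 :: real) ^ 0 / 2 ^ Suc m = inverse (2 ^ Suc m)" by (simp add: inverse_eq_divide)
    ultimately have "(\<lambda>k. I f (2 ^ k / 2 ^ m)) sums (S (Suc m) - I f (inverse (2 ^ Suc m)))"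
      by (simp only:)
    from sums_unique2[OF this S[of m]] show ?thesis by simp
  qed
  have "S \<longlonglongrightarrow> g 0 * (LINT x|lebesgue. cutoff (x :: real ^ 'n))"
    unfolding S_def I_def by (rule cutoff_average_tendsto[OF gc])
  then have "(\<lambda>m. S (Suc m) - S m) \<longlonglongrightarrow> g 0 * (LINT x|lebesgue. cutoff (x :: real ^ 'n)) - g 0 * (LINT x|lebesgue. cutoff (x :: real ^ 'n))"
    by (intro tendsto_diff LIMSEQ_Suc)
  moreover have "(\<lambda>m. I f (inverse (2 ^ Suc m))) \<longlonglongrightarrow> f 0 * (LINT x|lebesgue. cutoff (x :: real ^ 'n))"
    using LIMSEQ_Suc[OF cutoff_average_tendsto[OF fc]] unfolding I_def .
  ultimately have "f 0 * (LINT x|lebesgue. cutoff (x :: real ^ 'n)) = 0"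
    using LIMSEQ_unique by (fastforce simp only: step diff_self)
  then show ?thesis using integral_cutoff_pos by simp
qed

theorem Lp_weak_subsolution_zero:
  assumes G: "lie_group_Rn G" "lebesgue_bi_invariant G" "left_translation_invariant G A b" "\<one>\<^bsub>G\<^esub> = 0"
    and hypo: "hypoelliptic A b"
    and u: "weak_L_nonneg A b u" "in_Lp p u" and p: "1 \<le> p" "p \<le> 1 + 2 / (Q - 2)" and Q: "2 < Q"
  shows "AE x in lebesgue. u x = 0"
proof -
  have "L1_loc u" using u(1) by (simp add: weak_L_nonneg_def)
  then obtain f where f: "smooth_on UNIV f" "\<And>x. op_L A b f x = 0" and ae: "AE x in lebesgue. u x = f x"
    using weak_solution_smooth[OF hypo _ weak_subsolution_imp_solution[OF u p Q]] by metis
  have fc: "continuous_on UNIV f" by (rule Ck_on_continuous[OF smooth_onD[OF f(1)]])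
  have "f \<alpha> = 0" for \<alpha>
  proof -
    have i: "integrable lebesgue (\<lambda>x. \<bar>f x\<bar> powr p)"
      by (rule integrable_powr_cong_AE[OF ae borel_measurable_lebesgue_continuous[OF fc] u(2)])
    have "f (\<alpha> \<otimes>\<^bsub>G\<^esub> 0) = 0"
    proof (rule Lp_solution_at_0[OF hypo _ _ _ p(1)])
      show "smooth_on UNIV (\<lambda>x. f (\<alpha> \<otimes>\<^bsub>G\<^esub> x))"
        by (rule smooth_on_compose_UNIV[OF f(1) smooth_left_translation[OF G(1)]])
      show "op_L A b (\<lambda>x. f (\<alpha> \<otimes>\<^bsub>G\<^esub> x)) x = 0" for x
        using G(3) f by (simp add: left_translation_invariant_def)
      show "integrable lebesgue (\<lambda>x. \<bar>f (\<alpha> \<otimes>\<^bsub>G\<^esub> x)\<bar> powr p)"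
      proof (rule integrable_left_translation[OF G(1,2) _ i])
        show "continuous_on UNIV (\<lambda>x. \<bar>f x\<bar> powr p)"
          by (rule continuous_on_powr') (use p(1) fc in \<open>auto intro: continuous_intros\<close>)
      qed
    qed
    moreover have "\<alpha> \<otimes>\<^bsub>G\<^esub> 0 = \<alpha>"
      using G(1,4) group.is_monoid[of G] monoid.r_one[of G \<alpha>] by (simp add: lie_group_Rn_def)
    ultimately show ?thesis by simp
  qed
  with ae show ?thesis by simp
qed

end

section \<open>Linear functionals below a sublinear functional\<close>

locale function_subspace =
  fixes V :: "('a \<Rightarrow> real) set"
  assumes add: "f \<in> V \<Longrightarrow> g \<in> V \<Longrightarrow> (\<lambda>x. f x + g x) \<in> V"
    and cmult: "f \<in> V \<Longrightarrow> (\<lambda>x. c * f x) \<in> V"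
begin

definition sublinear :: "(('a \<Rightarrow> real) \<Rightarrow> real) \<Rightarrow> bool" where
  "sublinear q \<longleftrightarrow> (\<forall>f\<in>V. \<forall>g\<in>V. q (\<lambda>x. f x + g x) \<le> q f + q g) \<and>
     (\<forall>f\<in>V. \<forall>c\<ge>0. q (\<lambda>x. c * f x) = c * q f)"

text \<open>One inequality for positive \<open>c\<close> is enough: applied with
  \<open>inverse c\<close> it gives the opposite one.\<close>

lemma sublinearI:
  assumes "\<And>f g. f \<in> V \<Longrightarrow> g \<in> V \<Longrightarrow> q (\<lambda>x. f x + g x) \<le> q f + q g"
    and "\<And>f c. f \<in> V \<Longrightarrow> 0 < c \<Longrightarrow> q (\<lambda>x. c * f x) \<le> c * q f"
    and "q (\<lambda>x. 0) = 0"
  shows "sublinear q"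
  unfolding sublinear_def
proof (intro conjI ballI allI impI)
  fix f and c :: real assume f: "f \<in> V" and "0 \<le> c"
  show "q (\<lambda>x. c * f x) = c * q f"
  proof (cases "c = 0")
    case False
    then have c: "c > 0" using \<open>0 \<le> c\<close> by simp
    have "q (\<lambda>x. inverse c * (c * f x)) \<le> inverse c * q (\<lambda>x. c * f x)"
      using assms(2)[OF cmult[OF f, of c], of "inverse c"] c by simp
    moreover have "(\<lambda>x. inverse c * (c * f x)) = f" using c by (simp add: fun_eq_iff)
    ultimately have "c * q f \<le> q (\<lambda>x. c * f x)" using c by (simp add: field_simps)
    with assms(2)[OF f c] show ?thesis by simp
  qed (simp add: assms(3))
qed (rule assms(1))

lemma sublinear_add: "sublinear q \<Longrightarrow> f \<in> V \<Longrightarrow> g \<in> V \<Longrightarrow> q (\<lambda>x. f x + g x) \<le> q f + q g"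
  by (simp add: sublinear_def)

lemma sublinear_cmult: "sublinear q \<Longrightarrow> f \<in> V \<Longrightarrow> 0 \<le> c \<Longrightarrow> q (\<lambda>x. c * f x) = c * q f"
  by (simp add: sublinear_def)

lemma sublinear_lower:
  assumes "sublinear q" "f \<in> V"
  shows "- q (\<lambda>x. - f x) \<le> q f"
proof -
  have "(\<lambda>x. - f x) \<in> V" using cmult[OF assms(2), of "-1"] by simp
  from sublinear_add[OF assms this] sublinear_cmult[OF assms, of 0] show ?thesis by simp
qed

text \<open>A minimal sublinear functional \<open>q\<close> is additive, because \<open>f \<mapsto> inf\<^bsub>t \<ge> 0\<^esub> (q (f + t g) - t q g)\<close>
  is sublinear and below \<open>q\<close>.\<close>

theorem exists_linear_below:
  assumes P: "sublinear P"
  obtains T where "\<And>f g. f \<in> V \<Longrightarrow> g \<in> V \<Longrightarrow> T (\<lambda>x. f x + g x) = T f + T g"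
    and "\<And>f c. f \<in> V \<Longrightarrow> T (\<lambda>x. c * f x) = c * T f"
    and "\<And>f. f \<in> V \<Longrightarrow> T f \<le> P f"
proof (cases "V = {}")
  case True
  then show thesis using that by blast
next
  case False
  \<comment> \<open>Fixing the value 0 off \<open>V\<close> makes the pointwise order of functionals
    the order on \<open>V\<close>, so that minimality yields an equation between functions.\<close>
  define X where "X = {q. sublinear q \<and> (\<forall>f\<in>V. q f \<le> P f) \<and> (\<forall>f. f \<notin> V \<longrightarrow> q f = 0)}"
  let ?r = "relation_of (\<lambda>q q'. q' \<le> q) X"
  have zero: "(\<lambda>x. 0) \<in> V" using False cmult[of _ 0] by fastforce
  have neg: "(\<lambda>x. - f x) \<in> V" if "f \<in> V" for f using cmult[OF that, of "-1"] by simp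
  have lower: "- P (\<lambda>x. - f x) \<le> q f" if "q \<in> X" "f \<in> V" for q f
    using sublinear_lower[of q f] that neg[OF that(2)] by (fastforce simp: X_def)
  have "\<exists>m\<in>X. \<forall>q\<in>X. q \<le> m \<longrightarrow> q = m"
  proof (rule predicate_Zorn)
    show "partial_order_on X ?r" by (rule partial_order_on_relation_ofI) auto
    fix C assume C: "C \<in> Chains ?r"
    have CX: "C \<subseteq> X" using C by (auto simp: Chains_def relation_of_def)
    have chain: "q \<le> q' \<or> q' \<le> q" if "q \<in> C" "q' \<in> C" for q q'
      using C that by (auto simp: Chains_def relation_of_def)
    show "\<exists>u\<in>X. \<forall>q\<in>C. u \<le> q"
    proof (cases "C = {}")
      case True
      have "(\<lambda>f. if f \<in> V then P f else 0) \<in> X"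
        using P add cmult by (auto simp: X_def sublinear_def)
      then show ?thesis using True by blast
    next
      case False
      define u where "u f = (if f \<in> V then INF q\<in>C. q f else 0)" for f
      have bdd: "bdd_below ((\<lambda>q. q f) ` C)" if "f \<in> V" for f
        using lower[OF _ that] CX by (intro bdd_belowI2[of _ "- P (\<lambda>x. - f x)"]) auto
      have le: "u f \<le> q f" if "q \<in> C" for q f
      proof (cases "f \<in> V")
        case True
        then show ?thesis using cINF_lower[OF bdd[OF True] that] by (simp add: u_def)
      next
        case f: False
        then show ?thesis using CX that by (auto simp: u_def X_def)
      qed
      have greatest: "c \<le> u f" if "f \<in> V" "\<And>q. q \<in> C \<Longrightarrow> c \<le> q f" for c f
        using cINF_greatest[OF False, of c "\<lambda>q. q f"] that by (simp add: u_def)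
      have "sublinear u"
      proof (rule sublinearI)
        fix f g assume f: "f \<in> V" and g: "g \<in> V"
        \<comment> \<open>Two members of a chain both lie above the smaller of them, whose
          subadditivity then serves for both.\<close>
        have *: "u (\<lambda>x. f x + g x) \<le> q f + q' g" if q: "q \<in> C" "q' \<in> C" for q q'
        proof -
          obtain q'' where q'': "q'' \<in> C" "q'' \<le> q" "q'' \<le> q'" using chain[OF q] q by blast
          have "u (\<lambda>x. f x + g x) \<le> q'' (\<lambda>x. f x + g x)" by (rule le[OF q''(1)])
          also have "\<dots> \<le> q'' f + q'' g" using CX q''(1) f g by (auto simp: X_def intro: sublinear_add)
          also have "\<dots> \<le> q f + q' g" using q''(2,3) by (intro add_mono) (auto simp: le_fun_def)
          finally show ?thesis .
        qed
        have "u (\<lambda>x. f x + g x) - q' g \<le> u f" if "q' \<in> C" for q'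
          by (rule greatest[OF f]) (use *[OF _ that] in \<open>force simp: algebra_simps\<close>)
        then have "u (\<lambda>x. f x + g x) - u f \<le> u g"
          by (intro greatest[OF g]) (force simp: algebra_simps)
        then show "u (\<lambda>x. f x + g x) \<le> u f + u g" by simp
      next
        fix f and c :: real assume f: "f \<in> V" and c: "0 < c"
        have "u (\<lambda>x. c * f x) / c \<le> q f" if "q \<in> C" for q
        proof -
          have "u (\<lambda>x. c * f x) \<le> q (\<lambda>x. c * f x)" by (rule le[OF that])
          also have "\<dots> = c * q f" using CX that f c by (intro sublinear_cmult) (auto simp: X_def)
          finally show ?thesis using c by (simp add: field_simps)
        qed
        then have "u (\<lambda>x. c * f x) / c \<le> u f" by (rule greatest[OF f])
        then show "u (\<lambda>x. c * f x) \<le> c * u f" using c by (simp add: field_simps)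
      next
        have q0: "q (\<lambda>x. 0) = 0" if "q \<in> C" for q
          using sublinear_cmult[of q "\<lambda>x. 0" 0] zero CX that by (auto simp: X_def)
        show "u (\<lambda>x. 0) = 0"
        proof (rule antisym)
          show "u (\<lambda>x. 0) \<le> 0" using le[of _ "\<lambda>x. 0"] q0 False by fastforce
          show "0 \<le> u (\<lambda>x. 0)" by (rule greatest[OF zero]) (simp add: q0)
        qed
      qed
      moreover have "u f \<le> P f" if f: "f \<in> V" for f
      proof -
        obtain q where q: "q \<in> C" using False by blast
        have "u f \<le> q f" by (rule le[OF q])
        also have "q f \<le> P f" using q CX f by (auto simp: X_def)
        finally show ?thesis .
      qed
      ultimately have "u \<in> X" by (auto simp: X_def u_def)
      then show ?thesis using le by (auto simp: le_fun_def)
    qed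
  qed
  then obtain q where q: "q \<in> X" and min: "\<And>q'. q' \<in> X \<Longrightarrow> q' \<le> q \<Longrightarrow> q' = q" by blast
  have sub: "sublinear q" using q by (simp add: X_def)
  have additive: "q (\<lambda>x. f x + g x) = q f + q g" if f: "f \<in> V" and g: "g \<in> V" for f g
  proof -
    let ?F = "\<lambda>f t x. f x + t * g x"
    have FV: "?F f t \<in> V" if "f \<in> V" for f t by (rule add[OF that cmult[OF g]])
    define w where "w f = (if f \<in> V then INF t\<in>{0..}. q (?F f t) - t * q g else 0)" for f
    \<comment> \<open>Shows that the infimum defining \<open>w\<close> is finite, by subadditivity
      for t g = (f + t g) - f.\<close>
    have lb: "- q (\<lambda>x. - f x) \<le> q (?F f t) - t * q g" if f: "f \<in> V" and t: "0 \<le> t" for f t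
    proof -
      have "t * q g = q (\<lambda>x. t * g x)" using sublinear_cmult[OF sub g t] by simp
      also have "\<dots> = q (\<lambda>x. ?F f t x + - f x)" by simp
      also have "\<dots> \<le> q (?F f t) + q (\<lambda>x. - f x)" by (rule sublinear_add[OF sub FV[OF f] neg[OF f]])
      finally show ?thesis by simp
    qed
    have bdd: "bdd_below ((\<lambda>t. q (?F f t) - t * q g) ` {0..})" if "f \<in> V" for f
      using lb[OF that] by (intro bdd_belowI2[of _ "- q (\<lambda>x. - f x)"]) auto
    have le: "w f \<le> q (?F f t) - t * q g" if "f \<in> V" "0 \<le> t" for f t
      using cINF_lower[OF bdd[OF that(1)], of t] that by (simp add: w_def)
    have greatest: "c \<le> w f" if "f \<in> V" "\<And>t. 0 \<le> t \<Longrightarrow> c \<le> q (?F f t) - t * q g" for c f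
      using cINF_greatest[of "{0..}" c "\<lambda>t. q (?F f t) - t * q g"] that by (simp add: w_def)
    have wq: "w f \<le> q f" if "f \<in> V" for f using le[OF that, of 0] by simp
    have "sublinear w"
    proof (rule sublinearI)
      fix f h assume f: "f \<in> V" and h: "h \<in> V"
      have *: "w (\<lambda>x. f x + h x) \<le> (q (?F f s) - s * q g) + (q (?F h t) - t * q g)" if "0 \<le> s" "0 \<le> t" for s t
      proof -
        have "w (\<lambda>x. f x + h x) \<le> q (?F (\<lambda>x. f x + h x) (s + t)) - (s + t) * q g"
          by (rule le[OF add[OF f h]]) (use that in simp)
        also have "?F (\<lambda>x. f x + h x) (s + t) = (\<lambda>x. ?F f s x + ?F h t x)" by (simp add: fun_eq_iff algebra_simps)
        also have "q \<dots> \<le> q (?F f s) + q (?F h t)" by (rule sublinear_add[OF sub FV[OF f] FV[OF h]])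
        finally show ?thesis by (simp add: algebra_simps)
      qed
      have "w (\<lambda>x. f x + h x) - (q (?F h t) - t * q g) \<le> w f" if "0 \<le> t" for t
        by (rule greatest[OF f]) (use *[OF _ that] in \<open>force simp: algebra_simps\<close>)
      then have "w (\<lambda>x. f x + h x) - w f \<le> w h"
        by (intro greatest[OF h]) (force simp: algebra_simps)
      then show "w (\<lambda>x. f x + h x) \<le> w f + w h" by simp
    next
      fix f and c :: real assume f: "f \<in> V" and c: "0 < c"
      have "w (\<lambda>x. c * f x) / c \<le> q (?F f t) - t * q g" if t: "0 \<le> t" for t
      proof -
        have "w (\<lambda>x. c * f x) \<le> q (?F (\<lambda>x. c * f x) (c * t)) - (c * t) * q g"
          by (rule le[OF cmult[OF f]]) (use t c in simp)
        also have "?F (\<lambda>x. c * f x) (c * t) = (\<lambda>x. c * ?F f t x)" by (simp add: fun_eq_iff algebra_simps)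
        also have "q \<dots> = c * q (?F f t)" using c by (intro sublinear_cmult[OF sub FV[OF f]]) simp
        finally show ?thesis using c by (simp add: field_simps)
      qed
      then have "w (\<lambda>x. c * f x) / c \<le> w f" by (rule greatest[OF f])
      then show "w (\<lambda>x. c * f x) \<le> c * w f" using c by (simp add: field_simps)
    next
      have q0: "q (\<lambda>x. 0) = 0" using sublinear_cmult[OF sub zero, of 0] by simp
      show "w (\<lambda>x. 0) = 0"
      proof (rule antisym)
        show "w (\<lambda>x. 0) \<le> 0" using wq[OF zero] q0 by simp
        show "0 \<le> w (\<lambda>x. 0)"
          by (rule greatest[OF zero]) (simp add: sublinear_cmult[OF sub g])
      qed
    qed
    moreover have "w f \<le> P f" if "f \<in> V" for f
      using wq[OF that] q that by (fastforce simp: X_def)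
    ultimately have "w \<in> X" by (auto simp: X_def w_def)
    moreover have "w \<le> q" using wq q by (auto simp: le_fun_def w_def X_def)
    ultimately have "w = q" by (rule min)
    \<comment> \<open>With \<open>w\<close> = \<open>q\<close>, the value t = 1 in the infimum is
      the reverse of subadditivity.\<close>
    then have "q f + q g \<le> q (\<lambda>x. f x + g x)" using le[OF f, of 1] by simp
    with sublinear_add[OF sub f g] show ?thesis by simp
  qed
  have minus: "q (\<lambda>x. - f x) = - q f" if "f \<in> V" for f
    using additive[OF that neg[OF that]] sublinear_cmult[OF sub that, of 0] by simp
  have "q (\<lambda>x. c * f x) = c * q f" if f: "f \<in> V" for f c
  proof (cases "0 \<le> c")
    case False
    then have "q (\<lambda>x. - (- c * f x)) = - (- c * q f)"
      using minus[OF cmult[OF f, of "- c"]] sublinear_cmult[OF sub f, of "- c"] by simp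
    then show ?thesis by simp
  qed (rule sublinear_cmult[OF sub f])
  with additive q show thesis by (intro that[of q]) (auto simp: X_def)
qed

end

section \<open>Dyadic periodization and a maximum principle\<close>

abbreviation dyad :: "int \<Rightarrow> real" where "dyad k \<equiv> 2 powr real_of_int k"

lemma dyad_add: "dyad (k + j) = dyad k * dyad j"
  by (simp add: powr_add)

lemma dyad_le_iff: "dyad k \<le> dyad j \<longleftrightarrow> k \<le> j"
  by simp

lemma dyad_less_iff: "dyad k < dyad j \<longleftrightarrow> k < j"
  by simp

lemma exists_dyad_bracket:
  assumes "0 < (t :: real)"
  obtains j where "dyad j \<le> t" "t < dyad (j + 1)"
proof
  have t: "t = 2 powr (log 2 t)" using assms by simp
  show "dyad \<lfloor>log 2 t\<rfloor> \<le> t" by (subst (2) t) (intro powr_mono, auto)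
  show "t < dyad (\<lfloor>log 2 t\<rfloor> + 1)" by (subst (1) t) (intro powr_less_mono, auto)
qed

lemma sets_lebesgue_open: "open (U :: 'a::euclidean_space set) \<Longrightarrow> U \<in> sets lebesgue"
  by (simp add: lmeasurable_open sets_completionI_sets)

section \<open>Sums over dilations by powers of 2\<close>

context homogeneous_operator
begin

definition dyadic_support :: "nat \<Rightarrow> (real ^ 'n \<Rightarrow> real) \<Rightarrow> bool" where
  "dyadic_support m \<psi> \<longleftrightarrow> (\<forall>x. \<psi> x \<noteq> 0 \<longrightarrow> dyad (- int m) \<le> N x \<and> N x \<le> dyad (int m))"

abbreviation punctured_tests :: "(real ^ 'n \<Rightarrow> real) set" where
  "punctured_tests \<equiv> test_functions (- {0})"

lemma dyadic_support_mono: "dyadic_support m \<psi> \<Longrightarrow> m \<le> m' \<Longrightarrow> dyadic_support m' \<psi>"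
  unfolding dyadic_support_def
  by (meson dyad_le_iff order_trans neg_le_iff_le of_nat_le_iff)

lemma compact_dyadic_shell:
  assumes "compact K" "K \<subseteq> - {0}"
  obtains m :: nat where "\<And>x. x \<in> K \<Longrightarrow> dyad (- int m) \<le> N x \<and> N x \<le> dyad (int m)"
proof (cases "K = {}")
  case False
  have c: "continuous_on K N" by (rule continuous_on_hnorm[OF \<sigma>_pos])
  obtain x where x: "x \<in> K" "\<And>y. y \<in> K \<Longrightarrow> N x \<le> N y"
    using continuous_attains_inf[OF assms(1) False c] by blast
  obtain y where y: "y \<in> K" "\<And>z. z \<in> K \<Longrightarrow> N z \<le> N y"
    using continuous_attains_sup[OF assms(1) False c] by blast
  have pos: "0 < N x" using x(1) assms(2) by (auto simp: hnorm_pos_iff)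
  obtain m1 where m1: "N y < 2 ^ m1" using real_arch_pow[of 2 "N y"] by auto
  obtain m2 where m2: "inverse (N x) < 2 ^ m2" using real_arch_pow[of 2 "inverse (N x)"] by auto
  show thesis
  proof (rule that[of "max m1 m2"])
    fix z assume z: "z \<in> K"
    have "(2 :: real) ^ m1 \<le> 2 ^ max m1 m2" "(2 :: real) ^ m2 \<le> 2 ^ max m1 m2"
      by (auto intro: power_increasing)
    then have 1: "N z \<le> 2 ^ max m1 m2" "inverse (N x) \<le> 2 ^ max m1 m2"
      using y(2)[OF z] m1 m2 by linarith+
    have "inverse (2 ^ max m1 m2) \<le> N x"
      using 1(2) pos by (simp add: field_simps)
    then show "dyad (- int (max m1 m2)) \<le> N z \<and> N z \<le> dyad (int (max m1 m2))"
      using 1(1) x(2)[OF z] by (simp add: powr_minus powr_realpow)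
  qed
qed (use that in blast)

lemma dyadic_support_test:
  assumes "\<psi> \<in> punctured_tests"
  obtains m where "dyadic_support m \<psi>"
proof -
  obtain K where K: "compact K" "K \<subseteq> - {0}" "\<And>x. x \<notin> K \<Longrightarrow> \<psi> x = 0"
    using test_functionsE[OF assms] by metis
  show thesis
    using compact_dyadic_shell[OF K(1,2)] K(3) that unfolding dyadic_support_def by metis
qed

text \<open>Summing over the nonzero terms only avoids any reference to a support bound. For a test
  function off the origin they are finitely many at every point, and the result is homogeneous of
  degree -\<open>s\<close> under dilation by 2 (\<open>periodize_dilation\<close>).\<close>

definition periodize :: "real \<Rightarrow> (real ^ 'n \<Rightarrow> real) \<Rightarrow> real ^ 'n \<Rightarrow> real" where
  "periodize s \<psi> x = (\<Sum>k | \<psi> (\<delta> (dyad k) x) \<noteq> 0. dyad k powr s * \<psi> (\<delta> (dyad k) x))"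

lemma dyadic_term_nonzero:
  assumes "dyadic_support m \<psi>" "\<psi> (\<delta> (dyad k) x) \<noteq> 0" "dyad j \<le> N x" "N x < dyad (j + 1)"
  shows "k \<in> {- int m - j..int m - j}"
proof -
  have "dyad (- int m) \<le> dyad k * N x" "dyad k * N x \<le> dyad (int m)"
    using assms(1,2) N_\<delta>[of "dyad k" x] by (auto simp: dyadic_support_def)
  moreover have "dyad (k + j) \<le> dyad k * N x" "dyad k * N x < dyad (k + (j + 1))"
    unfolding dyad_add[of k] using assms(3,4) by (auto intro: mult_left_mono)
  ultimately have "dyad (- int m) < dyad (k + (j + 1))" "dyad (k + j) \<le> dyad (int m)" by linarith+
  then have "- int m < k + (j + 1)" "k + j \<le> int m" unfolding dyad_less_iff dyad_le_iff .
  then show ?thesis by auto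
qed

text \<open>Enlarging the index set adds only zeros, so different points and different functions can
  share one set \<open>I\<close>.\<close>

lemma periodize_eq:
  assumes "dyadic_support m \<psi>" "dyad j \<le> N x" "N x < dyad (j + 1)" "finite I" "{- int m - j..int m - j} \<subseteq> I"
  shows "periodize s \<psi> x = (\<Sum>k\<in>I. dyad k powr s * \<psi> (\<delta> (dyad k) x))"
  unfolding periodize_def
  using dyadic_term_nonzero[OF assms(1) _ assms(2,3)] assms(4,5)
  by (intro sum.mono_neutral_left) auto

lemma periodize_dilation:
  "periodize s \<psi> (\<delta> (dyad i) x) = dyad i powr (- s) * periodize s \<psi> x"
proof -
  have "periodize s \<psi> (\<delta> (dyad i) x)
      = (\<Sum>k | \<psi> (\<delta> (dyad k) x) \<noteq> 0. dyad (k - i) powr s * \<psi> (\<delta> (dyad k) x))"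
    unfolding periodize_def
    by (rule sum.reindex_bij_witness[of _ "\<lambda>k. k - i" "\<lambda>k. k + i"])
      (auto simp: dilation_dilation powr_add[symmetric])
  also have "\<dots> = dyad i powr (- s) * periodize s \<psi> x"
    unfolding periodize_def sum_distrib_left
    by (intro sum.cong refl) (simp add: powr_powr powr_add[symmetric] algebra_simps)
  finally show ?thesis .
qed

text \<open>At each point at most 2 m + 1 terms survive, and in these 2^k is at most 2^m / N x. The
  bound is uniform in \<open>I\<close>, hence in the truncations used in the maximum
  principle.\<close>

lemma dyadic_sum_bound:
  assumes "dyadic_support m \<psi>" "\<And>x. \<bar>\<psi> x\<bar> \<le> B" "0 \<le> s" "finite I"
  shows "\<bar>\<Sum>k\<in>I. dyad k powr s * \<psi> (\<delta> (dyad k) x)\<bar> \<le> (2 * real m + 1) * (dyad (int m) powr s * B) * N x powr (- s)"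
proof (cases "x = 0")
  case True
  have "\<psi> 0 = 0"
    using assms(1) powr_gt_zero[of 2 "real_of_int (- int m)"] by (fastforce simp: dyadic_support_def)
  then show ?thesis using True by simp
next
  case False
  then have N: "0 < N x" by (simp add: hnorm_pos_iff)
  have B: "0 \<le> B" using assms(2)[of 0] by linarith
  obtain j where j: "dyad j \<le> N x" "N x < dyad (j + 1)" using exists_dyad_bracket[OF N] .
  let ?J = "{- int m - j..int m - j}"
  let ?t = "\<lambda>k. dyad k powr s * \<psi> (\<delta> (dyad k) x)"
  have t: "\<bar>?t k\<bar> \<le> dyad (int m) powr s * B * N x powr (- s)" for k
  proof (cases "\<psi> (\<delta> (dyad k) x) = 0")
    case False
    then have "dyad k * N x \<le> dyad (int m)"
      using assms(1) N_\<delta>[of "dyad k" x] by (auto simp: dyadic_support_def)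
    then have "(dyad k * N x) powr s \<le> dyad (int m) powr s"
      using N assms(3) by (intro powr_mono2) auto
    then have "dyad k powr s \<le> dyad (int m) powr s * N x powr (- s)"
      using N by (simp add: powr_mult powr_minus field_simps)
    then have "dyad k powr s * \<bar>\<psi> (\<delta> (dyad k) x)\<bar> \<le> (dyad (int m) powr s * N x powr (- s)) * B"
      using assms(2) B by (intro mult_mono) auto
    then show ?thesis by (simp add: abs_mult mult_ac)
  qed (use B in simp)
  have "(\<Sum>k\<in>I. ?t k) = (\<Sum>k\<in>I \<inter> ?J. ?t k)"
    using dyadic_term_nonzero[OF assms(1) _ j] assms(4) by (intro sum.mono_neutral_right) auto
  also have "\<bar>\<dots>\<bar> \<le> (\<Sum>k\<in>I \<inter> ?J. dyad (int m) powr s * B * N x powr (- s))"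
    by (rule order_trans[OF sum_abs sum_mono[OF t]])
  also have "\<dots> \<le> (\<Sum>k\<in>?J. dyad (int m) powr s * B * N x powr (- s))"
    using B by (intro sum_mono2) auto
  also have "\<dots> = (2 * real m + 1) * (dyad (int m) powr s * B) * N x powr (- s)"
    by (simp add: algebra_simps)
  finally show ?thesis .
qed

text \<open>For k \<le> M the dilation by 2^k is too weak to carry so small an x out to the
  support.\<close>

lemma dyadic_sum_near_zero:
  assumes "dyadic_support m \<psi>" "N x < dyad (- int M - int m)"
  shows "(\<Sum>k\<in>{- int M..int M}. dyad k powr s * \<psi> (\<delta> (dyad k) x)) = 0"
proof (intro sum.neutral ballI)
  fix k assume k: "k \<in> {- int M..int M}"
  have "N (\<delta> (dyad k) x) = dyad k * N x" by (simp add: N_\<delta>)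
  also have "\<dots> < dyad k * dyad (- int M - int m)" using assms(2) by (intro mult_strict_left_mono) auto
  also have "\<dots> \<le> dyad (- int m)" using k by (simp add: powr_add[symmetric])
  finally have "\<psi> (\<delta> (dyad k) x) = 0" using assms(1) by (fastforce simp: dyadic_support_def)
  then show "dyad k powr s * \<psi> (\<delta> (dyad k) x) = 0" by simp
qed

lemma punctured_tests_dilation: "\<psi> \<in> punctured_tests \<Longrightarrow> r > 0 \<Longrightarrow> (\<lambda>x. \<psi> (\<delta> r x)) \<in> punctured_tests"
  by (rule test_functions_dilation) (auto simp: dilation_eq_0_iff)

lemma punctured_tests_dyadic_sum:
  "\<psi> \<in> punctured_tests \<Longrightarrow> (\<lambda>x. \<Sum>k\<in>I. dyad k powr s * \<psi> (\<delta> (dyad k) x)) \<in> punctured_tests"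
  by (intro test_functions_sum test_functions_cmult punctured_tests_dilation) auto

lemma L_adj_dyadic_sum:
  assumes "\<phi> \<in> punctured_tests"
  shows "L_adj (\<lambda>x. \<Sum>k\<in>I. dyad k powr s * \<phi> (\<delta> (dyad k) x)) x
    = (\<Sum>k\<in>I. dyad k powr (s + 2) * L_adj \<phi> (\<delta> (dyad k) x))"
proof -
  have C: "Ck_on 2 (\<lambda>x. \<phi> (\<delta> (dyad k) x)) UNIV" for k
    by (rule test_functions_Ck[OF punctured_tests_dilation[OF assms]]) simp
  have "L_adj (\<lambda>x. \<Sum>k\<in>I. dyad k powr s * \<phi> (\<delta> (dyad k) x)) x
    = (\<Sum>k\<in>I. dyad k powr s * L_adj (\<lambda>x. \<phi> (\<delta> (dyad k) x)) x)"
    using C by (subst adj.op_L_sum[OF open_UNIV]) (auto intro: Ck_on_cmult simp: adj.op_L_cmult[OF open_UNIV])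
  also have "\<dots> = (\<Sum>k\<in>I. dyad k powr (s + 2) * L_adj \<phi> (\<delta> (dyad k) x))"
    using L_adj_dilation[OF test_functions_smooth[OF assms]]
    by (intro sum.cong refl) (simp add: powr_add powr_numeral)
  finally show ?thesis .
qed

section \<open>The maximum principle for the adjoint on homogeneous functions\<close>

lemma integral_L_adj_eq_0:
  assumes "Ck_on 2 G UNIV" "compact K" "\<And>x. x \<notin> K \<Longrightarrow> G x = 0"
  shows "integrable lebesgue (L_adj G)" "(LINT x|lebesgue. L_adj G x) = 0"
  using integration_by_parts[OF divergence_b open_UNIV Ck_on_const[OF open_UNIV, of 2 1] assms(1,2) subset_UNIV assms(3)]
  by simp_all

text \<open>The cube of the truncation at level \<open>s\<close> is a convex \<open>C\<^sup>2\<close> function of the negative part.\<close>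

lemma L_adj_cubed_negative_part:
  fixes s :: real
  assumes "\<Phi> \<in> punctured_tests" "0 < s"
  shows "(LINT x|lebesgue. 3 * (max 0 (- \<Phi> x - s))\<^sup>2 * (- L_adj \<Phi> x)) \<le> 0"
    and "integrable lebesgue (\<lambda>x. 3 * (max 0 (- \<Phi> x - s))\<^sup>2 * (- L_adj \<Phi> x))"
    and "continuous_on UNIV (\<lambda>x. 3 * (max 0 (- \<Phi> x - s))\<^sup>2 * (- L_adj \<Phi> x))"
proof -
  let ?h = "\<lambda>x. 3 * (max 0 (- \<Phi> x - s))\<^sup>2 * (- L_adj \<Phi> x)"
  obtain K where K: "compact K" "\<And>x. x \<notin> K \<Longrightarrow> \<Phi> x = 0" using test_functionsE[OF assms(1)] by metis
  show hc: "continuous_on UNIV ?h"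
    by (intro continuous_intros test_functions_continuous[OF assms(1)]
        test_functions_continuous[OF adj.test_functions_op_L[OF assms(1)]])
  show hi: "integrable lebesgue ?h"
    by (rule integrable_continuous_compact[OF hc K(1)]) (use K(2) assms(2) in simp)
  \<comment> \<open>Both derivatives of the cube are instances of this; at 0 the difference quotient
    is dominated by |h|^(n+1).\<close>
  have D: "((\<lambda>t :: real. (max 0 t) ^ Suc (Suc n)) has_real_derivative (real (Suc (Suc n)) * (max 0 t) ^ Suc n)) (at t)" for n t
  proof -
    consider "t < 0" | "t = 0" | "t > 0" by linarith
    then show ?thesis
    proof cases
      case 1
      show ?thesis
        by (rule has_field_derivative_transform_within_open[of "\<lambda>_. 0" _ _ "{..<0}"]) (use 1 in auto)
    next
      case 2
      have "((\<lambda>h :: real. \<bar>h\<bar> ^ Suc n) \<longlongrightarrow> \<bar>0\<bar> ^ Suc n) (at 0)" by (intro tendsto_intros)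
      then have lim: "((\<lambda>h :: real. \<bar>h\<bar> ^ Suc n) \<longlongrightarrow> 0) (at 0)" by simp
      have "norm ((max 0 h) ^ Suc (Suc n) / h) \<le> \<bar>h\<bar> ^ Suc n" for h :: real
      proof (cases "h \<le> 0")
        case True
        then have "(max 0 h) ^ Suc (Suc n) / h = 0" by simp
        then show ?thesis by (metis abs_ge_zero norm_zero zero_le_power)
      qed simp
      then have "((\<lambda>h :: real. (max 0 h) ^ Suc (Suc n) / h) \<longlongrightarrow> 0) (at 0)"
        by (intro Lim_null_comparison[OF always_eventually lim]) blast
      then show ?thesis using 2 by (simp add: has_field_derivative_iff)
    next
      case 3
      show ?thesis
        by (rule has_field_derivative_transform_within_open[of "\<lambda>t. t ^ Suc (Suc n)" _ _ "{0<..}"])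
          (use 3 in \<open>auto intro!: derivative_eq_intros simp del: power_Suc\<close>)
    qed
  qed
  let ?F = "\<lambda>t :: real. (max 0 (- t - s)) ^ 3"
  have inner: "((\<lambda>t. - t - s) has_real_derivative (- 1)) (at t)" for t
    by (auto intro!: derivative_eq_intros)
  have cube: "((\<lambda>t :: real. (max 0 t) ^ 3) has_real_derivative (3 * (max 0 t)\<^sup>2)) (at t)" for t
    using D[of 1 t] by (simp add: numeral_eq_Suc)
  have square: "((\<lambda>t :: real. (max 0 t)\<^sup>2) has_real_derivative (2 * max 0 t)) (at t)" for t
    using D[of 0 t] by (simp add: numeral_eq_Suc)
  have D1: "(?F has_real_derivative (- 3 * (max 0 (- t - s))\<^sup>2)) (at t)" for t
    using DERIV_chain2[where f = "\<lambda>t. (max 0 t) ^ 3" and g = "\<lambda>t. - t - s", OF cube inner] by simp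
  have D2: "((\<lambda>t. - 3 * (max 0 (- t - s))\<^sup>2) has_real_derivative (6 * max 0 (- t - s))) (at t)" for t
    using DERIV_cmult[OF DERIV_chain2[where f = "\<lambda>t. (max 0 t)\<^sup>2" and g = "\<lambda>t. - t - s", OF square inner], of "- 3"]
    by simp
  note ch = adj.op_L_chain[OF open_UNIV test_functions_Ck[OF assms(1)] UNIV_I open_UNIV subset_UNIV D1 D2]
  have c6: "continuous_on UNIV (\<lambda>t :: real. 6 * max 0 (- t - s))" by (intro continuous_intros)
  have G0: "?F (\<Phi> x) = 0" if "x \<notin> K" for x using K(2)[OF that] assms(2) by simp
  \<comment> \<open>The second derivative of \<open>?F\<close> and the carre du champ are both
    nonnegative, so the second order term of the chain rule may be dropped.\<close>
  have le: "?h x \<le> L_adj (\<lambda>y. ?F (\<Phi> y)) x" for x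
    using ch(2)[OF c6, of x] carre_du_champ_nonneg[of \<Phi> x] by simp
  have "(LINT x|lebesgue. ?h x) \<le> (LINT x|lebesgue. L_adj (\<lambda>y. ?F (\<Phi> y)) x)"
    by (intro integral_mono hi integral_L_adj_eq_0(1)[OF ch(1)[OF c6] K(1) G0] le)
  also have "\<dots> = 0" by (rule integral_L_adj_eq_0(2)[OF ch(1)[OF c6] K(1) G0])
  finally show "(LINT x|lebesgue. ?h x) \<le> 0" .
qed

abbreviation dyadic_shell :: "(real ^ 'n) set" where
  "dyadic_shell \<equiv> {x. 1 \<le> N x \<and> N x < 2}"

text \<open>A dilation by some power of 2 takes x into the shell, and \<open>periodize\<close> only
  picks up a positive factor.\<close>

lemma periodize_neg_everywhere:
  assumes "\<And>x. x \<in> dyadic_shell \<Longrightarrow> periodize s \<psi> x < 0" "x \<noteq> 0"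
  shows "periodize s \<psi> x < 0"
proof -
  obtain j where j: "dyad j \<le> N x" "N x < dyad (j + 1)"
    using exists_dyad_bracket[of "N x"] assms(2) by (auto simp: hnorm_pos_iff)
  let ?y = "\<delta> (dyad (- j)) x"
  have "dyad j * N ?y = N x" by (simp add: N_\<delta> powr_minus)
  moreover have "N x < dyad j * 2" using j(2) by (simp add: powr_add)
  ultimately have "dyad j * 1 \<le> dyad j * N ?y" "dyad j * N ?y < dyad j * 2" using j(1) by simp_all
  then have "?y \<in> dyadic_shell"
    by (simp only: mult_le_cancel_left_pos mult_less_cancel_left_pos powr_gt_zero mem_Collect_eq)
  then have "periodize s \<psi> ?y < 0" by (rule assms(1))
  then show ?thesis unfolding periodize_dilation by (simp add: mult_less_0_iff)
qed

text \<open>If the negative part of \<open>\<Phi> = periodize g \<phi>\<close> exceeds \<open>s\<close> somewhere, test the equation for the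
  truncations \<open>\<Phi> M\<close> of \<open>\<Phi>\<close> with the squared excess of the negative part over \<open>s\<close>. The excess vanishes far out
  because \<open>\<Phi>\<close> decays, and near the origin the error made by truncating is of order \<open>2\<^bsup>-M(Q-3g-2)\<^esup>\<close>.\<close>

lemma periodize_nonneg:
  assumes g: "0 < g" "3 * g + 2 < Q" and \<phi>: "\<phi> \<in> punctured_tests"
    and neg: "\<And>x. x \<in> dyadic_shell \<Longrightarrow> periodize (g + 2) (L_adj \<phi>) x < 0" and "x\<^sub>0 \<noteq> 0"
  shows "0 \<le> periodize g \<phi> x\<^sub>0"
proof (rule ccontr)
  assume negative: "\<not> ?thesis"
  \<comment> \<open>Half the depth at \<open>x\<^sub>0\<close>, so that the excess over
    \<open>s\<close> is still positive there.\<close>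
  define s where "s = - periodize g \<phi> x\<^sub>0 / 2"
  have s: "s > 0" using negative by (simp add: s_def)
  have L\<phi>: "L_adj \<phi> \<in> punctured_tests" by (rule adj.test_functions_op_L[OF \<phi>])
  obtain m1 m2 where "dyadic_support m1 \<phi>" "dyadic_support m2 (L_adj \<phi>)"
    using dyadic_support_test[OF \<phi>] dyadic_support_test[OF L\<phi>] by metis
  then obtain m where m: "dyadic_support m \<phi>" "dyadic_support m (L_adj \<phi>)"
    using dyadic_support_mono[of _ _ "max m1 m2"] by (metis max.cobounded1 max.cobounded2)
  obtain B1 B2 where B1: "B1 > 0" "\<And>x. \<bar>\<phi> x\<bar> \<le> B1" and B2: "B2 > 0" "\<And>x. \<bar>L_adj \<phi> x\<bar> \<le> B2"
    using test_functions_bounded[OF \<phi>] test_functions_bounded[OF L\<phi>] by metis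
  define \<Phi> where "\<Phi> M x = (\<Sum>k\<in>{- int M..int M}. dyad k powr g * \<phi> (\<delta> (dyad k) x))" for M :: nat and x
  have \<Phi>: "\<Phi> M \<in> punctured_tests" for M unfolding \<Phi>_def by (rule punctured_tests_dyadic_sum[OF \<phi>])
  have L\<Phi>: "L_adj (\<Phi> M) x = (\<Sum>k\<in>{- int M..int M}. dyad k powr (g + 2) * L_adj \<phi> (\<delta> (dyad k) x))" for M x
    unfolding \<Phi>_def by (rule L_adj_dyadic_sum[OF \<phi>])
  define C1 where "C1 = (2 * real m + 1) * (dyad (int m) powr g * B1)"
  define C2 where "C2 = (2 * real m + 1) * (dyad (int m) powr (g + 2) * B2)"
  have C: "0 < C1" "0 < C2" using B1 B2 by (auto simp: C1_def C2_def add_nonneg_pos)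
  have \<Phi>b: "\<bar>\<Phi> M x\<bar> \<le> C1 * N x powr (- g)" for M x
    unfolding \<Phi>_def C1_def by (rule dyadic_sum_bound[OF m(1) B1(2)]) (use g in auto)
  have L\<Phi>b: "\<bar>L_adj (\<Phi> M) x\<bar> \<le> C2 * N x powr (- (g + 2))" for M x
    unfolding L\<Phi> C2_def by (rule dyadic_sum_bound[OF m(2) B2(2)]) (use g in auto)
  have \<Phi>_eq: "\<Phi> M x = periodize g \<phi> x" "L_adj (\<Phi> M) x = periodize (g + 2) (L_adj \<phi>) x"
    if "dyad j \<le> N x" "N x < dyad (j + 1)" "\<bar>j\<bar> + int m \<le> int M" for j M x
    unfolding L\<Phi> unfolding \<Phi>_def
    by (rule periodize_eq[symmetric, OF m(1) that(1,2)] periodize_eq[symmetric, OF m(2) that(1,2)];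
        use that(3) in auto)+
  \<comment> \<open>Away from the two ends the truncation removes only terms that vanish at x, so
    the truncated sum has the sign of the full one.\<close>
  have Lneg: "L_adj (\<Phi> M) x < 0" if "dyad (int m - int M) \<le> N x" "N x < dyad (int M - int m)" for M x
  proof -
    have N: "0 < N x" by (rule less_le_trans[OF _ that(1)]) simp
    obtain j where j: "dyad j \<le> N x" "N x < dyad (j + 1)" using exists_dyad_bracket[OF N] .
    have "dyad (int m - int M) < dyad (j + 1)" "dyad j < dyad (int M - int m)" using j that by linarith+
    then have "\<bar>j\<bar> + int m \<le> int M" unfolding dyad_less_iff by linarith
    then show ?thesis
      using \<Phi>_eq(2)[OF j] periodize_neg_everywhere[OF neg] N by (simp add: hnorm_pos_iff)
  qed
  define h where "h M x = 3 * (max 0 (- \<Phi> M x - s))\<^sup>2 * (- L_adj (\<Phi> M) x)" for M x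
  have hi: "integrable lebesgue (h M)" and hc: "continuous_on UNIV (h M)" and hle: "(LINT x|lebesgue. h M x) \<le> 0" for M
    unfolding h_def using L_adj_cubed_negative_part[OF \<Phi> s] by blast+
  obtain j0 where j0: "dyad j0 \<le> N x\<^sub>0" "N x\<^sub>0 < dyad (j0 + 1)"
    using exists_dyad_bracket[of "N x\<^sub>0"] \<open>x\<^sub>0 \<noteq> 0\<close> by (auto simp: hnorm_pos_iff)
  \<comment> \<open>An open set around \<open>x\<^sub>0\<close> on which \<open>h M\<close> no
    longer changes once M \<ge> \<open>M0\<close>. As \<open>x\<^sub>0\<close> may sit at the left
    end of its bracket, the bracket before it is included; the margin |j0| + 2 in \<open>M0\<close>
    covers both and keeps \<open>U\<close> away from the two ends.\<close>
  define U where "U = {x. dyad (j0 - 1) < N x} \<inter> {x. N x < dyad (j0 + 1)}"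
  have U: "open U" unfolding U_def by (intro open_Int open_N_less)
  have "dyad (j0 - 1) < dyad j0" by simp
  from less_le_trans[OF this j0(1)] j0(2) have x0U: "x\<^sub>0 \<in> U" unfolding U_def by simp
  define M0 where "M0 = nat (\<bar>j0\<bar> + 2) + m"
  have hU: "h M x = h M0 x" "0 \<le> h M x" if "x \<in> U" "M0 \<le> M" for M x
  proof -
    have "dyad (j0 - 1) \<le> N x" "N x < dyad (j0 + 1)" using that(1) by (auto simp: U_def)
    then have "\<exists>j. dyad j \<le> N x \<and> N x < dyad (j + 1) \<and> (j = j0 \<or> j = j0 - 1)"
      by (cases "dyad j0 \<le> N x") (auto intro: exI[of _ j0] exI[of _ "j0 - 1"])
    then obtain j where j: "dyad j \<le> N x" "N x < dyad (j + 1)" "j = j0 \<or> j = j0 - 1" by blast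
    have j': "\<bar>j\<bar> + int m \<le> int M0" using j(3) by (auto simp: M0_def)
    then have "\<bar>j\<bar> + int m \<le> int M" using that(2) by linarith
    then show "h M x = h M0 x" using \<Phi>_eq[OF j(1,2)] j' by (simp add: h_def)
    have "x \<noteq> 0" using j(1) powr_gt_zero[of 2 "real_of_int j"] by (auto simp: not_less[symmetric])
    then have "L_adj (\<Phi> M) x < 0"
      using \<Phi>_eq(2)[OF j(1,2) \<open>\<bar>j\<bar> + int m \<le> int M\<close>] periodize_neg_everywhere[OF neg] by simp
    then show "0 \<le> h M x" by (simp add: h_def mult_nonneg_nonpos)
  qed
  define \<kappa> where "\<kappa> = (LINT x|lebesgue. indicator U x * h M0 x)"
  have iU: "integrable lebesgue (\<lambda>x. indicator U x * h M0 x)"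
    using integrable_mult_indicator[OF sets_lebesgue_open[OF U] hi[of M0]] by simp
  have nnU: "0 \<le> indicator U x * h M0 x" for x using hU(2)[of x M0] by (auto simp: indicator_def)
  have "\<kappa> > 0"
  proof -
    have "\<kappa> \<noteq> 0"
    proof
      assume "\<kappa> = 0"
      then have "AE x in lebesgue. indicator U x * h M0 x = 0"
        using integral_nonneg_eq_0_iff_AE[OF iU] nnU by (simp add: \<kappa>_def)
      then have "AE x in lebesgue. x \<in> U \<longrightarrow> h M0 x = 0" by eventually_elim auto
      then have "h M0 x\<^sub>0 = 0"
        by (rule AE_zero_imp_zero[OF U continuous_on_subset[OF hc subset_UNIV] _ x0U])
      moreover have "\<Phi> M0 x\<^sub>0 = periodize g \<phi> x\<^sub>0" "L_adj (\<Phi> M0) x\<^sub>0 = periodize (g + 2) (L_adj \<phi>) x\<^sub>0"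
        by (rule \<Phi>_eq[OF j0]; simp add: M0_def)+
      ultimately show False
        using periodize_neg_everywhere[OF neg \<open>x\<^sub>0 \<noteq> 0\<close>] s by (auto simp: h_def s_def)
    qed
    moreover have "0 \<le> \<kappa>" unfolding \<kappa>_def by (intro Bochner_Integration.integral_nonneg nnU)
    ultimately show ?thesis by simp
  qed
  \<comment> \<open>The bound 3 (C1 N^(-g))^2 C2 N^(-(g+2)) for |h M|, evaluated at N = 2^(-M-m);
    still closer to the origin \<open>\<Phi> M\<close> vanishes.\<close>
  define E where "E M = 3 * C1\<^sup>2 * C2 * dyad (int M + int m) powr (3 * g + 2)" for M :: nat
  have key: "\<kappa> \<le> E M * (dyad (int m - int M) powr Q * unit_volume)"
    if M: "M0 \<le> M" and out: "C1 * dyad (int M - int m) powr (- g) \<le> s" for M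
  proof -
    \<comment> \<open>Only the ball of radius 2^(m-M) can contribute negatively: in the middle
      region the sign is right, and beyond it the excess over \<open>s\<close> is 0.\<close>
    have pt: "indicator U x * h M0 x - E M * indicator {x. N x \<le> dyad (int m - int M)} x \<le> h M x" for x
    proof -
      consider (inner) "N x < dyad (int m - int M)" | (middle) "dyad (int m - int M) \<le> N x" "N x < dyad (int M - int m)"
        | (outer) "dyad (int M - int m) \<le> N x" by linarith
      then show ?thesis
      proof cases
        case inner
        have "dyad (int m - int M) \<le> dyad (j0 - 1)" using M by (simp add: M0_def)
        from less_le_trans[OF inner this] have xU: "x \<notin> U" by (auto simp: U_def)
        have "- E M \<le> h M x"
        proof (cases "N x < dyad (- int M - int m)")
          case True
          then have "\<Phi> M x = 0" unfolding \<Phi>_def by (rule dyadic_sum_near_zero[OF m(1)])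
          then show ?thesis using s C by (simp add: h_def E_def)
        next
          case False
          have N: "0 < N x" using False powr_gt_zero[of 2 "real_of_int (- int M - int m)"] by linarith
          have inv: "N x powr (- a) \<le> dyad (int M + int m) powr a" if "0 \<le> a" for a
          proof -
            have "N x powr (- a) \<le> dyad (- int M - int m) powr (- a)"
              using False that N by (intro powr_mono2') auto
            then show ?thesis by (simp add: powr_powr algebra_simps)
          qed
          have "max 0 (- \<Phi> M x - s) \<le> \<bar>\<Phi> M x\<bar>" using s by auto
          also have "\<dots> \<le> C1 * dyad (int M + int m) powr g"
            using \<Phi>b[of M x] inv[of g] g C by (meson less_imp_le mult_left_mono order_trans)
          finally have "(max 0 (- \<Phi> M x - s))\<^sup>2 \<le> (C1 * dyad (int M + int m) powr g)\<^sup>2"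
            by (intro power_mono) auto
          moreover have "\<bar>L_adj (\<Phi> M) x\<bar> \<le> C2 * dyad (int M + int m) powr (g + 2)"
            using L\<Phi>b[of M x] inv[of "g + 2"] g C
              mult_left_mono[of "N x powr (- (g + 2))" "dyad (int M + int m) powr (g + 2)" C2] by linarith
          ultimately have "(max 0 (- \<Phi> M x - s))\<^sup>2 * \<bar>L_adj (\<Phi> M) x\<bar>
              \<le> (C1 * dyad (int M + int m) powr g)\<^sup>2 * (C2 * dyad (int M + int m) powr (g + 2))"
            by (intro mult_mono) auto
          then have "\<bar>h M x\<bar> \<le> 3 * ((C1 * dyad (int M + int m) powr g)\<^sup>2 * (C2 * dyad (int M + int m) powr (g + 2)))"
            by (simp add: h_def abs_mult)
          also have "\<dots> = E M"
            by (simp add: E_def power_mult_distrib power2_eq_square powr_add[symmetric] algebra_simps)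
          finally show ?thesis by linarith
        qed
        then show ?thesis using xU inner by simp
      next
        case middle
        then have "0 \<le> h M x" using Lneg[of M x] by (simp add: h_def mult_nonneg_nonpos)
        moreover have "0 \<le> E M" using C by (simp add: E_def)
        ultimately show ?thesis using hU(1)[of x M] M by (auto simp: indicator_def)
      next
        case outer
        have "N x powr (- g) \<le> dyad (int M - int m) powr (- g)"
          using outer g by (intro powr_mono2') auto
        then have "C1 * N x powr (- g) \<le> s" using out C by (meson less_imp_le mult_left_mono order_trans)
        then have "h M x = 0" using \<Phi>b[of M x] by (simp add: h_def)
        moreover have "dyad (j0 + 1) \<le> dyad (int M - int m)" using M by (simp add: M0_def)
        from order_trans[OF this outer] have "x \<notin> U" by (auto simp: U_def)
        moreover have "0 \<le> E M" using C by (simp add: E_def)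
        ultimately show ?thesis by simp
      qed
    qed
    have iE: "integrable lebesgue (\<lambda>x. E M * indicator {x. N x \<le> dyad (int m - int M)} x)"
      by (intro integrable_mult_right integrable_indicator_ball)
    have "\<kappa> - E M * (dyad (int m - int M) powr Q * unit_volume)
      = (LINT x|lebesgue. indicator U x * h M0 x - E M * indicator {x. N x \<le> dyad (int m - int M)} x)"
      by (simp only: \<kappa>_def Bochner_Integration.integral_diff[OF iU iE] integral_mult_right_zero
          integral_indicator_ball[of "dyad (int m - int M)"] powr_gt_zero)
    also have "\<dots> \<le> (LINT x|lebesgue. h M x)"
      by (intro integral_mono hi Bochner_Integration.integrable_diff iU iE pt)
    also have "\<dots> \<le> 0" by (rule hle)
    finally show ?thesis by simp
  qed
  have pow: "(\<lambda>M :: nat. c * (2 powr (- a)) ^ M) \<longlonglongrightarrow> 0" if "0 < a" for a c :: real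
    using that by (intro tendsto_mult_right_zero LIMSEQ_power_zero) (simp add: powr_less_one)
  have "(\<lambda>M. E M * (dyad (int m - int M) powr Q * unit_volume)) \<longlonglongrightarrow> 0"
  proof -
    have "E M * (dyad (int m - int M) powr Q * unit_volume)
      = (3 * C1\<^sup>2 * C2 * unit_volume * dyad (int m) powr (3 * g + 2 + Q)) * (2 powr (- (Q - (3 * g + 2)))) ^ M" for M
      by (simp add: E_def powr_realpow[symmetric] powr_powr powr_add[symmetric] algebra_simps)
    then show ?thesis by (simp only:) (rule pow, use g in simp)
  qed
  moreover have "(\<lambda>M. C1 * dyad (int M - int m) powr (- g)) \<longlonglongrightarrow> 0"
  proof -
    have "C1 * dyad (int M - int m) powr (- g) = (C1 * dyad (int m) powr g) * (2 powr (- g)) ^ M" for M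
      by (simp add: powr_realpow[symmetric] powr_powr powr_add[symmetric] algebra_simps)
    then show ?thesis by (simp only:) (rule pow[OF g(1)])
  qed
  ultimately have "eventually (\<lambda>M. E M * (dyad (int m - int M) powr Q * unit_volume) < \<kappa>
      \<and> C1 * dyad (int M - int m) powr (- g) < s \<and> M0 \<le> M) sequentially"
    using \<open>\<kappa> > 0\<close> s by (intro eventually_conj order_tendstoD(2) eventually_ge_at_top)
  then obtain M where "E M * (dyad (int m - int M) powr Q * unit_volume) < \<kappa>"
      "C1 * dyad (int M - int m) powr (- g) < s" "M0 \<le> M"
    by (auto simp: eventually_sequentially)
  with key[of M] show False by simp
qed

end

section \<open>A positive homogeneous supersolution\<close>

context homogeneous_operator
begin

text \<open>The factor 1/2 keeps the first cutoff equal to 1 up to N = 2; the factor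
  \<open>2 * cutoff_radius \<sigma>\<close> kills the second cutoff for N > 1/2, which leaves room
  for the strict inequality in \<open>cutoff_eq_0\<close> on all of N \<ge> 1.\<close>

definition shell_bump :: "real ^ 'n \<Rightarrow> real" where
  "shell_bump x = cutoff (\<delta> (1 / 2) x) * (1 - cutoff (\<delta> (2 * cutoff_radius \<sigma>) x))"

lemma shell_bump_nonneg: "0 \<le> shell_bump x"
  unfolding shell_bump_def by (intro mult_nonneg_nonneg) (auto simp: cutoff_bounds)

lemma shell_bump_eq_1: "1 \<le> N x \<Longrightarrow> N x \<le> 2 \<Longrightarrow> shell_bump x = 1"
  using cutoff_radius_pos[of \<sigma>]
  by (simp add: shell_bump_def cutoff_eq_1[of \<sigma>, OF \<sigma>_pos] cutoff_eq_0[of \<sigma>, OF \<sigma>_pos] N_\<delta>)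

lemma shell_bump_test: "shell_bump \<in> punctured_tests"
proof (rule test_functionsI)
  let ?c = "2 * cutoff_radius \<sigma>"
  have c: "0 < ?c" using cutoff_radius_pos[of \<sigma>] by simp
  have "smooth_on UNIV (\<lambda>x. 1 - cutoff (\<delta> ?c x))"
    by (intro smooth_onI Ck_on_diff Ck_on_const open_UNIV smooth_onD[OF smooth_on_dilation[OF smooth_cutoff]])
  then show "smooth_on UNIV shell_bump"
    unfolding shell_bump_def[abs_def] by (intro smooth_on_mult open_UNIV smooth_on_dilation[OF smooth_cutoff])
  have "closed {x. inverse ?c \<le> N x}"
    using continuous_on_hnorm[of \<sigma> UNIV, OF \<sigma>_pos] by (intro closed_Collect_le continuous_intros)
  then show "compact ({x. N x \<le> ?c} \<inter> {x. inverse ?c \<le> N x})"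
    by (intro compact_Int_closed compact_hnorm_le \<sigma>_pos)
  show "{x. N x \<le> ?c} \<inter> {x. inverse ?c \<le> N x} \<subseteq> - {0}" using c by auto
  show "shell_bump x = 0" if "x \<notin> {x. N x \<le> ?c} \<inter> {x. inverse ?c \<le> N x}" for x
  proof (cases "N x \<le> ?c")
    case True
    then have "N x < inverse ?c" using that by simp
    then have "?c * N x < ?c * inverse ?c" using c by (rule mult_strict_left_mono)
    also have "?c * inverse ?c = 1" by (rule right_inverse) (use c in simp)
    finally have "?c * N x < 1" .
    then show ?thesis
      unfolding shell_bump_def using c by (simp add: cutoff_eq_1[of \<sigma>, OF \<sigma>_pos] N_\<delta>)
  next
    case False
    then show ?thesis unfolding shell_bump_def by (simp add: cutoff_eq_0[of \<sigma>, OF \<sigma>_pos] N_\<delta>)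
  qed
qed

lemma exists_N_eq: "r > 0 \<Longrightarrow> \<exists>x. N x = r"
proof -
  assume r: "r > 0"
  define e where "e = (axis undefined 1 :: real ^ 'n)"
  have "e \<noteq> 0" by (simp add: e_def axis_eq_0_iff)
  then have "N e > 0" by (simp add: hnorm_pos_iff)
  then have "N (\<delta> (r / N e) e) = r" using r by (simp add: N_\<delta>)
  then show ?thesis by blast
qed

lemma smooth_periodize:
  assumes "\<psi> \<in> punctured_tests"
  shows "smooth_on (- {0}) (periodize s \<psi>)"
proof (rule smooth_onI, rule Ck_on_local)
  fix k and x :: "real ^ 'n" assume "x \<in> - {0}"
  then have "0 < N x" by (simp add: hnorm_pos_iff)
  then obtain j where j: "dyad j \<le> N x" "N x < dyad (j + 1)" using exists_dyad_bracket by metis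
  obtain m where m: "dyadic_support m \<psi>" using dyadic_support_test[OF assms] .
  define U where "U = {y. dyad (j - 1) < N y} \<inter> {y. N y < dyad (j + 1)}"
  have U: "open U" unfolding U_def by (intro open_Int open_N_less)
  \<comment> \<open>\<open>U\<close> meets the two brackets j - 1 and j, hence one index more than
    for a single bracket.\<close>
  let ?I = "{- int m - j..int m - j + 1}"
  have "periodize s \<psi> y = (\<Sum>k\<in>?I. dyad k powr s * \<psi> (\<delta> (dyad k) y))" if "y \<in> U" for y
  proof -
    have y: "dyad (j - 1) \<le> N y" "N y < dyad (j + 1)" using that by (auto simp: U_def)
    show ?thesis
    proof (cases "dyad j \<le> N y")
      case True
      show ?thesis by (rule periodize_eq[OF m True y(2)]) auto
    next
      case False
      show ?thesis by (rule periodize_eq[OF m y(1)]) (use False in auto)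
    qed
  qed
  then have "Ck_on k (periodize s \<psi>) U"
    by (intro Ck_on_cong[OF U _ Ck_on_subset[OF test_functions_Ck[OF punctured_tests_dyadic_sum[OF assms]] subset_UNIV]]) simp
  moreover have "dyad (j - 1) < dyad j" by simp
  from less_le_trans[OF this j(1)] j(2) have "x \<in> U" unfolding U_def by simp
  ultimately show "\<exists>U. open U \<and> x \<in> U \<and> Ck_on k (periodize s \<psi>) U" using U by blast
qed auto

lemma periodize_nonneg_function: "(\<And>x. 0 \<le> \<psi> x) \<Longrightarrow> 0 \<le> periodize s \<psi> x"
  unfolding periodize_def by (intro sum_nonneg mult_nonneg_nonneg) auto

lemma periodize_cmult: "periodize s (\<lambda>x. c * \<psi> x) x = c * periodize s \<psi> x"
proof (cases "c = 0")
  case False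
  then show ?thesis unfolding periodize_def by (simp add: sum_distrib_left mult.left_commute)
qed (simp add: periodize_def)

lemma periodize_add:
  assumes "\<phi> \<in> punctured_tests" "\<psi> \<in> punctured_tests" "x \<noteq> 0"
  shows "periodize s (\<lambda>x. \<phi> x + \<psi> x) x = periodize s \<phi> x + periodize s \<psi> x"
proof -
  obtain m1 m2 where "dyadic_support m1 \<phi>" "dyadic_support m2 \<psi>"
    using dyadic_support_test[OF assms(1)] dyadic_support_test[OF assms(2)] by metis
  then obtain m where m: "dyadic_support m \<phi>" "dyadic_support m \<psi>"
    using dyadic_support_mono[of _ _ "max m1 m2"] by (metis max.cobounded1 max.cobounded2)
  then have m': "dyadic_support m (\<lambda>x. \<phi> x + \<psi> x)"
    unfolding dyadic_support_def by (metis add.right_neutral)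
  have "0 < N x" using assms(3) by (simp add: hnorm_pos_iff)
  then obtain j where j: "dyad j \<le> N x" "N x < dyad (j + 1)" using exists_dyad_bracket by metis
  have fin: "finite {- int m - j..int m - j}" by simp
  show ?thesis
    unfolding periodize_eq[OF m(1) j fin order_refl] periodize_eq[OF m(2) j fin order_refl]
      periodize_eq[OF m' j fin order_refl]
    by (simp add: distrib_left sum.distrib)
qed

lemma periodize_bound:
  assumes "dyadic_support m \<psi>" "\<And>x. \<bar>\<psi> x\<bar> \<le> B" "0 \<le> s" "1 \<le> N x"
  shows "\<bar>periodize s \<psi> x\<bar> \<le> (2 * real m + 1) * (dyad (int m) powr s * B)"
proof -
  have "0 < N x" using assms(4) by linarith
  then obtain j where j: "dyad j \<le> N x" "N x < dyad (j + 1)" using exists_dyad_bracket by metis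
  have fin: "finite {- int m - j..int m - j}" by simp
  have B: "0 \<le> B" using assms(2)[of 0] by linarith
  have "\<bar>periodize s \<psi> x\<bar> \<le> (2 * real m + 1) * (dyad (int m) powr s * B) * N x powr (- s)"
    unfolding periodize_eq[OF assms(1) j fin order_refl] by (rule dyadic_sum_bound[OF assms(1-3) fin])
  also have "\<dots> \<le> (2 * real m + 1) * (dyad (int m) powr s * B) * 1"
    using powr_mono2'[of "- s" 1 "N x"] assms(3,4) B by (intro mult_left_mono) auto
  finally show ?thesis by simp
qed

text \<open>\<open>w\<close> may be singular or arbitrary at the origin, but \<open>\<phi>\<close>
  vanishes in a neighbourhood of it.\<close>

lemma punctured_pairing:
  assumes "continuous_on (- {0}) w" "\<phi> \<in> punctured_tests"
  shows "continuous_on UNIV (\<lambda>x. w x * \<phi> x)" "integrable lebesgue (\<lambda>x. w x * \<phi> x)"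
proof -
  obtain K where K: "compact K" "K \<subseteq> - {0}" "\<And>x. x \<notin> K \<Longrightarrow> \<phi> x = 0"
    using test_functionsE[OF assms(2)] by metis
  have "Ck_on 0 (\<lambda>x. w x * \<phi> x) UNIV"
    by (rule Ck_on_extend_zero[OF _ _ compact_imp_closed[OF K(1)] K(2)])
      (use K assms(1) in \<open>auto intro!: continuous_intros continuous_on_subset[OF test_functions_continuous[OF assms(2)]]\<close>)
  then show c: "continuous_on UNIV (\<lambda>x. w x * \<phi> x)" by simp
  show "integrable lebesgue (\<lambda>x. w x * \<phi> x)"
    by (rule integrable_continuous_compact[OF c K(1)]) (use K(3) in simp)
qed

text \<open>The change of variables by 2^k contributes 2^(-kQ), which turns the weight 2^(k(Q-g))
  into 2^(-kg); replacing k by -k moves the sum from \<open>\<eta>\<close> to \<open>\<phi>\<close>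
  with the dual exponent.\<close>

lemma integral_periodize_pairing:
  assumes \<eta>: "\<eta> \<in> punctured_tests" "dyadic_support m \<eta>" and \<phi>: "\<phi> \<in> punctured_tests" "dyadic_support m \<phi>"
  shows "(LINT x|lebesgue. periodize (Q - g) \<eta> x * \<phi> x)
      = (LINT x|lebesgue. \<eta> x * (\<Sum>k\<in>{- int (2 * m)..int (2 * m)}. dyad k powr g * \<phi> (\<delta> (dyad k) x)))"
    and "\<eta> x \<noteq> 0 \<Longrightarrow> (\<Sum>k\<in>{- int (2 * m)..int (2 * m)}. dyad k powr g * \<phi> (\<delta> (dyad k) x)) = periodize g \<phi> x"
proof -
  \<comment> \<open>Both supports lie between 2^(-m) and 2^m, so no dilation beyond 2^(2m) or below
    2^(-2m) relates them.\<close>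
  let ?I = "{- int (2 * m)..int (2 * m)}"
  have bracket: "\<exists>j. dyad j \<le> N x \<and> N x < dyad (j + 1) \<and> {- int m - j..int m - j} \<subseteq> ?I"
    if \<psi>: "dyadic_support m \<psi>" "\<psi> x \<noteq> 0" for \<psi> x
  proof -
    have b: "dyad (- int m) \<le> N x" "N x \<le> dyad (int m)" using that by (auto simp: dyadic_support_def)
    have "0 < N x" by (rule less_le_trans[OF _ b(1)]) simp
    then obtain j where j: "dyad j \<le> N x" "N x < dyad (j + 1)" using exists_dyad_bracket by metis
    have "dyad (- int m) < dyad (j + 1)" "dyad j \<le> dyad (int m)" using b j by linarith+
    then have "- int m < j + 1" "j \<le> int m" unfolding dyad_less_iff dyad_le_iff .
    then have "{- int m - j..int m - j} \<subseteq> ?I" by auto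
    with j show ?thesis by blast
  qed
  show "(\<Sum>k\<in>?I. dyad k powr g * \<phi> (\<delta> (dyad k) x)) = periodize g \<phi> x" if "\<eta> x \<noteq> 0" for x
    using bracket[OF \<eta>(2) that] periodize_eq[OF \<phi>(2), of _ x ?I g] by force
  have "periodize (Q - g) \<eta> x * \<phi> x = (\<Sum>k\<in>?I. dyad k powr (Q - g) * (\<eta> (\<delta> (dyad k) x) * \<phi> x))" for x
  proof (cases "\<phi> x = 0")
    case False
    then show ?thesis
      using bracket[OF \<phi>(2) False] periodize_eq[OF \<eta>(2), of _ x ?I "Q - g"]
      by (force simp: sum_distrib_right mult.assoc)
  qed simp
  moreover have prod_int: "integrable lebesgue (\<lambda>x. \<eta> (\<delta> r x) * \<phi> x)" if "r > 0" for r
    by (rule punctured_pairing(2)[OF continuous_on_subset[OF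
          test_functions_continuous[OF punctured_tests_dilation[OF \<eta>(1) that]]] \<phi>(1)]) simp
  ultimately have "(LINT x|lebesgue. periodize (Q - g) \<eta> x * \<phi> x)
    = (\<Sum>k\<in>?I. dyad k powr (Q - g) * (LINT x|lebesgue. \<eta> (\<delta> (dyad k) x) * \<phi> x))"
    by (simp add: Bochner_Integration.integral_sum)
  also have "\<dots> = (\<Sum>k\<in>?I. dyad (- k) powr g * (LINT x|lebesgue. \<eta> x * \<phi> (\<delta> (dyad (- k)) x)))"
  proof (rule sum.cong[OF refl])
    fix k
    have c: "continuous_on UNIV (\<lambda>x. \<eta> x * \<phi> (\<delta> (dyad (- k)) x))"
      by (intro continuous_intros test_functions_continuous[OF \<eta>(1)]
          continuous_on_compose2[OF test_functions_continuous[OF \<phi>(1)]]) auto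
    have inv: "\<delta> (dyad (- k)) (\<delta> (dyad k) x) = x" for x
      by (subst dilation_dilation) (auto simp: powr_add[symmetric])
    have "(LINT x|lebesgue. \<eta> (\<delta> (dyad k) x) * \<phi> x)
        = dyad k powr (- Q) * (LINT x|lebesgue. \<eta> x * \<phi> (\<delta> (dyad (- k)) x))"
      using lebesgue_integral_dilation(1)[OF _ borel_measurable_lebesgue_continuous[OF c], of "dyad k" \<sigma>]
      unfolding inv by simp
    then show "dyad k powr (Q - g) * (LINT x|lebesgue. \<eta> (\<delta> (dyad k) x) * \<phi> x)
        = dyad (- k) powr g * (LINT x|lebesgue. \<eta> x * \<phi> (\<delta> (dyad (- k)) x))"
      by (simp add: powr_powr powr_add[symmetric] algebra_simps)
  qed
  also have "\<dots> = (\<Sum>k\<in>?I. dyad k powr g * (LINT x|lebesgue. \<eta> x * \<phi> (\<delta> (dyad k) x)))"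
    by (rule sum.reindex_bij_witness[of _ uminus uminus]) auto
  also have "\<dots> = (LINT x|lebesgue. (\<Sum>k\<in>?I. dyad k powr g * (\<eta> x * \<phi> (\<delta> (dyad k) x))))"
  proof -
    have "integrable lebesgue (\<lambda>x. \<eta> x * \<phi> (\<delta> (dyad k) x))" for k
      by (rule punctured_pairing(2)[OF continuous_on_subset[OF test_functions_continuous[OF \<eta>(1)]]
            punctured_tests_dilation[OF \<phi>(1)]]) auto
    then show ?thesis by (simp add: Bochner_Integration.integral_sum)
  qed
  finally show "(LINT x|lebesgue. periodize (Q - g) \<eta> x * \<phi> x)
      = (LINT x|lebesgue. \<eta> x * (\<Sum>k\<in>?I. dyad k powr g * \<phi> (\<delta> (dyad k) x)))"
    by (simp add: sum_distrib_left mult.left_commute)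
qed

text \<open>By duality the integral is that of \<open>shell_bump\<close> times the periodization of
  \<open>\<phi>\<close>, which the maximum principle makes nonnegative. Were it 0, the periodization
  would vanish inside the shell and so would its image under \<open>L_adj\<close>, against the
  strict inequality assumed.\<close>

lemma pairing_pos:
  assumes g: "0 < g" "3 * g + 2 < Q" and \<phi>: "\<phi> \<in> punctured_tests"
    and neg: "\<And>x. x \<in> dyadic_shell \<Longrightarrow> periodize (g + 2) (L_adj \<phi>) x < 0"
  shows "0 < (LINT x|lebesgue. periodize (Q - g) shell_bump x * \<phi> x)"
proof -
  have L\<phi>: "L_adj \<phi> \<in> punctured_tests" by (rule adj.test_functions_op_L[OF \<phi>])
  obtain m1 where m1: "dyadic_support m1 \<phi>" using dyadic_support_test[OF \<phi>] .
  obtain m2 where m2: "dyadic_support m2 shell_bump" using dyadic_support_test[OF shell_bump_test] .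
  obtain m3 where m3: "dyadic_support m3 (L_adj \<phi>)" using dyadic_support_test[OF L\<phi>] .
  define m where "m = m1 + m2 + m3"
  have m: "dyadic_support m \<phi>" "dyadic_support m shell_bump" "dyadic_support m (L_adj \<phi>)"
    by (rule dyadic_support_mono[OF m1] dyadic_support_mono[OF m2] dyadic_support_mono[OF m3]; simp add: m_def)+
  define \<Phi> where "\<Phi> x = (\<Sum>k\<in>{- int (2 * m)..int (2 * m)}. dyad k powr g * \<phi> (\<delta> (dyad k) x))" for x
  have \<Phi>: "\<Phi> \<in> punctured_tests" unfolding \<Phi>_def by (rule punctured_tests_dyadic_sum[OF \<phi>])
  have eq: "(LINT x|lebesgue. periodize (Q - g) shell_bump x * \<phi> x) = (LINT x|lebesgue. shell_bump x * \<Phi> x)"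
    unfolding \<Phi>_def by (rule integral_periodize_pairing(1)[OF shell_bump_test m(2) \<phi> m(1)])
  have nn: "0 \<le> shell_bump x * \<Phi> x" for x
  proof (cases "shell_bump x = 0")
    case False
    have "shell_bump 0 = 0"
      using cutoff_eq_1[of \<sigma> 0, OF \<sigma>_pos] by (simp add: shell_bump_def)
    then have "x \<noteq> 0" using False by auto
    have "\<Phi> x = periodize g \<phi> x"
      unfolding \<Phi>_def by (rule integral_periodize_pairing(2)[OF shell_bump_test m(2) \<phi> m(1) False])
    then show ?thesis
      using periodize_nonneg[OF g \<phi> neg \<open>x \<noteq> 0\<close>] shell_bump_nonneg[of x] by simp
  qed simp
  have "continuous_on (- {0}) shell_bump"
    by (rule continuous_on_subset[OF test_functions_continuous[OF shell_bump_test]]) simp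
  note c = punctured_pairing[OF this \<Phi>]
  have "(LINT x|lebesgue. shell_bump x * \<Phi> x) \<noteq> 0"
  proof
    assume "(LINT x|lebesgue. shell_bump x * \<Phi> x) = 0"
    then have "AE x in lebesgue. shell_bump x * \<Phi> x = 0"
      using integral_nonneg_eq_0_iff_AE[OF c(2)] nn by simp
    then have zero: "shell_bump x * \<Phi> x = 0" for x
      by (intro AE_zero_imp_zero[OF open_UNIV c(1)]) auto
    \<comment> \<open>An interior point of the shell, because \<open>op_L_cong\<close> compares
      functions on an open set.\<close>
    obtain y where y: "N y = 3 / 2" using exists_N_eq[of "3 / 2"] by auto
    have "open ({x. 1 < N x} \<inter> {x. N x < 2})" by (intro open_Int open_N_less)
    then have "L_adj \<Phi> y = L_adj (\<lambda>_. 0) y"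
    proof (rule op_L_cong)
      show "y \<in> {x. 1 < N x} \<inter> {x. N x < 2}" using y by simp
      show "\<Phi> x = 0" if "x \<in> {x. 1 < N x} \<inter> {x. N x < 2}" for x
        using zero[of x] that by (simp add: shell_bump_eq_1)
    qed
    moreover have "L_adj \<Phi> y = periodize (g + 2) (L_adj \<phi>) y"
      unfolding \<Phi>_def L_adj_dyadic_sum[OF \<phi>]
      by (rule periodize_eq[symmetric, OF m(3), of 0]) (auto simp: y)
    ultimately show False using neg[of y] y by simp
  qed
  moreover have "0 \<le> (LINT x|lebesgue. shell_bump x * \<Phi> x)"
    by (intro Bochner_Integration.integral_nonneg nn)
  ultimately show ?thesis by (simp add: eq)
qed

end

sublocale homogeneous_operator \<subseteq> punctured: function_subspace punctured_tests
  by unfold_locales (rule test_functions_add test_functions_cmult; assumption)+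

section \<open>The separation argument\<close>

context homogeneous_operator
begin

text \<open>The shell is a fundamental domain for dilation by 2, and only the periodization enters.
  A linear functional dominated by it is therefore nonnegative, homogeneous under dilation by 2, and
  a distribution of order zero off the origin, all at once.\<close>

definition shell_sup :: "real \<Rightarrow> (real ^ 'n \<Rightarrow> real) \<Rightarrow> real" where
  "shell_sup s \<psi> = (SUP x\<in>dyadic_shell. periodize s \<psi> x)"

lemma dyadic_shell_nonempty: "dyadic_shell \<noteq> {}"
proof -
  obtain x where "N x = 1" using exists_N_eq[of 1] by auto
  then have "x \<in> dyadic_shell" by simp
  then show ?thesis by blast
qed

lemma periodize_le_shell_sup:
  assumes "\<psi> \<in> punctured_tests" "0 \<le> s" "x \<in> dyadic_shell"
  shows "periodize s \<psi> x \<le> shell_sup s \<psi>"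
proof -
  obtain m where m: "dyadic_support m \<psi>" using dyadic_support_test[OF assms(1)] .
  obtain B where B: "\<And>x. \<bar>\<psi> x\<bar> \<le> B" using test_functions_bounded[OF assms(1)] by metis
  have "periodize s \<psi> y \<le> (2 * real m + 1) * (dyad (int m) powr s * B)" if "y \<in> dyadic_shell" for y
    using periodize_bound[OF m B assms(2), of y] that by (simp add: abs_le_iff)
  then show ?thesis
    unfolding shell_sup_def by (intro cSUP_upper[OF assms(3)] bdd_aboveI2)
qed

lemma shell_sup_le: "(\<And>x. x \<in> dyadic_shell \<Longrightarrow> periodize s \<psi> x \<le> c) \<Longrightarrow> shell_sup s \<psi> \<le> c"
  unfolding shell_sup_def by (rule cSUP_least[OF dyadic_shell_nonempty])

lemma dyadic_shell_nonzero: "x \<in> dyadic_shell \<Longrightarrow> x \<noteq> 0"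
  by auto

lemma shell_sup_add:
  assumes "\<phi> \<in> punctured_tests" "\<psi> \<in> punctured_tests" "0 \<le> s"
  shows "shell_sup s (\<lambda>x. \<phi> x + \<psi> x) \<le> shell_sup s \<phi> + shell_sup s \<psi>"
proof (rule shell_sup_le)
  fix x assume x: "x \<in> dyadic_shell"
  show "periodize s (\<lambda>x. \<phi> x + \<psi> x) x \<le> shell_sup s \<phi> + shell_sup s \<psi>"
    unfolding periodize_add[OF assms(1,2) dyadic_shell_nonzero[OF x]]
    by (intro add_mono periodize_le_shell_sup assms x)
qed

lemma shell_sup_cmult:
  assumes "\<psi> \<in> punctured_tests" "0 \<le> s" "0 \<le> c"
  shows "shell_sup s (\<lambda>x. c * \<psi> x) \<le> c * shell_sup s \<psi>"
proof (rule shell_sup_le)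
  fix x assume x: "x \<in> dyadic_shell"
  show "periodize s (\<lambda>x. c * \<psi> x) x \<le> c * shell_sup s \<psi>"
    unfolding periodize_cmult by (intro mult_left_mono periodize_le_shell_sup assms x)
qed

lemma shell_sup_zero: "shell_sup s (\<lambda>x. 0) = 0"
  unfolding shell_sup_def periodize_def using dyadic_shell_nonempty by simp

text \<open>The tests with nonpositive pairing form a convex cone \<open>D\<close>. By
  \<open>pairing_pos\<close> no \<open>L_adj \<phi>\<close> with \<phi> in \<open>D\<close> has a
  negative \<open>shell_sup\<close>, so the images of the cone can be separated from the functions
  with negative \<open>shell_sup\<close>.\<close>

lemma exists_positive_functional:
  assumes g: "0 < g" "3 * g + 2 < Q"
  obtains T where "\<And>\<phi> \<psi>. \<phi> \<in> punctured_tests \<Longrightarrow> \<psi> \<in> punctured_tests \<Longrightarrow> T (\<lambda>x. \<phi> x + \<psi> x) = T \<phi> + T \<psi>"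
    and "\<And>\<phi> c. \<phi> \<in> punctured_tests \<Longrightarrow> T (\<lambda>x. c * \<phi> x) = c * T \<phi>"
    and "\<And>\<phi>. \<phi> \<in> punctured_tests \<Longrightarrow> T \<phi> \<le> shell_sup (g + 2) \<phi>"
    and "\<And>\<phi>. \<phi> \<in> punctured_tests \<Longrightarrow> (LINT x|lebesgue. periodize (Q - g) shell_bump x * \<phi> x) \<le> 0 \<Longrightarrow> 0 \<le> T (L_adj \<phi>)"
proof -
  let ?q = "shell_sup (g + 2)"
  let ?F = "\<lambda>\<phi>. LINT x|lebesgue. periodize (Q - g) shell_bump x * \<phi> x"
  define D where "D = {\<phi> \<in> punctured_tests. ?F \<phi> \<le> 0}"
  have g2: "0 \<le> g + 2" using g by simp
  have fc: "continuous_on (- {0}) (periodize (Q - g) shell_bump)"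
    by (rule Ck_on_continuous[OF smooth_onD[OF smooth_periodize[OF shell_bump_test]]])
  have D0: "(\<lambda>x. 0) \<in> D" by (simp add: D_def test_functions_zero)
  have L: "L_adj \<phi> \<in> punctured_tests" if "\<phi> \<in> D" for \<phi>
    using that adj.test_functions_op_L by (simp add: D_def)
  have D_add: "(\<lambda>x. \<phi> x + \<psi> x) \<in> D" if "\<phi> \<in> D" "\<psi> \<in> D" for \<phi> \<psi>
    using that punctured_pairing(2)[OF fc, of \<phi>] punctured_pairing(2)[OF fc, of \<psi>]
    by (auto simp: D_def distrib_left intro: test_functions_add)
  have D_cmult: "(\<lambda>x. c * \<phi> x) \<in> D" if "\<phi> \<in> D" "0 \<le> c" for \<phi> c
    using that by (auto simp: D_def mult.left_commute mult_nonneg_nonpos intro: test_functions_cmult)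
  have L_add: "L_adj (\<lambda>x. \<phi> x + \<psi> x) = (\<lambda>x. L_adj \<phi> x + L_adj \<psi> x)" if "\<phi> \<in> D" "\<psi> \<in> D" for \<phi> \<psi>
    using that by (intro ext adj.op_L_add[OF open_UNIV]) (auto simp: D_def intro: test_functions_Ck)
  have L_cmult: "L_adj (\<lambda>x. c * \<phi> x) = (\<lambda>x. c * L_adj \<phi> x)" if "\<phi> \<in> D" for \<phi> c
    using that by (intro ext adj.op_L_cmult[OF open_UNIV]) (auto simp: D_def intro: test_functions_Ck)
  have qL: "0 \<le> ?q (L_adj \<phi>)" if "\<phi> \<in> D" for \<phi>
  proof (rule ccontr)
    assume "\<not> 0 \<le> ?q (L_adj \<phi>)"
    then have "periodize (g + 2) (L_adj \<phi>) x < 0" if "x \<in> dyadic_shell" for x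
      using periodize_le_shell_sup[OF L[OF \<open>\<phi> \<in> D\<close>] g2 that] by linarith
    then have "0 < ?F \<phi>" using pairing_pos[OF g] \<open>\<phi> \<in> D\<close> by (simp add: D_def)
    with \<open>\<phi> \<in> D\<close> show False by (simp add: D_def)
  qed
  \<comment> \<open>A linear functional below \<open>P\<close> is below \<open>?q\<close> (take
    \<phi> = 0) and nonpositive at \<open>- L_adj \<phi>\<close> for \<phi> in \<open>D\<close>
    (take \<psi> = \<open>- L_adj \<phi>\<close>). That the infimum is finite rests on
    \<open>qL\<close>.\<close>
  define P where "P \<psi> = (INF \<phi>\<in>D. ?q (\<lambda>x. \<psi> x + L_adj \<phi> x))" for \<psi>
  have lb: "- ?q (\<lambda>x. - \<psi> x) \<le> ?q (\<lambda>x. \<psi> x + L_adj \<phi> x)" if \<psi>: "\<psi> \<in> punctured_tests" and \<phi>: "\<phi> \<in> D" for \<phi> \<psi>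
  proof -
    have "0 \<le> ?q (\<lambda>x. (\<psi> x + L_adj \<phi> x) + - \<psi> x)" using qL[OF \<phi>] by simp
    also have "\<dots> \<le> ?q (\<lambda>x. \<psi> x + L_adj \<phi> x) + ?q (\<lambda>x. - \<psi> x)"
      by (intro shell_sup_add g2 test_functions_add test_functions_minus \<psi> L \<phi>)
    finally show ?thesis by simp
  qed
  have P_le: "P \<psi> \<le> ?q (\<lambda>x. \<psi> x + L_adj \<phi> x)" if "\<psi> \<in> punctured_tests" "\<phi> \<in> D" for \<phi> \<psi>
    unfolding P_def by (rule cINF_lower[OF bdd_belowI2[OF lb[OF that(1)]] that(2)])
  have P_ge: "c \<le> P \<psi>" if "\<And>\<phi>. \<phi> \<in> D \<Longrightarrow> c \<le> ?q (\<lambda>x. \<psi> x + L_adj \<phi> x)" for c \<psi>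
    unfolding P_def by (rule cINF_greatest) (use D0 that in auto)
  have P_q: "P \<psi> \<le> ?q \<psi>" if "\<psi> \<in> punctured_tests" for \<psi>
    using P_le[OF that D0] by simp
  have "punctured.sublinear P"
  proof (rule punctured.sublinearI)
    fix \<phi> \<psi> assume \<phi>: "\<phi> \<in> punctured_tests" and \<psi>: "\<psi> \<in> punctured_tests"
    have *: "P (\<lambda>x. \<phi> x + \<psi> x) \<le> ?q (\<lambda>x. \<phi> x + L_adj \<phi>' x) + ?q (\<lambda>x. \<psi> x + L_adj \<psi>' x)"
      if "\<phi>' \<in> D" "\<psi>' \<in> D" for \<phi>' \<psi>'
    proof -
      have "P (\<lambda>x. \<phi> x + \<psi> x) \<le> ?q (\<lambda>x. (\<phi> x + \<psi> x) + L_adj (\<lambda>x. \<phi>' x + \<psi>' x) x)"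
        by (intro P_le test_functions_add \<phi> \<psi> D_add that)
      also have "(\<lambda>x. (\<phi> x + \<psi> x) + L_adj (\<lambda>x. \<phi>' x + \<psi>' x) x) = (\<lambda>x. (\<phi> x + L_adj \<phi>' x) + (\<psi> x + L_adj \<psi>' x))"
        by (simp add: L_add[OF that] fun_eq_iff)
      also have "?q \<dots> \<le> ?q (\<lambda>x. \<phi> x + L_adj \<phi>' x) + ?q (\<lambda>x. \<psi> x + L_adj \<psi>' x)"
        by (intro shell_sup_add g2 test_functions_add \<phi> \<psi> L that)
      finally show ?thesis .
    qed
    have "P (\<lambda>x. \<phi> x + \<psi> x) - ?q (\<lambda>x. \<psi> x + L_adj \<psi>' x) \<le> P \<phi>" if "\<psi>' \<in> D" for \<psi>'
      by (rule P_ge) (use *[OF _ that] in \<open>force simp: algebra_simps\<close>)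
    then have "P (\<lambda>x. \<phi> x + \<psi> x) - P \<phi> \<le> P \<psi>"
      by (intro P_ge) (force simp: algebra_simps)
    then show "P (\<lambda>x. \<phi> x + \<psi> x) \<le> P \<phi> + P \<psi>" by simp
  next
    fix \<psi> and c :: real assume \<psi>: "\<psi> \<in> punctured_tests" and c: "0 < c"
    have "P (\<lambda>x. c * \<psi> x) / c \<le> P \<psi>"
    proof (rule P_ge)
      fix \<phi> assume \<phi>: "\<phi> \<in> D"
      have "P (\<lambda>x. c * \<psi> x) \<le> ?q (\<lambda>x. c * \<psi> x + L_adj (\<lambda>x. c * \<phi> x) x)"
        using c by (intro P_le test_functions_cmult \<psi> D_cmult \<phi>) simp
      also have "(\<lambda>x. c * \<psi> x + L_adj (\<lambda>x. c * \<phi> x) x) = (\<lambda>x. c * (\<psi> x + L_adj \<phi> x))"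
        by (simp add: L_cmult[OF \<phi>] fun_eq_iff algebra_simps)
      also have "?q \<dots> \<le> c * ?q (\<lambda>x. \<psi> x + L_adj \<phi> x)"
        using c by (intro shell_sup_cmult g2 test_functions_add \<psi> L \<phi>) simp
      finally show "P (\<lambda>x. c * \<psi> x) / c \<le> ?q (\<lambda>x. \<psi> x + L_adj \<phi> x)" using c by (simp add: field_simps)
    qed
    then show "P (\<lambda>x. c * \<psi> x) \<le> c * P \<psi>" using c by (simp add: field_simps)
  next
    show "P (\<lambda>x. 0) = 0"
    proof (rule antisym)
      show "P (\<lambda>x. 0) \<le> 0" using P_q[OF test_functions_zero] by (simp add: shell_sup_zero)
      show "0 \<le> P (\<lambda>x. 0)" by (rule P_ge) (simp add: qL)
    qed
  qed
  then obtain T where T: "\<And>\<phi> \<psi>. \<phi> \<in> punctured_tests \<Longrightarrow> \<psi> \<in> punctured_tests \<Longrightarrow> T (\<lambda>x. \<phi> x + \<psi> x) = T \<phi> + T \<psi>"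
    "\<And>\<phi> c. \<phi> \<in> punctured_tests \<Longrightarrow> T (\<lambda>x. c * \<phi> x) = c * T \<phi>"
    and T_le: "\<And>\<phi>. \<phi> \<in> punctured_tests \<Longrightarrow> T \<phi> \<le> P \<phi>"
    using punctured.exists_linear_below[of P] by blast
  show thesis
  proof (rule that[OF T])
    show "T \<phi> \<le> ?q \<phi>" if "\<phi> \<in> punctured_tests" for \<phi>
      using T_le[OF that] P_q[OF that] by linarith
    fix \<phi> assume "\<phi> \<in> punctured_tests" "?F \<phi> \<le> 0"
    then have \<phi>: "\<phi> \<in> D" by (simp add: D_def)
    have "T (\<lambda>x. - 1 * L_adj \<phi> x) \<le> ?q (\<lambda>x. - 1 * L_adj \<phi> x + L_adj \<phi> x)"
      by (rule order_trans[OF T_le P_le]) (use L[OF \<phi>] \<phi> in \<open>auto intro: test_functions_minus\<close>)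
    also have "\<dots> = 0" by (simp add: shell_sup_zero)
    finally show "0 \<le> T (L_adj \<phi>)" unfolding T(2)[OF L[OF \<phi>]] by simp
  qed
qed

section \<open>From the functional to a smooth supersolution\<close>

lemma shell_sup_nonpos: "(\<And>x. \<psi> x \<le> 0) \<Longrightarrow> shell_sup s \<psi> \<le> 0"
  by (rule shell_sup_le, unfold periodize_def) (auto intro!: sum_nonpos mult_nonneg_nonpos)

text \<open>Sign, equation and homogeneity are proved for the functional first and passed to its
  smooth density by \<open>fundamental_lemma\<close> and its one-sided form.\<close>

lemma exists_homogeneous_supersolution:
  assumes hypo: "hypoelliptic A b" and g: "0 < g" "3 * g + 2 < Q"
  obtains v where "smooth_on (- {0}) v" "\<And>x. x \<noteq> 0 \<Longrightarrow> 0 \<le> v x" "\<And>x. x \<noteq> 0 \<Longrightarrow> op_L A b v x \<le> 0"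
    and "\<And>x. x \<noteq> 0 \<Longrightarrow> v (\<delta> 2 x) = 2 powr (- (Q - 2 - g)) * v x" "\<exists>x. x \<noteq> 0 \<and> 0 < v x"
proof -
  obtain T where T_add: "\<And>\<phi> \<psi>. \<phi> \<in> punctured_tests \<Longrightarrow> \<psi> \<in> punctured_tests \<Longrightarrow> T (\<lambda>x. \<phi> x + \<psi> x) = T \<phi> + T \<psi>"
    and T_cmult: "\<And>\<phi> c. \<phi> \<in> punctured_tests \<Longrightarrow> T (\<lambda>x. c * \<phi> x) = c * T \<phi>"
    and T_le: "\<And>\<phi>. \<phi> \<in> punctured_tests \<Longrightarrow> T \<phi> \<le> shell_sup (g + 2) \<phi>"
    and T_L: "\<And>\<phi>. \<phi> \<in> punctured_tests \<Longrightarrow> (LINT x|lebesgue. periodize (Q - g) shell_bump x * \<phi> x) \<le> 0 \<Longrightarrow> 0 \<le> T (L_adj \<phi>)"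
    using exists_positive_functional[OF g] by blast
  have g2: "0 \<le> g + 2" using g by simp
  define f where "f = periodize (Q - g) shell_bump"
  define F where "F \<phi> = (LINT x|lebesgue. f x * \<phi> x)" for \<phi>
  have f_smooth: "smooth_on (- {0}) f" unfolding f_def by (rule smooth_periodize[OF shell_bump_test])
  have fc: "continuous_on (- {0}) f" by (rule Ck_on_continuous[OF smooth_onD[OF f_smooth]])
  have f_nonneg: "0 \<le> f x" for x unfolding f_def by (rule periodize_nonneg_function[OF shell_bump_nonneg])
  have T_minus: "T (\<lambda>x. - \<phi> x) = - T \<phi>" if "\<phi> \<in> punctured_tests" for \<phi>
    using T_cmult[OF that, of "- 1"] by simp
  have T_nonneg: "0 \<le> T \<psi>" if "\<psi> \<in> punctured_tests" "\<And>x. 0 \<le> \<psi> x" for \<psi>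
    using T_le[OF test_functions_minus[OF that(1)]] shell_sup_nonpos[of "\<lambda>x. - \<psi> x" "g + 2"] that(2) T_minus[OF that(1)] by force
  \<comment> \<open>Excludes the zero functional: the term k = 0 alone makes the periodized bump at
    least 1 on the shell.\<close>
  have T_bump: "1 \<le> T shell_bump"
  proof -
    have "shell_sup (g + 2) (\<lambda>x. - shell_bump x) \<le> - 1"
    proof (rule shell_sup_le)
      fix x assume x: "x \<in> dyadic_shell"
      obtain m where m: "dyadic_support m shell_bump" using dyadic_support_test[OF shell_bump_test] .
      have "periodize (g + 2) shell_bump x = (\<Sum>k\<in>{- int m..int m}. dyad k powr (g + 2) * shell_bump (\<delta> (dyad k) x))"
        by (rule periodize_eq[OF m, of 0]) (use x in auto)
      also have "\<dots> \<ge> dyad 0 powr (g + 2) * shell_bump (\<delta> (dyad 0) x)"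
        by (rule member_le_sum) (auto intro!: mult_nonneg_nonneg shell_bump_nonneg)
      finally have "1 \<le> periodize (g + 2) shell_bump x" using x by (simp add: shell_bump_eq_1)
      then show "periodize (g + 2) (\<lambda>x. - shell_bump x) x \<le> - 1"
        using periodize_cmult[of "g + 2" "- 1" shell_bump x] by simp
    qed
    then show ?thesis using T_le[OF test_functions_minus[OF shell_bump_test]] T_minus[OF shell_bump_test] by simp
  qed
  have F_add: "F (\<lambda>x. \<phi> x + c * \<psi> x) = F \<phi> + c * F \<psi>" if "\<phi> \<in> punctured_tests" "\<psi> \<in> punctured_tests" for \<phi> \<psi> c
    using punctured_pairing(2)[OF fc that(1)] punctured_pairing(2)[OF fc that(2)]
    by (simp add: F_def distrib_left mult.left_commute[of _ c])
  have F_minus: "F (\<lambda>x. - \<phi> x) = - F \<phi>" for \<phi> by (simp add: F_def)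
  have TL_add: "T (L_adj (\<lambda>x. \<phi> x + c * \<psi> x)) = T (L_adj \<phi>) + c * T (L_adj \<psi>)"
    if "\<phi> \<in> punctured_tests" "\<psi> \<in> punctured_tests" for \<phi> \<psi> c
  proof -
    have "L_adj (\<lambda>x. \<phi> x + c * \<psi> x) = (\<lambda>x. L_adj \<phi> x + c * L_adj \<psi> x)"
      using adj.op_L_add[OF open_UNIV test_functions_Ck[OF that(1)] test_functions_Ck[OF test_functions_cmult[OF that(2)]]]
        adj.op_L_cmult[OF open_UNIV test_functions_Ck[OF that(2)]] by (intro ext) simp
    then show ?thesis
      using T_add T_cmult adj.test_functions_op_L[OF that(1)] adj.test_functions_op_L[OF that(2)]
      by (simp add: test_functions_cmult)
  qed
  have TL_minus: "T (L_adj (\<lambda>x. - \<psi> x)) = - T (L_adj \<psi>)" if "\<psi> \<in> punctured_tests" for \<psi>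
  proof -
    have "L_adj (\<lambda>x. - \<psi> x) = (\<lambda>x. - L_adj \<psi> x)"
      using adj.op_L_cmult[OF open_UNIV test_functions_Ck[OF that] UNIV_I, of "- 1"] by (intro ext) simp
    then show ?thesis using T_minus[OF adj.test_functions_op_L[OF that]] by simp
  qed
  have F_bump: "0 < F shell_bump"
  proof -
    obtain m where m: "dyadic_support m shell_bump" using dyadic_support_test[OF shell_bump_test] .
    have "F shell_bump \<noteq> 0"
    proof
      assume "F shell_bump = 0"
      then have "AE x in lebesgue. f x * shell_bump x = 0"
        using integral_nonneg_eq_0_iff_AE[OF punctured_pairing(2)[OF fc shell_bump_test]] f_nonneg shell_bump_nonneg
        by (simp add: F_def)
      then have zero: "f x * shell_bump x = 0" for x
        by (intro AE_zero_imp_zero[OF open_UNIV punctured_pairing(1)[OF fc shell_bump_test]]) auto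
      obtain y where y: "N y = 1" using exists_N_eq[of 1] by auto
      have "f y = (\<Sum>k\<in>{- int m..int m}. dyad k powr (Q - g) * shell_bump (\<delta> (dyad k) y))"
        unfolding f_def by (rule periodize_eq[OF m, of 0]) (use y in auto)
      also have "\<dots> \<ge> dyad 0 powr (Q - g) * shell_bump (\<delta> (dyad 0) y)"
        by (rule member_le_sum) (auto intro!: mult_nonneg_nonneg shell_bump_nonneg)
      finally show False using zero[of y] y by (simp add: shell_bump_eq_1)
    qed
    moreover have "0 \<le> F shell_bump"
      unfolding F_def by (intro Bochner_Integration.integral_nonneg mult_nonneg_nonneg f_nonneg shell_bump_nonneg)
    ultimately show ?thesis by simp
  qed
  define c where "c = - T (L_adj shell_bump) / F shell_bump"
  \<comment> \<open>A linear functional that is nonnegative on the half-space F \<le> 0 vanishes on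
    the kernel of F and is thus a multiple of F. The number \<open>r\<close> below projects
    \<open>\<phi>\<close> to the kernel along \<open>shell_bump\<close>.\<close>
  have TF: "T (L_adj \<phi>) = - c * F \<phi>" if \<phi>: "\<phi> \<in> punctured_tests" for \<phi>
  proof -
    define r where "r = - F \<phi> / F shell_bump"
    let ?\<psi> = "\<lambda>x. \<phi> x + r * shell_bump x"
    have \<psi>: "?\<psi> \<in> punctured_tests" by (intro test_functions_add test_functions_cmult \<phi> shell_bump_test)
    have F\<psi>: "F ?\<psi> = 0" unfolding F_add[OF \<phi> shell_bump_test] using F_bump by (simp add: r_def)
    have F\<psi>': "F (\<lambda>x. - ?\<psi> x) = 0" by (simp only: F_minus F\<psi> minus_zero)
    have "0 \<le> T (L_adj ?\<psi>)" using T_L[OF \<psi>] F\<psi> by (simp add: F_def f_def)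
    moreover have "0 \<le> T (L_adj (\<lambda>x. - ?\<psi> x))"
      using T_L[OF test_functions_minus[OF \<psi>]] F\<psi>' by (simp only: F_def f_def order_refl)
    then have "0 \<le> - T (L_adj ?\<psi>)"
      by (simp only: TL_minus[OF \<psi>])
    ultimately have "T (L_adj ?\<psi>) = 0" by simp
    then have "T (L_adj \<phi>) = - r * T (L_adj shell_bump)" using TL_add[OF \<phi> shell_bump_test, of r] by simp
    then show ?thesis by (simp add: r_def c_def)
  qed
  have c: "0 \<le> c"
  proof -
    have "F (\<lambda>x. - shell_bump x) \<le> 0" using F_bump by (simp add: F_minus)
    then have "0 \<le> T (L_adj (\<lambda>x. - shell_bump x))"
      using T_L[OF test_functions_minus[OF shell_bump_test]] by (simp add: F_def f_def)
    then have "T (L_adj shell_bump) \<le> 0"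
      using TL_minus[OF shell_bump_test] by simp
    then show ?thesis using F_bump by (simp add: c_def divide_nonpos_pos)
  qed
  \<comment> \<open>Both functions have the same periodization, so their difference has
    \<open>shell_sup\<close> at most 0 with either sign.\<close>
  have T_dilate: "T (\<lambda>x. 2 powr (g + 2) * \<psi> (\<delta> 2 x)) = T \<psi>" if \<psi>: "\<psi> \<in> punctured_tests" for \<psi>
  proof -
    let ?\<psi>' = "\<lambda>x. 2 powr (g + 2) * \<psi> (\<delta> 2 x)"
    have \<psi>': "?\<psi>' \<in> punctured_tests" by (intro test_functions_cmult punctured_tests_dilation \<psi>) simp
    have "periodize (g + 2) (\<lambda>x. \<psi> (\<delta> 2 x)) x = periodize (g + 2) \<psi> (\<delta> (dyad 1) x)" for x
      unfolding periodize_def by (simp add: dilation_dilation mult.commute)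
    then have pe: "periodize (g + 2) ?\<psi>' x = periodize (g + 2) \<psi> x" for x
      unfolding periodize_cmult periodize_dilation by (simp add: powr_add[symmetric] del: powr_minus)
    have per: "periodize (g + 2) (\<lambda>x. a * \<psi> x + - a * ?\<psi>' x) x = 0" if "x \<in> dyadic_shell" for a x
      unfolding periodize_add[OF test_functions_cmult[OF \<psi>] test_functions_cmult[OF \<psi>'] dyadic_shell_nonzero[OF that]]
        periodize_cmult[of _ a \<psi>] periodize_cmult[of _ "- a" ?\<psi>'] pe
      by simp
    have "a * T \<psi> - a * T ?\<psi>' \<le> 0" for a
    proof -
      have "a * T \<psi> + - a * T ?\<psi>' = T (\<lambda>x. a * \<psi> x + - a * ?\<psi>' x)"
        by (simp only: T_add[OF test_functions_cmult[OF \<psi>] test_functions_cmult[OF \<psi>']] T_cmult[OF \<psi>] T_cmult[OF \<psi>'])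
      also have "\<dots> \<le> shell_sup (g + 2) (\<lambda>x. a * \<psi> x + - a * ?\<psi>' x)"
        by (intro T_le test_functions_add test_functions_cmult[OF \<psi>] test_functions_cmult[OF \<psi>'])
      also have "\<dots> \<le> 0" by (rule shell_sup_le) (simp only: per order_refl)
      finally show ?thesis by simp
    qed
    from this[of 1] this[of "- 1"] show ?thesis by simp
  qed
  have "distribution_on (- {0}) T"
  proof (rule distribution_onI[OF T_add T_cmult])
    fix K :: "(real ^ 'n) set" assume K: "compact K" "K \<subseteq> - {0}"
    obtain m :: nat where m: "\<And>x. x \<in> K \<Longrightarrow> dyad (- int m) \<le> N x \<and> N x \<le> dyad (int m)"
      using compact_dyadic_shell[OF K] by blast
    have "\<bar>T \<phi>\<bar> \<le> (2 * real m + 1) * dyad (int m) powr (g + 2) * B"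
      if \<phi>: "\<phi> \<in> test_functions K" and B: "\<forall>x. \<bar>\<phi> x\<bar> \<le> B" for \<phi> B
    proof -
      have \<phi>': "\<phi> \<in> punctured_tests" by (rule test_functions_mono[OF \<phi> K(2)])
      have "\<phi> x = 0" if "x \<notin> K" for x using test_functionsE[OF \<phi>] that by (metis subsetD)
      then have supp: "dyadic_support m \<phi>" using m unfolding dyadic_support_def by blast
      have per: "\<bar>periodize (g + 2) \<phi> x\<bar> \<le> (2 * real m + 1) * (dyad (int m) powr (g + 2) * B)" if "x \<in> dyadic_shell" for x
        by (rule periodize_bound[OF supp _ g2]) (use B that in auto)
      have "T \<phi> \<le> (2 * real m + 1) * (dyad (int m) powr (g + 2) * B)"
        by (rule order_trans[OF T_le[OF \<phi>'] shell_sup_le]) (use per in \<open>simp add: abs_le_iff\<close>)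
      moreover have "T (\<lambda>x. - 1 * \<phi> x) \<le> (2 * real m + 1) * (dyad (int m) powr (g + 2) * B)"
        by (rule order_trans[OF T_le[OF test_functions_cmult[OF \<phi>']] shell_sup_le], unfold periodize_cmult)
          (use per in \<open>simp add: abs_le_iff\<close>)
      ultimately show ?thesis unfolding T_cmult[OF \<phi>'] by (simp add: abs_le_iff mult.assoc)
    qed
    then show "\<exists>C. \<forall>\<phi>\<in>test_functions K. \<forall>B. (\<forall>x. \<bar>\<phi> x\<bar> \<le> B) \<longrightarrow> \<bar>T \<phi>\<bar> \<le> C * B" by blast
  qed
  have set_int: "(LINT x:- {0}|lebesgue. w x * \<phi> x) = (LINT x|lebesgue. w x * \<phi> x)"
    if "\<phi> \<in> punctured_tests" for w \<phi> :: "real ^ 'n \<Rightarrow> real"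
  proof -
    have "\<phi> 0 = 0" using test_functionsE[OF that] by (metis ComplD singletonI subsetD)
    then show ?thesis
      unfolding set_lebesgue_integral_def
      by (intro Bochner_Integration.integral_cong refl) (auto simp: indicator_def)
  qed
  have "distribution_smooth_rep (- {0}) (\<lambda>\<phi>. T (op_L_adj A b \<phi>))"
    unfolding distribution_smooth_rep_def
  proof (intro exI[of _ "\<lambda>x. - c * f x"] conjI ballI)
    show "smooth_on (- {0}) (\<lambda>x. - c * f x)"
      by (intro smooth_onI Ck_on_cmult smooth_onD[OF f_smooth]) auto
    fix \<phi> :: "real ^ 'n \<Rightarrow> real" assume \<phi>: "\<phi> \<in> punctured_tests"
    show "T (op_L_adj A b \<phi>) = (LINT x:- {0}|lebesgue. - c * f x * \<phi> x)"
      unfolding set_int[OF \<phi>] op_L_adj_test[OF \<phi>] TF[OF \<phi>] F_def by (simp add: mult.assoc)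
  qed
  with \<open>distribution_on (- {0}) T\<close> have "distribution_smooth_rep (- {0}) T"
    using hypo[unfolded hypoelliptic_def, rule_format, of "- {0}" T] by (auto simp: open_Compl)
  then obtain v where v: "smooth_on (- {0}) v"
    and set_rep: "\<forall>\<phi>\<in>punctured_tests. T \<phi> = (LINT x:- {0}|lebesgue. v x * \<phi> x)"
    unfolding distribution_smooth_rep_def by blast
  have rep: "T \<phi> = (LINT x|lebesgue. v x * \<phi> x)" if "\<phi> \<in> punctured_tests" for \<phi>
    by (rule trans[OF bspec[OF set_rep that] set_int[OF that]])
  have o: "open (- {0 :: real ^ 'n})" by auto
  have vc: "continuous_on (- {0}) v" by (rule Ck_on_continuous[OF smooth_onD[OF v]])
  have "0 \<le> v x" if "x \<noteq> 0" for x
  proof -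
    have "- v x \<le> 0"
    proof (rule fundamental_lemma_nonpos[OF o, of "\<lambda>x. - v x"])
      show "(LINT x|lebesgue. - v x * \<phi> x) \<le> 0" if "\<phi> \<in> punctured_tests" "\<And>x. 0 \<le> \<phi> x" for \<phi>
        using T_nonneg[OF that] rep[OF that(1)] by simp
    qed (use that vc in \<open>auto intro: continuous_intros\<close>)
    then show ?thesis by simp
  qed
  moreover have "op_L A b v x \<le> 0" if "x \<noteq> 0" for x
  proof (rule fundamental_lemma_nonpos[OF o])
    show "continuous_on (- {0}) (op_L A b v)"
      by (rule Ck_on_continuous[OF smooth_onD[OF smooth_op_L[OF o v]]])
    show "x \<in> - {0}" using that by simp
    fix \<phi> :: "real ^ 'n \<Rightarrow> real" assume \<phi>: "\<phi> \<in> punctured_tests" and nn: "\<And>x. 0 \<le> \<phi> x"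
    obtain K where K: "compact K" "K \<subseteq> - {0}" "\<And>x. x \<notin> K \<Longrightarrow> \<phi> x = 0" using test_functionsE[OF \<phi>] by metis
    have "(LINT x|lebesgue. \<phi> x * op_L A b v x) = (LINT x|lebesgue. v x * L_adj \<phi> x)"
      using integration_by_parts(1)[OF divergence_b o smooth_onD[OF v] test_functions_Ck[OF \<phi>] K] by simp
    also have "\<dots> = - c * F \<phi>" using rep[OF adj.test_functions_op_L[OF \<phi>]] TF[OF \<phi>] by simp
    also have "\<dots> \<le> 0"
    proof -
      have "0 \<le> F \<phi>" unfolding F_def by (intro Bochner_Integration.integral_nonneg mult_nonneg_nonneg f_nonneg nn)
      then show ?thesis using c by simp
    qed
    finally show "(LINT x|lebesgue. op_L A b v x * \<phi> x) \<le> 0" by (simp add: mult.commute)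
  qed
  moreover have "v (\<delta> 2 x) = 2 powr (- (Q - 2 - g)) * v x" if "x \<noteq> 0" for x
  proof -
    \<comment> \<open>The weight 2^(g+2) from \<open>T_dilate\<close> meets the Jacobian 2^(-Q); the
      degree -(Q-2-g) of \<open>v\<close> originates here.\<close>
    let ?a = "2 powr (g + 2 - Q)"
    have d: "continuous_on (- {0}) (\<lambda>x. v (\<delta> (1 / 2) x))"
      by (rule continuous_on_compose2[OF vc]) (auto intro: continuous_intros simp: dilation_eq_0_iff)
    have "?a * v (\<delta> (1 / 2) y) - v y = 0" if "y \<noteq> 0" for y
    proof (rule fundamental_lemma[OF o])
      show "continuous_on (- {0}) (\<lambda>y. ?a * v (\<delta> (1 / 2) y) - v y)" by (intro continuous_intros d vc)
      show "y \<in> - {0}" using that by simp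
      fix \<phi> :: "real ^ 'n \<Rightarrow> real" assume \<phi>: "\<phi> \<in> punctured_tests"
      have inv: "\<delta> (1 / 2) (\<delta> 2 x) = x" for x by (subst dilation_dilation) auto
      have e1: "(LINT x|lebesgue. v x * \<phi> (\<delta> 2 x)) = 2 powr (- Q) * (LINT x|lebesgue. v (\<delta> (1 / 2) x) * \<phi> x)"
        using lebesgue_integral_dilation(1)[OF _ borel_measurable_lebesgue_continuous[OF punctured_pairing(1)[OF d \<phi>]], of 2 \<sigma>]
        unfolding inv by simp
      have e2: "2 powr (g + 2) * (LINT x|lebesgue. v x * \<phi> (\<delta> 2 x)) = (LINT x|lebesgue. v x * \<phi> x)"
      proof -
        have t: "(\<lambda>x. \<phi> (\<delta> 2 x)) \<in> punctured_tests" by (rule punctured_tests_dilation[OF \<phi>]) simp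
        show ?thesis using T_dilate[OF \<phi>] unfolding T_cmult[OF t] rep[OF t] rep[OF \<phi>] .
      qed
      have e3: "2 powr (g + 2) * 2 powr (- Q) = ?a" by (simp add: powr_add[symmetric])
      have "?a * (LINT x|lebesgue. v (\<delta> (1 / 2) x) * \<phi> x) = (LINT x|lebesgue. v x * \<phi> x)"
        unfolding e3[symmetric] mult.assoc e1[symmetric] by (rule e2)
      then show "(LINT x|lebesgue. (?a * v (\<delta> (1 / 2) x) - v x) * \<phi> x) = 0"
        using punctured_pairing(2)[OF d \<phi>] punctured_pairing(2)[OF vc \<phi>]
        by (simp add: left_diff_distrib mult.assoc)
    qed
    from this[of "\<delta> 2 x"] that have "v (\<delta> 2 x) = ?a * v x"
      by (simp add: dilation_eq_0_iff dilation_dilation)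
    then show ?thesis by (simp add: algebra_simps)
  qed
  moreover have "\<exists>x. x \<noteq> 0 \<and> 0 < v x"
  proof (rule ccontr)
    assume "\<not> ?thesis"
    then have "v x * shell_bump x \<le> 0" for x
    proof (cases "x = 0")
      case True
      have "shell_bump 0 = 0" using cutoff_eq_1[of \<sigma> 0, OF \<sigma>_pos] by (simp add: shell_bump_def)
      then show ?thesis using True by simp
    next
      case False
      then have "v x \<le> 0" using \<open>\<not> (\<exists>x. x \<noteq> 0 \<and> 0 < v x)\<close> by (auto simp: not_less)
      then show ?thesis using shell_bump_nonneg[of x] by (simp add: mult_nonpos_nonneg)
    qed
    then have "0 \<le> (LINT x|lebesgue. - (v x * shell_bump x))"
      by (intro Bochner_Integration.integral_nonneg) simp
    then have "T shell_bump \<le> 0" unfolding rep[OF shell_bump_test] by simp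
    then show False using T_bump by simp
  qed
  ultimately show thesis using v that by blast
qed

end

section \<open>Sharpness of the exponent\<close>

context homogeneous_operator
begin

text \<open>A bound on one compact shell is carried to all others by powers of 2; the constant
  2^\<gamma> pays for rounding N x down to such a power.\<close>

lemma homogeneous_decay:
  assumes v: "continuous_on (- {0}) v" "\<And>x. x \<noteq> 0 \<Longrightarrow> v (\<delta> 2 x) = 2 powr (- \<gamma>) * v x" and \<gamma>: "0 \<le> \<gamma>"
  obtains C where "0 < C" "\<And>x. x \<noteq> 0 \<Longrightarrow> v x \<le> C * N x powr (- \<gamma>)"
proof -
  let ?K = "{x. N x \<le> 2} \<inter> {x. 1 \<le> N x}"
  have "closed {x. 1 \<le> N x}"
    using continuous_on_hnorm[of \<sigma> UNIV, OF \<sigma>_pos] by (intro closed_Collect_le continuous_intros)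
  then have "compact ?K" by (intro compact_Int_closed compact_hnorm_le \<sigma>_pos)
  moreover have "?K \<subseteq> - {0}" by auto
  ultimately have "bounded (v ` ?K)"
    by (intro compact_imp_bounded compact_continuous_image continuous_on_subset[OF v(1)])
  then obtain B where B: "B > 0" "\<And>x. x \<in> ?K \<Longrightarrow> \<bar>v x\<bar> \<le> B" by (auto simp: bounded_pos)
  have pos: "v (\<delta> (dyad (int k)) x) = dyad (int k) powr (- \<gamma>) * v x" if "x \<noteq> 0" for k :: nat and x
  proof (induction k)
    case (Suc k)
    have "\<delta> (dyad (int (Suc k))) x = \<delta> 2 (\<delta> (dyad (int k)) x)"
      by (subst dilation_dilation) (auto simp: powr_add)
    then have "v (\<delta> (dyad (int (Suc k))) x) = 2 powr (- \<gamma>) * (dyad (int k) powr (- \<gamma>) * v x)"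
      using v(2)[of "\<delta> (dyad (int k)) x"] that Suc by (simp add: dilation_eq_0_iff)
    then show ?case by (simp add: powr_add powr_mult)
  qed simp
  have all: "v (\<delta> (dyad k) x) = dyad k powr (- \<gamma>) * v x" if "x \<noteq> 0" for k x
  proof (cases "0 \<le> k")
    case True
    then show ?thesis using pos[OF that, of "nat k"] by simp
  next
    case False
    let ?y = "\<delta> (dyad k) x"
    have "\<delta> (dyad (- k)) ?y = x" by (subst dilation_dilation) (auto simp: powr_add[symmetric])
    moreover have "?y \<noteq> 0" using that by (simp add: dilation_eq_0_iff)
    ultimately have "v x = dyad (- k) powr (- \<gamma>) * v ?y" using pos[of ?y "nat (- k)"] False by simp
    moreover have "dyad k powr (- \<gamma>) * dyad (- k) powr (- \<gamma>) = 1"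
      by (simp only: powr_powr powr_add[symmetric]) simp
    ultimately show ?thesis by (simp only: mult.assoc[symmetric] mult_1_left)
  qed
  show thesis
  proof (rule that[of "2 powr \<gamma> * B"])
    fix x :: "real ^ 'n" assume x: "x \<noteq> 0"
    then have N: "0 < N x" by (simp add: hnorm_pos_iff)
    then obtain j where j: "dyad j \<le> N x" "N x < dyad (j + 1)" using exists_dyad_bracket by metis
    let ?y = "\<delta> (dyad (- j)) x"
    have xy: "x = \<delta> (dyad j) ?y" by (subst dilation_dilation) (auto simp: powr_add[symmetric])
    have "N x = dyad j * N ?y" by (subst (1) xy) (rule N_\<delta>, simp)
    moreover have "N x < dyad j * 2" using j(2) by (simp add: powr_add)
    ultimately have "dyad j * 1 \<le> dyad j * N ?y" "dyad j * N ?y < dyad j * 2" using j(1) by simp_all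
    then have "1 \<le> N ?y" "N ?y < 2"
      by (simp_all only: mult_le_cancel_left_pos mult_less_cancel_left_pos powr_gt_zero)
    then have "\<bar>v ?y\<bar> \<le> B" by (intro B) simp
    moreover have "?y \<noteq> 0" using x by (simp add: dilation_eq_0_iff)
    then have "v x = dyad j powr (- \<gamma>) * v ?y" using all[of ?y j] xy by simp
    ultimately have "v x \<le> dyad j powr (- \<gamma>) * B" by (simp add: mult_left_mono abs_le_iff)
    also have "dyad j powr (- \<gamma>) \<le> (N x / 2) powr (- \<gamma>)"
      using \<open>N x < dyad j * 2\<close> N \<gamma> by (intro powr_mono2') auto
    then have "dyad j powr (- \<gamma>) * B \<le> (N x / 2) powr (- \<gamma>) * B" using B(1) by (intro mult_right_mono) auto
    also have "\<dots> = 2 powr \<gamma> * B * N x powr (- \<gamma>)"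
      using N by (simp add: powr_divide powr_minus field_simps)
    finally show "v x \<le> 2 powr \<gamma> * B * N x powr (- \<gamma>)" .
  qed (use B in simp)
qed

text \<open>Outside the unit ball the layer 2^k \<le> N x < 2^(k+1) is covered by the full ball of
  radius 2^(k+1), whose volume is known. The integrals of these majorants form a geometric series of
  ratio 2^(Q - \<gamma> p).\<close>

lemma integrable_decay:
  assumes w: "w \<in> borel_measurable lebesgue" "\<And>x. 0 \<le> w x" "\<And>x. w x \<le> 1" "\<And>x. x \<noteq> 0 \<Longrightarrow> w x \<le> C * N x powr (- \<gamma>)"
    and C: "0 < C" and \<gamma>: "0 < \<gamma>" and p: "0 < p" "Q < \<gamma> * p"
  shows "integrable lebesgue (\<lambda>x. w x powr p)"
proof -
  define a where "a k = (C * dyad (int k) powr (- \<gamma>)) powr p" for k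
  let ?h = "\<lambda>k x. a k * indicat_real {x. N x \<le> dyad (int k + 1)} x"
  have a: "a k = C powr p * (2 powr (- \<gamma> * p)) ^ k" for k
    using C by (simp add: a_def powr_mult powr_powr powr_realpow[symmetric] algebra_simps)
  have sa: "summable a"
    unfolding a using \<gamma> p by (intro summable_mult summable_geometric) (simp add: powr_less_one)
  have int: "integrable lebesgue (?h k)" for k by (intro integrable_mult_right integrable_indicator_ball)
  have ih: "(LINT x|lebesgue. norm (?h k x)) = (C powr p * 2 powr Q * unit_volume) * (2 powr (Q - \<gamma> * p)) ^ k" for k
  proof -
    have "(LINT x|lebesgue. norm (?h k x)) = (LINT x|lebesgue. ?h k x)"
      by (intro Bochner_Integration.integral_cong refl) (simp add: a_def indicator_def)
    also have "\<dots> = a k * (dyad (int k + 1) powr Q * unit_volume)"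
      by (simp only: integral_mult_right_zero integral_indicator_ball[of "dyad (int k + 1)"] powr_gt_zero)
    also have "dyad (int k + 1) powr Q = 2 powr Q * (2 powr Q) ^ k"
      by (simp add: powr_powr powr_add[symmetric] powr_realpow[symmetric] algebra_simps)
    also have "a k * (2 powr Q * (2 powr Q) ^ k * unit_volume)
        = (C powr p * 2 powr Q * unit_volume) * (2 powr (- \<gamma> * p) * 2 powr Q) ^ k"
      by (simp add: a power_mult_distrib)
    also have "2 powr (- \<gamma> * p) * 2 powr Q = 2 powr (Q - \<gamma> * p)" by (simp add: powr_add[symmetric])
    finally show ?thesis .
  qed
  have sh: "summable (\<lambda>k. LINT x|lebesgue. norm (?h k x))"
    unfolding ih using p by (intro summable_mult summable_geometric) (simp add: powr_less_one)
  have sx: "summable (\<lambda>k. norm (?h k x))" for x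
    by (rule summable_comparison_test[OF _ sa]) (auto simp: a_def indicator_def)
  have single_le: "f k \<le> suminf f" if "summable f" "\<And>k. 0 \<le> f k" for f :: "nat \<Rightarrow> real" and k
    using sum_le_suminf[OF that(1), of "{k}"] that(2) by simp
  have H: "integrable lebesgue (\<lambda>x. \<Sum>k. ?h k x)"
    by (rule integrable_suminf[OF int _ sh]) (intro AE_I2 sx)
  show ?thesis
  proof (rule Bochner_Integration.integrable_bound)
    show "integrable lebesgue (\<lambda>x. indicat_real {x. N x \<le> 1} x + (\<Sum>k. ?h k x))"
      by (intro Bochner_Integration.integrable_add integrable_indicator_ball H)
    show "(\<lambda>x. w x powr p) \<in> borel_measurable lebesgue" using w(1) by simp
    show "AE x in lebesgue. norm (w x powr p) \<le> norm (indicat_real {x. N x \<le> 1} x + (\<Sum>k. ?h k x))"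
    proof (rule AE_I2)
      fix x
      have h0: "0 \<le> ?h k x" for k by (simp add: a_def indicator_def)
      have S: "?h k x \<le> (\<Sum>k. ?h k x)" for k
        by (rule single_le[OF summable_norm_cancel[OF sx] h0])
      have S0: "0 \<le> (\<Sum>k. ?h k x)" using h0 S[of 0] by (rule order_trans)
      have "w x powr p \<le> indicat_real {x. N x \<le> 1} x + (\<Sum>k. ?h k x)"
      proof (cases "N x \<le> 1")
        case True
        have "w x powr p \<le> 1" using powr_mono2[of p "w x" 1] w(2,3)[of x] p(1) by simp
        then show ?thesis using True S0 by simp
      next
        case False
        then have "x \<noteq> 0" by auto
        obtain j where j: "dyad j \<le> N x" "N x < dyad (j + 1)" using exists_dyad_bracket[of "N x"] False by auto
        have "dyad 0 < dyad (j + 1)" using j(2) False by simp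
        then have "0 < j + 1" unfolding dyad_less_iff .
        then obtain k where k: "j = int k" by (metis zle_add1_eq_le nonneg_int_cases)
        have "w x \<le> C * dyad (int k) powr (- \<gamma>)"
        proof -
          have "N x powr (- \<gamma>) \<le> dyad j powr (- \<gamma>)" using j(1) \<gamma> by (intro powr_mono2') auto
          then have "C * N x powr (- \<gamma>) \<le> C * dyad j powr (- \<gamma>)" using C by (intro mult_left_mono) auto
          then show ?thesis using w(4)[OF \<open>x \<noteq> 0\<close>] by (simp add: k)
        qed
        then have "w x powr p \<le> a k" unfolding a_def using w(2)[of x] p(1) by (intro powr_mono2) auto
        also have "a k = ?h k x" using j(2) by (simp add: k)
        also have "\<dots> \<le> (\<Sum>k. ?h k x)" by (rule S)
        finally show ?thesis using False by simp
      qed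
      then show "norm (w x powr p) \<le> norm (indicat_real {x. N x \<le> 1} x + (\<Sum>k. ?h k x))" by simp
    qed
  qed
qed

section \<open>Removability of the origin and the final subsolution\<close>

lemma carre_du_champ_commute: "carre_du_champ A v w x = carre_du_champ A w v x"
  unfolding carre_du_champ_def by (subst sum.swap) (simp add: symm_A[of x] mult.commute mult.left_commute)

text \<open>The quadratic form of \<open>A\<close> is nonnegative at the sum and at the difference
  of the two gradients.\<close>

lemma carre_du_champ_le: "2 * \<bar>carre_du_champ A v w x\<bar> \<le> carre_du_champ A v v x + carre_du_champ A w w x"
proof -
  have "0 \<le> (A x *v (grad v x + c *\<^sub>R grad w x)) \<bullet> (grad v x + c *\<^sub>R grad w x)" for c by (rule nonneg_A)
  then have "0 \<le> carre_du_champ A v v x + 2 * c * carre_du_champ A v w x + c * c * carre_du_champ A w w x" for c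
    using carre_du_champ_commute[of v w x]
    by (simp add: carre_du_champ_eq matrix_vector_right_distrib matrix_vector_mult_scaleR inner_add_left
        inner_add_right inner_commute algebra_simps)
  from this[of 1] this[of "- 1"] show ?thesis by (simp add: abs_if)
qed

text \<open>By the product rule twice the carre du champ of \<open>\<phi>\<close> is the image of
  \<phi>^2 minus 2 \<phi> \<open>L_adj \<phi>\<close>, a test function.\<close>

lemma carre_du_champ_bounded:
  assumes "\<phi> \<in> test_functions \<Omega>"
  obtains B where "0 < B" "\<And>x. carre_du_champ A \<phi> \<phi> x \<le> B"
proof -
  note C = test_functions_Ck[OF assms, of 2]
  have "(\<lambda>x. L_adj (\<lambda>y. \<phi> y * \<phi> y) x + (- 2) * (\<phi> x * L_adj \<phi> x)) \<in> test_functions \<Omega>"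
    by (intro test_functions_add test_functions_cmult adj.test_functions_op_L test_functions_mult
        test_functions_smooth[OF assms] assms)
  then obtain B where B: "0 < B" "\<And>x. \<bar>L_adj (\<lambda>y. \<phi> y * \<phi> y) x + (- 2) * (\<phi> x * L_adj \<phi> x)\<bar> \<le> B"
    by (rule test_functions_bounded) blast
  have "2 * carre_du_champ A \<phi> \<phi> x \<le> B" for x
    using B(2)[of x] adj.op_L_mult[OF open_UNIV C C UNIV_I, of x] by simp
  then have "carre_du_champ A \<phi> \<phi> x \<le> B" for x using B(1) by (smt (verit))
  with B(1) that show thesis by blast
qed

text \<open>The origin has zero capacity: \<open>\<delta>\<^bsub>2^m\<^esub>\<close> multiplies second order terms by \<open>4\<^sup>m\<close> and volumes by \<open>2\<^bsup>-mQ\<^esup>\<close>.\<close>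

lemma shrinking_cutoff_tendsto_0:
  assumes \<phi>: "\<phi> \<in> test_functions UNIV" and Q: "2 < Q"
  shows "(\<lambda>m. LINT x|lebesgue. \<bar>L_adj (\<lambda>x. \<phi> x * cutoff (\<delta> (2 ^ m) x)) x\<bar>) \<longlonglongrightarrow> 0"
proof -
  obtain B1 where B1: "0 < B1" "\<And>x. \<bar>\<phi> x\<bar> \<le> B1" using test_functions_bounded[OF \<phi>] by blast
  obtain B2 where B2: "0 < B2" "\<And>x. \<bar>L_adj \<phi> x\<bar> \<le> B2"
    using test_functions_bounded[OF adj.test_functions_op_L[OF \<phi>]] by blast
  obtain B3 where B3: "0 < B3" "\<And>x. carre_du_champ A \<phi> \<phi> x \<le> B3" using carre_du_champ_bounded[OF \<phi>] by blast
  obtain B4 where B4: "0 < B4" "\<And>x. \<bar>L_adj cutoff x\<bar> \<le> B4"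
    using test_functions_bounded[OF adj.test_functions_op_L[OF cutoff_test]] by blast
  obtain B5 where B5: "0 < B5" "\<And>x. carre_du_champ A cutoff cutoff x \<le> B5"
    using carre_du_champ_bounded[OF cutoff_test] by blast
  define B where "B = B1 * B4 + B2 + B3 + B5"
  let ?\<chi> = "\<lambda>m x. cutoff (\<delta> (2 ^ m) x)"
  let ?C = "cutoff_radius \<sigma>"
  have \<chi>: "?\<chi> m \<in> test_functions UNIV" for m by (rule scaled_cutoff_test) simp
  \<comment> \<open>\<open>carre_du_champ_le\<close> splits the mixed term. Only derivatives of the
    cutoff carry the factor 4^m, and 1 \<le> 4^m lets the remaining terms share it.\<close>
  have pt: "\<bar>L_adj (\<lambda>x. \<phi> x * ?\<chi> m x) x\<bar> \<le> 4 ^ m * B * indicat_real {x. N x \<le> ?C * inverse (2 ^ m)} x" for m x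
  proof (cases "N x \<le> ?C * inverse (2 ^ m)")
    case True
    have four: "(2 ^ m)\<^sup>2 = (4 :: real) ^ m" "1 \<le> (4 :: real) ^ m"
      by (simp_all add: power2_eq_square power_mult_distrib[symmetric])
    have L: "L_adj (?\<chi> m) x = 4 ^ m * L_adj cutoff (\<delta> (2 ^ m) x)"
      using L_adj_dilation[OF smooth_cutoff, of "2 ^ m" x] four by simp
    have G: "carre_du_champ A (?\<chi> m) (?\<chi> m) x = 4 ^ m * carre_du_champ A cutoff cutoff (\<delta> (2 ^ m) x)"
      using carre_du_champ_dilation[OF smooth_cutoff smooth_cutoff, of "2 ^ m" x] four by simp
    have "\<bar>L_adj (\<lambda>x. \<phi> x * ?\<chi> m x) x\<bar> \<le> \<bar>\<phi> x * L_adj (?\<chi> m) x\<bar> + \<bar>?\<chi> m x * L_adj \<phi> x\<bar> + 2 * \<bar>carre_du_champ A \<phi> (?\<chi> m) x\<bar>"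
      unfolding adj.op_L_mult[OF open_UNIV test_functions_Ck[OF \<phi>] test_functions_Ck[OF \<chi>] UNIV_I]
      by linarith
    also have "\<bar>\<phi> x * L_adj (?\<chi> m) x\<bar> \<le> B1 * (4 ^ m * B4)"
      unfolding abs_mult L using B1 B4 by (intro mult_mono) auto
    also have "\<bar>?\<chi> m x * L_adj \<phi> x\<bar> \<le> 1 * B2"
      unfolding abs_mult by (intro mult_mono B2) (auto simp: cutoff_bounds)
    also have "2 * \<bar>carre_du_champ A \<phi> (?\<chi> m) x\<bar> \<le> B3 + 4 ^ m * B5"
    proof -
      have "carre_du_champ A (?\<chi> m) (?\<chi> m) x \<le> 4 ^ m * B5" unfolding G by (intro mult_left_mono B5) simp
      then show ?thesis using carre_du_champ_le[of \<phi> "?\<chi> m" x] B3(2)[of x] by linarith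
    qed
    also have "B1 * (4 ^ m * B4) + 1 * B2 + (B3 + 4 ^ m * B5) \<le> 4 ^ m * B"
    proof -
      have "1 * (B2 + B3) \<le> 4 ^ m * (B2 + B3)" using four(2) B2(1) B3(1) by (intro mult_right_mono) auto
      then show ?thesis by (simp add: B_def algebra_simps)
    qed
    finally show ?thesis using True by simp
  next
    case False
    have "L_adj (\<lambda>x. \<phi> x * ?\<chi> m x) x = L_adj (\<lambda>_. 0) x"
    proof (rule op_L_cong[OF open_N_less(2)[of "?C * inverse (2 ^ m)"]])
      show "x \<in> {x. ?C * inverse (2 ^ m) < N x}" using False by simp
      fix y assume "y \<in> {x. ?C * inverse (2 ^ m) < N x}"
      then have "?C < N (\<delta> (2 ^ m) y)" by (simp add: N_\<delta> field_simps)
      then show "\<phi> y * ?\<chi> m y = 0" by (simp add: cutoff_eq_0[of \<sigma>, OF \<sigma>_pos])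
    qed
    then show ?thesis using False by simp
  qed
  have bound: "(LINT x|lebesgue. \<bar>L_adj (\<lambda>x. \<phi> x * ?\<chi> m x) x\<bar>) \<le> (B * (?C powr Q * unit_volume)) * (2 powr (2 - Q)) ^ m" for m
  proof -
    have i: "integrable lebesgue (\<lambda>x. 4 ^ m * B * indicat_real {x. N x \<le> ?C * inverse (2 ^ m)} x)"
      by (intro integrable_mult_right integrable_indicator_ball)
    have "(LINT x|lebesgue. \<bar>L_adj (\<lambda>x. \<phi> x * ?\<chi> m x) x\<bar>) \<le> (LINT x|lebesgue. 4 ^ m * B * indicat_real {x. N x \<le> ?C * inverse (2 ^ m)} x)"
      by (rule integral_mono_AE'[OF i]) (rule AE_I2, rule pt, rule AE_I2, rule order_trans[OF abs_ge_zero pt])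
    also have "\<dots> = 4 ^ m * B * ((?C * inverse (2 ^ m)) powr Q * unit_volume)"
      using integral_indicator_ball[of "?C * inverse (2 ^ m)"] cutoff_radius_pos[of \<sigma>] by simp
    also have "(?C * inverse (2 ^ m)) powr Q = ?C powr Q * (2 powr (- Q)) ^ m"
    proof -
      have "inverse (2 ^ m) powr Q = (2 powr (- Q)) ^ m"
        by (simp add: powr_realpow[symmetric] powr_minus[symmetric] powr_powr algebra_simps)
      then show ?thesis using cutoff_radius_pos[of \<sigma>] by (simp add: powr_mult)
    qed
    also have "4 ^ m * B * (?C powr Q * (2 powr (- Q)) ^ m * unit_volume)
        = (B * (?C powr Q * unit_volume)) * (4 * 2 powr (- Q)) ^ m"
      by (simp add: power_mult_distrib)
    also have "4 * 2 powr (- Q) = 2 powr (2 - Q)"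
      using powr_add[of 2 2 "- Q"] by simp
    finally show ?thesis .
  qed
  have "(\<lambda>m. (B * (?C powr Q * unit_volume)) * (2 powr (2 - Q)) ^ m) \<longlonglongrightarrow> 0"
    using Q by (intro tendsto_mult_right_zero LIMSEQ_power_zero) (simp add: powr_less_one)
  then show ?thesis
    by (rule tendsto_sandwich[OF _ _ tendsto_const, rotated 2])
      (intro always_eventually allI bound Bochner_Integration.integral_nonneg abs_ge_zero)+
qed

theorem exists_Lp_subsolution:
  assumes hypo: "hypoelliptic A b" and Q: "2 < Q" and p: "1 + 2 / (Q - 2) < p"
  shows "\<exists>u. in_Lp p u \<and> (\<forall>x. u x \<le> 0) \<and> \<not> (AE x in lebesgue. u x = 0) \<and> weak_L_nonneg A b u"
proof -
  have "0 < 2 / (Q - 2)" using Q by simp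
  with p have p1: "1 < p" by linarith
  have pQ: "Q / p < Q - 2"
  proof -
    have "Q < p * (Q - 2)" using p Q by (simp add: field_simps)
    then show ?thesis using p1 by (simp add: field_simps)
  qed
  \<comment> \<open>The first entry gives 3 g + 2 < Q for the maximum principle; the second keeps
    \<gamma> above Q/p, so that decay of order \<gamma> is p-integrable at infinity.\<close>
  define g where "g = min ((Q - 2) / 4) ((Q - 2 - Q / p) / 2)"
  define \<gamma> where "\<gamma> = Q - 2 - g"
  have "g \<le> (Q - 2) / 4" unfolding g_def by (rule min.cobounded1)
  then have "4 * g \<le> Q - 2" by (simp add: field_simps)
  then have g2: "3 * g + 2 < Q" using Q pQ by argo
  have g1: "0 < g" using Q pQ by (simp add: g_def)
  note g = g1 g2
  have "g \<le> (Q - 2 - Q / p) / 2" unfolding g_def by (rule min.cobounded2)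
  then have \<gamma>p: "Q / p < \<gamma>" using pQ by (simp add: \<gamma>_def field_simps)
  have \<gamma>1: "Q < \<gamma> * p" using \<gamma>p p1 by (simp add: field_simps)
  have \<gamma>2: "0 < \<gamma>" by (rule less_trans[OF _ \<gamma>p]) (use p1 Q in simp)
  note \<gamma> = \<gamma>1 \<gamma>2
  obtain v where v: "smooth_on (- {0}) v" "\<And>x. x \<noteq> 0 \<Longrightarrow> 0 \<le> v x" "\<And>x. x \<noteq> 0 \<Longrightarrow> op_L A b v x \<le> 0"
    "\<And>x. x \<noteq> 0 \<Longrightarrow> v (\<delta> 2 x) = 2 powr (- \<gamma>) * v x" and "\<exists>x. x \<noteq> 0 \<and> 0 < v x"
    using exists_homogeneous_supersolution[OF hypo g] unfolding \<gamma>_def by blast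
  then obtain x\<^sub>0 where x0: "x\<^sub>0 \<noteq> 0" "0 < v x\<^sub>0" by blast
  have o: "open (- {0 :: real ^ 'n})" by auto
  have vc: "continuous_on (- {0}) v" by (rule Ck_on_continuous[OF smooth_onD[OF v(1)]])
  obtain C where C: "0 < C" "\<And>x. x \<noteq> 0 \<Longrightarrow> v x \<le> C * N x powr (- \<gamma>)"
    using homogeneous_decay[OF vc v(4)] \<gamma>(2) by (metis less_imp_le)
  \<comment> \<open>For t \<ge> 0 it stays below both t and 1: the decay of \<open>v\<close>
    survives and a blow-up at the origin does not.\<close>
  let ?F = "\<lambda>t :: real. t / (1 + t)"
  have F1: "(?F has_real_derivative 1 / (1 + t)\<^sup>2) (at t)" if "t \<in> {-1<..}" for t
    using that by (auto intro!: derivative_eq_intros simp: power2_eq_square field_simps)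
  have F2: "((\<lambda>t. 1 / (1 + t)\<^sup>2) has_real_derivative - 2 / (1 + t) ^ 3) (at t)" if "t \<in> {-1<..}" for t :: real
  proof -
    have eq: "- (2 * s) / (s\<^sup>2 * s\<^sup>2) = - 2 / s ^ 3" if "s \<noteq> 0" for s :: real
      using that by (simp add: field_simps power2_eq_square power3_eq_cube)
    have s: "1 + t \<noteq> 0" using that by auto
    have "((\<lambda>t. 1 / (1 + t)\<^sup>2) has_real_derivative - (2 * (1 + t)) / ((1 + t)\<^sup>2 * (1 + t)\<^sup>2)) (at t)"
      using s by (auto intro!: derivative_eq_intros)
    then show ?thesis unfolding eq[OF s] .
  qed
  have F3: "continuous_on {-1<..} (\<lambda>t :: real. - 2 / (1 + t) ^ 3)"
    by (auto intro!: continuous_intros)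
  have v_image: "v ` (- {0}) \<subseteq> {-1<..}" using v(2) by force
  have ch: "Ck_on 2 (\<lambda>y. ?F (v y)) (- {0})"
      "op_L A b (\<lambda>y. ?F (v y)) x = 1 / (1 + v x)\<^sup>2 * op_L A b v x + - 2 / (1 + v x) ^ 3 * carre_du_champ A v v x"
    if "x \<noteq> 0" for x
  proof -
    have "x \<in> - {0}" using that by simp
    note chain = op_L_chain[OF o smooth_onD[OF v(1)] this open_greaterThan v_image F1 F2 F3]
    show "Ck_on 2 (\<lambda>y. ?F (v y)) (- {0})" by (rule chain(1)) assumption+
    show "op_L A b (\<lambda>y. ?F (v y)) x = 1 / (1 + v x)\<^sup>2 * op_L A b v x + - 2 / (1 + v x) ^ 3 * carre_du_champ A v v x"
      by (rule chain(2)) assumption+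
  qed
  have LF: "op_L A b (\<lambda>y. ?F (v y)) x \<le> 0" if "x \<noteq> 0" for x
  proof -
    have "1 / (1 + v x)\<^sup>2 * op_L A b v x \<le> 0" by (rule mult_nonneg_nonpos[OF _ v(3)[OF that]]) simp
    moreover have "- 2 / (1 + v x) ^ 3 * carre_du_champ A v v x \<le> 0"
      by (rule mult_nonpos_nonneg[OF _ carre_du_champ_nonneg]) (use v(2)[OF that] in simp)
    ultimately show ?thesis unfolding ch(2)[OF that] by (rule add_nonpos_nonpos)
  qed
  \<comment> \<open>The smooth representation says nothing about \<open>v\<close> at the origin, so
    the value 0 is prescribed there.\<close>
  define w where "w x = indicat_real (- {0}) x * ?F (v x)" for x
  have w: "0 \<le> w x" "w x \<le> 1" for x
    using v(2)[of x] by (auto simp: w_def indicator_def)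
  have wv: "w x \<le> v x" if "x \<noteq> 0" for x
    using v(2)[OF that] that by (simp add: w_def field_simps)
  have wm: "w \<in> borel_measurable lebesgue"
  proof -
    have "(\<lambda>x. indicator (- {0}) x *\<^sub>R ?F (v x)) \<in> borel_measurable borel"
      using v(2) by (intro borel_measurable_continuous_on_indicator continuous_intros vc) force+
    then show ?thesis unfolding w_def by (intro measurable_completion) simp
  qed
  have Lp: "integrable lebesgue (\<lambda>x. w x powr p)"
    by (rule integrable_decay[OF wm w order_trans[OF wv C(2)] C(1) \<gamma>(2) _ \<gamma>(1)]) (use p1 in auto)
  show ?thesis
  proof (intro exI[of _ "\<lambda>x. - w x"] conjI allI)
    show "in_Lp p (\<lambda>x. - w x)" using wm Lp w(1) by (simp add: in_Lp_def)
    show "- w x \<le> 0" for x using w(1) by simp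
    show "\<not> (AE x in lebesgue. - w x = 0)"
    proof
      assume "AE x in lebesgue. - w x = 0"
      then have "AE x in lebesgue. x \<in> - {0} \<longrightarrow> ?F (v x) = 0" by eventually_elim (auto simp: w_def indicator_def)
      then have "?F (v x\<^sub>0) = 0"
        by (rule AE_zero_imp_zero[OF o Ck_on_continuous[OF ch(1)[OF x0(1)]]]) (use x0 in simp)
      then show False using x0 by simp
    qed
    show "weak_L_nonneg A b (\<lambda>x. - w x)"
      unfolding weak_L_nonneg_def
    proof (intro conjI ballI impI)
      have loc: "(\<lambda>x. - w x) absolutely_integrable_on K" if K: "compact K" for K
      proof -
        have "K \<in> sets lebesgue" using lmeasurable_compact[OF K] by (rule fmeasurableD)
        then have "integrable lebesgue (\<lambda>x. indicator K x * - w x)"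
          using wm w by (intro integrable_lebesgue_compact[OF _ K, of _ 1] borel_measurable_times
              borel_measurable_indicator borel_measurable_uminus) (auto simp: indicator_def)
        then show ?thesis by (simp add: set_integrable_def)
      qed
      then show L1: "L1_loc (\<lambda>x. - w x)" using wm by (simp add: L1_loc_def)
      fix \<phi> :: "real ^ 'n \<Rightarrow> real" assume \<phi>: "\<phi> \<in> test_functions UNIV" and nn: "\<forall>x. 0 \<le> \<phi> x"
      let ?\<chi> = "\<lambda>m x. cutoff (\<delta> (2 ^ m) x)"
      let ?I = "LINT x|lebesgue. - w x * L_adj \<phi> x"
      have "- (LINT x|lebesgue. \<bar>L_adj (\<lambda>x. \<phi> x * ?\<chi> m x) x\<bar>) \<le> ?I" for m
      proof -
        have \<chi>: "?\<chi> m \<in> test_functions UNIV" by (rule scaled_cutoff_test) simp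
        have in1: "(\<lambda>x. \<phi> x * ?\<chi> m x) \<in> test_functions UNIV"
          by (rule test_functions_mult[OF test_functions_smooth[OF \<phi>] \<chi>])
        \<comment> \<open>This part of \<open>\<phi>\<close> lives off the origin, where the
          pointwise inequality \<open>LF\<close> can be integrated by parts. The other part shrinks
          to the origin, and 0 \<le> w \<le> 1 bounds its pairing by the integral treated in
          \<open>shrinking_cutoff_tendsto_0\<close>.\<close>
        let ?\<psi> = "\<lambda>x. \<phi> x * (1 - ?\<chi> m x)"
        obtain K where K: "compact K" "\<And>x. x \<notin> K \<Longrightarrow> \<phi> x = 0" using test_functionsE[OF \<phi>] by metis
        have "closed {x. inverse (2 ^ m) \<le> N x}"
          using continuous_on_hnorm[of \<sigma> UNIV, OF \<sigma>_pos] by (intro closed_Collect_le continuous_intros)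
        then have K': "compact (K \<inter> {x. inverse (2 ^ m) \<le> N x})" "K \<inter> {x. inverse (2 ^ m) \<le> N x} \<subseteq> - {0}"
          using K(1) by (auto simp: not_le)
        have \<psi>0: "?\<psi> x = 0" if "x \<notin> K \<inter> {x. inverse (2 ^ m) \<le> N x}" for x
        proof (cases "x \<in> K")
          case True
          then have "N x < inverse (2 ^ m)" using that by simp
          then have "N (\<delta> (2 ^ m) x) \<le> 1" by (simp add: N_\<delta> field_simps)
          then show ?thesis by (simp add: cutoff_eq_1[of \<sigma>, OF \<sigma>_pos])
        qed (simp add: K(2))
        have \<psi>C: "smooth_on UNIV ?\<psi>"
          by (intro smooth_onI Ck_on_mult Ck_on_diff Ck_on_const open_UNIV test_functions_Ck[OF \<phi>] test_functions_Ck[OF \<chi>])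
        have \<psi>: "?\<psi> \<in> punctured_tests" by (rule test_functionsI[OF \<psi>C K' \<psi>0])
        have L\<psi>: "L_adj ?\<psi> \<in> punctured_tests" by (rule adj.test_functions_op_L[OF \<psi>])
        have "L_adj ?\<psi> 0 = 0" using test_functionsE[OF L\<psi>] by (metis ComplD singletonI subsetD)
        then have "w x * L_adj ?\<psi> x = ?F (v x) * L_adj ?\<psi> x" for x by (cases "x = 0") (auto simp: w_def)
        then have "(LINT x|lebesgue. w x * L_adj ?\<psi> x) = (LINT x|lebesgue. ?F (v x) * L_adj ?\<psi> x)" by simp
        also have "\<dots> = (LINT x|lebesgue. ?\<psi> x * op_L A b (\<lambda>y. ?F (v y)) x)"
          by (rule integration_by_parts(1)[OF divergence_b o ch(1)[OF x0(1)] smooth_onD[OF \<psi>C] K' \<psi>0])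
        also have "\<dots> \<le> 0"
        proof -
          have "?\<psi> x * op_L A b (\<lambda>y. ?F (v y)) x \<le> 0" for x
          proof (cases "x = 0")
            case True
            have "?\<psi> x = 0" by (rule \<psi>0) (use True K'(2) in blast)
            then show ?thesis by (simp only: mult_zero_left order_refl)
          next
            case False
            have "0 \<le> ?\<psi> x"
              by (intro mult_nonneg_nonneg nn[rule_format]) (simp add: cutoff_bounds)
            then show ?thesis using LF[OF False] by (rule mult_nonneg_nonpos)
          qed
          then have "0 \<le> (LINT x|lebesgue. - (?\<psi> x * op_L A b (\<lambda>y. ?F (v y)) x))"
            by (intro Bochner_Integration.integral_nonneg) simp
          then show ?thesis by simp
        qed
        finally have 1: "(LINT x|lebesgue. w x * L_adj ?\<psi> x) \<le> 0" .
        have int: "integrable lebesgue (\<lambda>x. - w x * L_adj \<eta> x)" if "\<eta> \<in> test_functions UNIV" for \<eta>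
          by (rule L1_loc_times_test_integrable[OF loc adj.test_functions_op_L[OF that]])
        have i1: "integrable lebesgue (\<lambda>x. - w x * L_adj ?\<psi> x)"
          by (rule int[OF test_functions_mono[OF \<psi> subset_UNIV]])
        have i2: "integrable lebesgue (\<lambda>x. - w x * L_adj (\<lambda>x. \<phi> x * ?\<chi> m x) x)" by (rule int[OF in1])
        have i3: "integrable lebesgue (\<lambda>x. \<bar>L_adj (\<lambda>x. \<phi> x * ?\<chi> m x) x\<bar>)"
          by (intro integrable_abs test_functions_integrable[OF adj.test_functions_op_L[OF in1]])
        have "L_adj \<phi> x = L_adj ?\<psi> x + L_adj (\<lambda>x. \<phi> x * ?\<chi> m x) x" for x
          using adj.op_L_add[OF open_UNIV smooth_onD[OF \<psi>C] test_functions_Ck[OF in1] UNIV_I, of x]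
          by (simp add: algebra_simps)
        then have "?I = (LINT x|lebesgue. - w x * L_adj ?\<psi> x + - w x * L_adj (\<lambda>x. \<phi> x * ?\<chi> m x) x)"
          by (simp only: distrib_left)
        also have "\<dots> = (LINT x|lebesgue. - w x * L_adj ?\<psi> x) + (LINT x|lebesgue. - w x * L_adj (\<lambda>x. \<phi> x * ?\<chi> m x) x)"
          by (rule Bochner_Integration.integral_add[OF i1 i2])
        finally have split: "?I = - (LINT x|lebesgue. w x * L_adj ?\<psi> x) + (LINT x|lebesgue. - w x * L_adj (\<lambda>x. \<phi> x * ?\<chi> m x) x)"
          by simp
        have "(LINT x|lebesgue. - \<bar>L_adj (\<lambda>x. \<phi> x * ?\<chi> m x) x\<bar>) \<le> (LINT x|lebesgue. - w x * L_adj (\<lambda>x. \<phi> x * ?\<chi> m x) x)"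
        proof (rule integral_mono[OF integrable_minus[OF i3] i2])
          fix x
          have "\<bar>w x * L_adj (\<lambda>x. \<phi> x * ?\<chi> m x) x\<bar> \<le> \<bar>L_adj (\<lambda>x. \<phi> x * ?\<chi> m x) x\<bar>"
            using w[of x] by (simp add: abs_mult mult_left_le_one_le)
          then show "- \<bar>L_adj (\<lambda>x. \<phi> x * ?\<chi> m x) x\<bar> \<le> - w x * L_adj (\<lambda>x. \<phi> x * ?\<chi> m x) x" by simp
        qed
        then show ?thesis using split 1 by simp
      qed
      then have "0 \<le> ?I"
        using tendsto_minus[OF shrinking_cutoff_tendsto_0[OF \<phi> Q]]
        by (intro tendsto_upperbound[of "\<lambda>m. - (LINT x|lebesgue. \<bar>L_adj (\<lambda>x. \<phi> x * ?\<chi> m x) x\<bar>)" 0 sequentially]) auto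
      then show "0 \<le> (LINT x|lebesgue. - w x * op_L_adj A b \<phi> x)" by (simp add: op_L_adj_test[OF \<phi>])
    qed
  qed
qed

end

theorem theorem1p4:
  fixes A :: "real ^ ('n::{finite,linorder}) \<Rightarrow> real ^ ('n::{finite,linorder}) ^ ('n::{finite,linorder})"
    and b :: "real ^ ('n::{finite,linorder}) \<Rightarrow> real ^ ('n::{finite,linorder})"
    and G :: "(real ^ ('n::{finite,linorder})) monoid"
    and \<sigma> :: "('n::{finite,linorder}) \<Rightarrow> real"
    and Q :: real
  assumes "admissible_operator G A b"
    and "homogeneous_group G \<sigma>"
    and "Q = homogeneous_dim \<sigma>"
    and "Q \<ge> 3"
    and "homogeneous_degree_two \<sigma> A b"
  shows "(\<forall>u p. L1_loc u \<and> weak_L_nonneg A b u \<and> p \<in> {1 .. 1 + 2 / (Q - 2)} \<and> in_Lp p u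
             \<longrightarrow> (AE x in lebesgue. u x = 0))
       \<and> (\<forall>p::real. p > 1 + 2 / (Q - 2) \<longrightarrow>
            (\<exists>u. in_Lp p u \<and> (\<forall>x. u x \<le> 0) \<and> \<not> (AE x in lebesgue. u x = 0) \<and> weak_L_nonneg A b u))"
proof -
  have adm: "\<And>i j. smooth_on UNIV (\<lambda>x. A x $ i $ j)" "\<And>j. smooth_on UNIV (\<lambda>x. b x $ j)"
    "\<And>x. transpose (A x) = A x" "\<And>x \<xi>. 0 \<le> (A x *v \<xi>) \<bullet> \<xi>" "hypoelliptic A b"
    "lie_group_Rn G" "left_translation_invariant G A b" "lebesgue_bi_invariant G"
    using assms(1) by (auto simp: admissible_operator_def)
  have sym: "A x $ i $ j = A x $ j $ i" for x i j
    by (subst adm(3)[of x, symmetric]) (simp add: transpose_def)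
  have "1 \<le> \<sigma> i" for i using assms(2) by (simp add: homogeneous_group_def)
  then interpret homogeneous_operator A b \<sigma>
    by unfold_locales (rule adm(1,2,4) sym assms(5) | assumption)+
  have Q: "2 < homogeneous_dim \<sigma>" using assms(3,4) by simp
  show ?thesis
    unfolding assms(3)
    using Lp_weak_subsolution_zero[OF adm(6,8,7) homogeneous_group_one[OF assms(2)] adm(5)]
      exists_Lp_subsolution[OF adm(5) Q] Q by auto
qed

end
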